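(* Let $u_L^*=(v_L^*,w_L^* )\in\mathcal H_1$, $u_R^*=(v_R^*,w_R^* )\in\mathcal H_3$ be such that the Riemann problem with data $u_L^*$ (left), $u_R^*$ (right) is solved by a single phase boundary of speed $V^*$ and no contact discontinuity; if $V^*=c_3$, assume $w_L^*=0$ and $w_R^*=\sqrt{\phi'(c_3)/c_3}$. There exist $\delta>0$ and a constant $O(1)$ such that, for all $u_L^0\in BV_{loc}(\mathbb R_-,\mathcal H_1)$, $u_R^0\in BV_{loc}(\mathbb R_+,\mathcal H_3)$ with $\|u_L^0-u_L^*\|_{BV(\mathbb R_-)}+\|u_R^0-u_R^*\|_{BV(\mathbb R_+)}\le\delta$, the functions $u^h$ given by Glimm's scheme applied to the initial data $u_0=u_L^0$ for $x<0$, $u_0=u_R^0$ for $x>0$ satisfy, for all $t\ge0$, $t'\ge0$, $$TV_{-\infty}^{+\infty}\big((u^h-\tilde u^h)(t)\big)\le O(1)N_1,$$ $$\|u^h(t)-\tilde u^h(t)\|_{L^\infty(\mathbb R)}\le O(1)(N_1+N_2),$$ $$\|u^h(t)-u^h(t')\|_{L^1(\mathbb R)}\le O(1)N_1\big(|t-t'|+h\big),$$ where $N_2=\|u_L^0-u_L^*\|_{L^\infty(\mathbb R_-)}+\|u_R^0-u_R^*\|_{L^\infty(\mathbb R_+)}$, and $N_1=TV_{-\infty}^0(u_L^0)+TV_0^\infty(u_R^0)$ if $V^*\ne c_3$, $N_1=TV_{-\infty}^0(u_L^0)+TV_0^\infty(u_R^0)+N_2$ if $V^*=c_3$. Here $\tilde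 u^h(t,x)=u_L^*$ if $x<\chi^h(t)$, $u_R^*$ if $x>\chi^h(t)$, where $\chi^h$ is the approximate phase boundary in $u^h$.
   Context: Notation: $]a,b[$ is the open interval; $\|f\|_{BV(\Omega)}=\|f\|_{L^1(\Omega)}+TV_\Omega(f)$. System $\partial_tw-\partial_xv=0$, $\partial_tv-\partial_x\sigma(w)=0$, $u=(v,w)$. Let $k_1>k_3>0$, $w_m>w_M>0$, $c_1=\sqrt{k_1}$, $c_3=\sqrt{k_3}$. $\sigma:]-1,\infty[\to\mathbb R$ is $\sigma(w)=k_1w$ for $-1<w\le w_M$, $\sigma(w)=k_3w$ for $w\ge w_m$, and affine on $[w_M,w_m]$ joining these values continuously. $\mathcal H_1=\{(v,w):v\in\mathbb R,-1<w\le w_M\}$, $\mathcal H_3=\{(v,w):v\in\mathbb R,w\ge w_m\}$, $\mathcal H=\mathcal H_1\cup\mathcal H_3$. Entropy dissipation function. $\phi:]-c_3,c_3]\to\mathbb R$ is given with: $\phi\in C^2(]-c_3,0[\cup]0,c_3])$ and $\phi(0\pm),\phi'(0\pm)$ exist; $\lim_{V\to c_3^-}\phi=\overline\psi(c_3)$ and $\phi'''(c_3-)$ exists; $\lim_{V\to-c_3^+}\phi=-\infty$; $\phi$ is increasing; $\underline\psi(V)\le\phi(V)\le0$ for $V\in]-c_3,0]$ and $0\le\phi(V)\le\overline\psi(V)$ for $V\in[0,c_3]$, where $\underline\psi(V)=\frac{k_1-k_3}2w_M\big(w_m-\frac{k_1-V^2}{k_3-V^2}w_M\big)$ and $\overline\psi(V)=\frac{k_1-k_3}2w_m\big(w_M-\frac{k_3-V^2}{k_1-V^2}w_m\big)$.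 If $\phi$ jumps at $0$, then at $V=0$ "$=\phi(0)$" is understood as membership in $[\phi(0-),\phi(0+)]$. Riemann solver $R(u_\ell,u_r)$ (self-similar in $x/t$) for states near $u_L^*$ or $u_R^*$. (i) $u_\ell,u_r$ both in $\mathcal H_i$ ($i=1$ or $3$): with $h=\frac{w_\ell+w_r}2+\frac{v_r-v_\ell}{2c_i}$, the states $u_\ell$, $(v_\ell+c_i(h-w_\ell),h)$, $u_r$ separated by contacts of speeds $-c_i,c_i$ (the paper takes for granted that $(\cdot,h)\in\mathcal H_i$ for the states considered, so that no new phase is created). (ii) $u_\ell\in\mathcal H_1$, $u_r\in\mathcal H_3$: let $h=\frac{c_1w_\ell+c_3w_r+v_r-v_\ell}{c_1+c_3}$. If $h>0$: states $u_\ell,u_-\in\mathcal H_1$, $u_+\in\mathcal H_3$, $u_r$ separated by discontinuities of speeds $-c_1<V<c_3$, $V\in]-c_3,c_3[$, where $w_-=\frac{c_3+V}{c_1+V}h$, $v_-=v_\ell+c_1(w_--w_\ell)$, $w_+=\frac{c_1-V}{c_3-V}h$, $v_+=v_r+c_3(w_r-w_+)$, and $V$ solves $\frac{k_1-k_3}2\{w_Mw_m-w_-w_+\}=\phi(V)$. If $h\le0$: states $u_\ell,u_-\in\mathcal H_1,u_r$ separated by a contact of speed $-c_1$ and a phase boundary of speed $V\in[c_3,c_1[$, determined by the Rankine–Hugoniot relations. Glimm's scheme. Mesh sizes $\tau,h>0$ with $h/\tau$ constant and $\tau c_1<h$; $\{a_n\}_{n\ge1}\subset]-1,1[$ is an equidistributed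 sequence. $u^h(0,x)=\frac1{2h}\int_{mh}^{(m+2)h}u_0(y)dy$ for $x\in[mh,(m+2)h[$, $m$ even; $u^h(n\tau+0,x)=u^h(n\tau-0,(m+1+a_n)h-0)$ for $x\in[mh,(m+2)h[$, $m+n$ even; for $n\tau\le t<(n+1)\tau$, $u^h$ is obtained by solving the Riemann problems centered at $x=mh$, $m+n$ even, with the solver $R$. At each time $u^h(t,\cdot)$ has exactly one jump from $\mathcal H_1$ to $\mathcal H_3$; its position $\chi^h(t)$ is the approximate phase boundary ($\chi^h$ is affine on each $[n\tau,(n+1)\tau[$ and may jump at $t=n\tau$).
   Formalization: The third estimate is false as printed (for data u_L^*, u_R^* one has N_1=0 but the boundary moves); it is replaced by the bound O(1)N_1(|t-t'|+h) for u^h-ũ^h and by O(1)(N_1+|u_R^*-u_L^*|)(|t-t'|+h) for u^h. *)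

theory Defs
  imports "HOL-Analysis.Analysis" "HOL-Probability.Essential_Supremum"
begin

section \<open>Norms and total variation\<close>

text \<open>All norms take values in \<^typ>\<open>ennreal\<close>, so that no finiteness convention is hidden in them.\<close>

text \<open>Pointwise total variation. Every BV class has a representative (e.g. the right-continuous
  one) whose pointwise variation is the variation of the class.\<close>

definition TV :: "real set \<Rightarrow> (real \<Rightarrow> 'a::real_normed_vector) \<Rightarrow> ennreal" where
  "TV A f = (SUP (n, x) \<in> {(n::nat, x::nat \<Rightarrow> real). x ` {..n} \<subseteq> A \<and> mono_on {..n} x}.
               \<Sum>i<n. ennreal (norm (f (x (Suc i)) - f (x i))))"

definition L1_norm :: "real set \<Rightarrow> (real \<Rightarrow> 'a::real_normed_vector) \<Rightarrow> ennreal" where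
  "L1_norm A f = (\<integral>\<^sup>+x\<in>A. ennreal (norm (f x)) \<partial>lborel)"

definition Linf_norm :: "real set \<Rightarrow> (real \<Rightarrow> 'a::real_normed_vector) \<Rightarrow> ennreal" where
  "Linf_norm A f = e2ennreal (esssup (restrict_space lborel A) (\<lambda>x. ereal (norm (f x))))"

definition BV_norm :: "real set \<Rightarrow> (real \<Rightarrow> 'a::real_normed_vector) \<Rightarrow> ennreal" where
  "BV_norm A f = L1_norm A f + TV A f"

definition BV_loc :: "real set \<Rightarrow> 'a set \<Rightarrow> (real \<Rightarrow> 'a::real_normed_vector) set" where
  "BV_loc A S = {f. f ` A \<subseteq> S \<and> (\<forall>a b. {a..b} \<subseteq> A \<longrightarrow> TV {a..b} f < \<infinity>)}"

definition equidistributed :: "(nat \<Rightarrow> real) \<Rightarrow> bool" where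
  "equidistributed a \<longleftrightarrow> (\<forall>n\<ge>1. a n \<in> {-1<..<1}) \<and>
     (\<forall>\<alpha> \<beta>. -1 \<le> \<alpha> \<longrightarrow> \<alpha> < \<beta> \<longrightarrow> \<beta> \<le> 1 \<longrightarrow>
        (\<lambda>N. real (card {n\<in>{1..N}. a n \<in> {\<alpha><..<\<beta>}}) / real N) \<longlonglongrightarrow> (\<beta> - \<alpha>) / 2)"


section \<open>Self-similar wave fans\<close>

text \<open>A state is the pair \<open>(v, w)\<close>.\<close>

type_synonym state = "real \<times> real"

text \<open>A fan \<open>(u, [(s\<^sub>1, u\<^sub>1), \<dots>, (s\<^sub>n, u\<^sub>n)])\<close> consists of constant states \<open>u, u\<^sub>1, \<dots>, u\<^sub>n\<close>
  (from left to right), the state \<open>u\<^sub>i\<close> having on its left a discontinuity of speed \<open>s\<^sub>i\<close>;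
  the speeds are increasing.\<close>

type_synonym fan = "state \<times> (real \<times> state) list"

text \<open>The value of a fan centred at the origin at the point \<open>x\<close> and time \<open>t \<ge> 0\<close>. It is
  right-continuous in \<open>x\<close>, and for \<open>t = 0\<close> it is the Riemann datum.\<close>

definition fan_value :: "fan \<Rightarrow> real \<Rightarrow> real \<Rightarrow> state" where
  "fan_value F t x = fold (\<lambda>(s, u') u. if s * t \<le> x then u' else u) (snd F) (fst F)"


section \<open>The phase transition model\<close>

locale phase_model =
  fixes k1 k3 wM wm :: real and \<phi> :: "real \<Rightarrow> real"
begin

abbreviation c1 :: real where "c1 \<equiv> sqrt k1"
abbreviation c3 :: real where "c3 \<equiv> sqrt k3"

text \<open>Only the values on \<open>]-1, \<infinity>[\<close> are meaningful.\<close>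

definition \<sigma> :: "real \<Rightarrow> real" where
  "\<sigma> w = (if w \<le> wM then k1 * w
          else if wm \<le> w then k3 * w
          else k1 * wM + (k3 * wm - k1 * wM) / (wm - wM) * (w - wM))"

definition H1 :: "state set" where
  "H1 = {(v, w). -1 < w \<and> w \<le> wM}"

definition H3 :: "state set" where
  "H3 = {(v, w). wm \<le> w}"

subsection \<open>Entropy dissipation function\<close>

definition psi_lower :: "real \<Rightarrow> real" where
  "psi_lower V = (k1 - k3) / 2 * wM * (wm - (k1 - V\<^sup>2) / (k3 - V\<^sup>2) * wM)"

definition psi_upper :: "real \<Rightarrow> real" where
  "psi_upper V = (k1 - k3) / 2 * wm * (wM - (k3 - V\<^sup>2) / (k1 - V\<^sup>2) * wm)"

text \<open>The derivatives at \<open>c\<^sub>3\<close> are one-sided; the third one is taken as the left derivative of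
  \<open>\<phi>''\<close> at \<open>c\<^sub>3\<close>, which exists in particular if \<open>\<phi>'''\<close> has a left limit there.\<close>

definition entropy_dissipation :: bool where
  "entropy_dissipation \<longleftrightarrow>
     (\<exists>\<phi>' \<phi>''. let D = {-c3<..<0} \<union> {0<..c3} in
        (\<forall>V\<in>D. (\<phi> has_real_derivative \<phi>' V) (at V within D)) \<and>
        (\<forall>V\<in>D. (\<phi>' has_real_derivative \<phi>'' V) (at V within D)) \<and>
        continuous_on D \<phi>'' \<and>
        (\<exists>l. (\<phi> \<longlongrightarrow> l) (at_left 0)) \<and> (\<exists>l. (\<phi> \<longlongrightarrow> l) (at_right 0)) \<and>
        (\<exists>l. (\<phi>' \<longlongrightarrow> l) (at_left 0)) \<and> (\<exists>l. (\<phi>' \<longlongrightarrow> l) (at_right 0)) \<and>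
        (\<exists>l. (\<phi>'' has_real_derivative l) (at_left c3))) \<and>
     (\<phi> \<longlongrightarrow> psi_upper c3) (at_left c3) \<and>
     filterlim \<phi> at_bot (at_right (- c3)) \<and>
     mono_on {-c3<..c3} \<phi> \<and>
     (\<forall>V\<in>{-c3<..0}. psi_lower V \<le> \<phi> V \<and> \<phi> V \<le> 0) \<and>
     (\<forall>V\<in>{0..c3}. 0 \<le> \<phi> V \<and> \<phi> V \<le> psi_upper V)"

text \<open>The relation \<open>y = \<phi>(V)\<close>, with the jump of \<open>\<phi>\<close> at \<open>0\<close> filled in.
  If \<open>\<phi>\<close> is continuous at \<open>0\<close>, the second case reduces to \<open>y = \<phi>(0)\<close>.\<close>

definition kinetic_relation :: "real \<Rightarrow> real \<Rightarrow> bool" where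
  "kinetic_relation V y \<longleftrightarrow>
     (if V \<noteq> 0 then y = \<phi> V else y \<in> {Lim (at_left 0) \<phi> .. Lim (at_right 0) \<phi>})"

subsection \<open>Riemann solver\<close>

definition rankine_hugoniot :: "real \<Rightarrow> state \<Rightarrow> state \<Rightarrow> bool" where
  "rankine_hugoniot s ul ur \<longleftrightarrow>
     - s * (snd ur - snd ul) = fst ur - fst ul \<and>
     - s * (fst ur - fst ul) = \<sigma> (snd ur) - \<sigma> (snd ul)"

text \<open>\<open>riemann u\<^sub>\<ell> u\<^sub>r F\<close>: the solver resolves the data \<open>u\<^sub>\<ell>, u\<^sub>r\<close> by the fan \<open>F\<close>. The intermediate
  state between two states of one phase is required to lie in that phase, so the solver is a
  partial (single-valued) function that never creates a new phase.\<close>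

inductive riemann :: "state \<Rightarrow> state \<Rightarrow> fan \<Rightarrow> bool" where
  phase1: "riemann (vl, wl) (vr, wr)
      ((vl, wl), [(- c1, (vl + c1 * (h - wl), h)), (c1, (vr, wr))])"
    if "(vl, wl) \<in> H1" "(vr, wr) \<in> H1"
       "h = (wl + wr) / 2 + (vr - vl) / (2 * c1)"
       "(vl + c1 * (h - wl), h) \<in> H1"
| phase3: "riemann (vl, wl) (vr, wr)
      ((vl, wl), [(- c3, (vl + c3 * (h - wl), h)), (c3, (vr, wr))])"
    if "(vl, wl) \<in> H3" "(vr, wr) \<in> H3"
       "h = (wl + wr) / 2 + (vr - vl) / (2 * c3)"
       "(vl + c3 * (h - wl), h) \<in> H3"
| boundary_kinetic: "riemann (vl, wl) (vr, wr)
      ((vl, wl), [(- c1, (v', w')), (V, (v'', w'')), (c3, (vr, wr))])"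
    if "(vl, wl) \<in> H1" "(vr, wr) \<in> H3"
       "h = (c1 * wl + c3 * wr + vr - vl) / (c1 + c3)" "h > 0"
       "V \<in> {-c3<..<c3}"
       "w' = (c3 + V) / (c1 + V) * h" "v' = vl + c1 * (w' - wl)" "(v', w') \<in> H1"
       "w'' = (c1 - V) / (c3 - V) * h" "v'' = vr + c3 * (wr - w'')" "(v'', w'') \<in> H3"
       "kinetic_relation V ((k1 - k3) / 2 * (wM * wm - w' * w''))"
| boundary_supersonic: "riemann (vl, wl) (vr, wr)
      ((vl, wl), [(- c1, (v', w')), (V, (vr, wr))])"
    if "(vl, wl) \<in> H1" "(vr, wr) \<in> H3"
       "h = (c1 * wl + c3 * wr + vr - vl) / (c1 + c3)" "h \<le> 0"
       "V \<in> {c3..<c1}"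
       "(v', w') \<in> H1"
       "rankine_hugoniot (- c1) (vl, wl) (v', w')"
       "rankine_hugoniot V (v', w') (vr, wr)"

text \<open>The Riemann problem is solved by one phase boundary, all contacts being trivial.\<close>

definition single_phase_boundary :: "state \<Rightarrow> state \<Rightarrow> real \<Rightarrow> bool" where
  "single_phase_boundary uL uR V \<longleftrightarrow> uL \<in> H1 \<and> uR \<in> H3 \<and>
     (riemann uL uR (uL, [(- c1, uL), (V, uR), (c3, uR)]) \<or>
      riemann uL uR (uL, [(- c1, uL), (V, uR)]))"

subsection \<open>Glimm's scheme\<close>

text \<open>\<open>u t x\<close> is the approximation with mesh sizes \<open>\<tau>\<close> (time) and \<open>h\<close> (space). The second clause is
  \<open>u(n\<tau>+0, x) = u(n\<tau>-0, (m+1+a\<^sub>n)h-0)\<close>. In the third clause, \<open>u (n\<tau>)\<close> is constant on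
  \<open>[(m-2)h, mh[\<close> and on \<open>[mh, (m+2)h[\<close>, so its values at \<open>(m-1)h\<close> and \<open>mh\<close> are the Riemann data
  at \<open>mh\<close>.\<close>

definition glimm_approximation ::
  "real \<Rightarrow> real \<Rightarrow> (nat \<Rightarrow> real) \<Rightarrow> (real \<Rightarrow> state) \<Rightarrow> (real \<Rightarrow> real \<Rightarrow> state) \<Rightarrow> bool" where
  "glimm_approximation \<tau> h a u0 u \<longleftrightarrow>
     (\<forall>m::int. even m \<longrightarrow>
        (\<forall>x\<in>{of_int m * h..<(of_int m + 2) * h}.
           u 0 x = (1 / (2 * h)) *\<^sub>R
             (LINT y:{of_int m * h..<(of_int m + 2) * h}|lborel. u0 y))) \<and>
     (\<forall>(n::nat) (m::int). n \<ge> 1 \<longrightarrow> even (m + int n) \<longrightarrow>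
        (\<forall>x\<in>{of_int m * h..<(of_int m + 2) * h}.
           u (real n * \<tau>) x =
             Lim (at_left ((of_int m + 1 + a n) * h)) (\<lambda>y. Lim (at_left (real n * \<tau>)) (\<lambda>t. u t y)))) \<and>
     (\<forall>(n::nat) (m::int). even (m + int n) \<longrightarrow>
        (\<exists>F. riemann (u (real n * \<tau>) ((of_int m - 1) * h)) (u (real n * \<tau>) (of_int m * h)) F \<and>
           (\<forall>t\<in>{real n * \<tau>..<(real n + 1) * \<tau>}. \<forall>x\<in>{(of_int m - 1) * h..<(of_int m + 1) * h}.
              u t x = fan_value F (t - real n * \<tau>) (x - of_int m * h))))"

text \<open>\<open>chi t\<close> is the position of the only jump of \<open>u t\<close> from \<open>H1\<close> to \<open>H3\<close>.\<close>

definition phase_boundary :: "(real \<Rightarrow> real \<Rightarrow> state) \<Rightarrow> (real \<Rightarrow> real) \<Rightarrow> bool" where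
  "phase_boundary u chi \<longleftrightarrow>
     (\<forall>t\<ge>0. (\<forall>x<chi t. u t x \<in> H1) \<and> (\<forall>x>chi t. u t x \<in> H3))"

end

end

theory Submission
  imports Defs
begin

text \<open>In each phase the system is linear: the invariants \<open>p = v + c w\<close> and \<open>q = v - c w\<close> are merely
  transported, so on either side of the phase boundary one step of the scheme shifts sequences. Seen from
  the boundary the scheme acts on four sequences (\<open>p, q\<close> on the left and on the right): a step removes
  the first entry of an incoming sequence or puts in front of an outgoing one the value emitted by the
  boundary. The emitted values are Lipschitz functions of the incoming ones; at the sonic state
  \<open>V = c\<^sub>3\<close> this uses the second order Taylor expansion of \<open>\<phi>\<close>. Hence the variation of the outgoing
  sequences, plus the strength of the wave the boundary is about to emit, plus a multiple of the variation
  of the incoming sequences does not increase. When the boundary is supersonic it overtakes waves on its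
  right, which then act on it with a strength proportional to the negative part \<open>\<eta>\<close> of \<open>h\<close>; the
  additional term \<open>\<eta>\<close> times the variation of these waves accounts for them. Finally, on a half-line a
  function with finite \<open>L\<^sup>1\<close> norm has infimum \<open>0\<close>, so the variation of the data also bounds
  their distance to the base states and \<open>N\<^sub>2\<close> never exceeds the variation.\<close>

section \<open>Total variation and measurability\<close>

text \<open>Waves reach the boundary at every time step, so the estimates must not accumulate in
  time. A triangular structure makes this possible. The incoming sequences (\<open>q\<close> on the
  left, \<open>p\<close> on the right) only lose entries. The \<open>q\<close> emitted to the right
  depends on their first entries alone, and \<open>W1\<close> bounds the right outgoing sequence.
  The \<open>p\<close> emitted to the left depends also on the first right outgoing entry, but only
  with a factor \<open>\<eta>\<close>. This would make the estimate quadratic; the bound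
  \<open>svar QR \<le> 1\<close> obtained from \<open>W1\<close> turns it into a linear one for
  \<open>W2\<close>. The Lipschitz bound for the speed comes from the monotonicity of
  \<open>\<phi>\<close> and a lower bound for the slope of \<open>PP\<close>, so a jump of
  \<open>\<phi>\<close> at \<open>0\<close> is harmless. It degenerates in the sonic case, where
  \<open>V\<close> tends to \<open>c3\<close> as \<open>h\<close> tends to \<open>0\<close> and
  \<open>w_plus\<close> is a quotient of two quantities tending to \<open>0\<close>. Its limit is
  \<open>sqrt (\<phi>'(c3) / c3)\<close>, precisely the strain prescribed there for the right base
  state; with it the emitted \<open>q\<close> continues across \<open>h = 0\<close> without a
  jump.\<close>

lemma TV_sum_le:
  assumes "x ` {..n} \<subseteq> A" "mono_on {..n::nat} x"
  shows "(\<Sum>i<n. ennreal (norm (f (x (Suc i)) - f (x i)))) \<le> TV A f"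
  unfolding TV_def using assms by (intro SUP_upper2[of "(n, x)"]) auto

lemma TV_sum_le_real:
  assumes "TV A f \<le> ennreal T" "0 \<le> T" "x ` {..n} \<subseteq> A" "mono_on {..n::nat} x"
  shows "(\<Sum>i<n. norm (f (x (Suc i)) - f (x i))) \<le> T"
proof -
  have "ennreal (\<Sum>i<n. norm (f (x (Suc i)) - f (x i))) \<le> ennreal T"
    using order_trans[OF TV_sum_le[OF assms(3,4), of f] assms(1)] by (simp add: sum_ennreal)
  then show ?thesis using assms(2) by (simp add: ennreal_le_iff)
qed

lemma TV_dist_le:
  assumes "TV A f \<le> ennreal T" "0 \<le> T" "x \<in> A" "y \<in> A"
  shows "norm (f x - f y) \<le> T"
proof -
  have *: "norm (f b - f a) \<le> T" if "a \<le> b" "a \<in> A" "b \<in> A" for a b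
  proof -
    have "(\<lambda>i. if i = 0 then a else b) ` {..1::nat} \<subseteq> A" "mono_on {..1::nat} (\<lambda>i. if i = 0 then a else b)"
      using that by (auto simp: mono_on_def)
    from TV_sum_le_real[OF assms(1,2) this] show ?thesis by simp
  qed
  show ?thesis
    using *[of x y] *[of y x] assms(3,4) by (cases "x \<le> y") (auto simp: norm_minus_commute)
qed

text \<open>The increments of \<open>G\<close> telescope, so a \<open>G\<close> with values in
  \<open>[0, B]\<close> that dominates the increments of \<open>f\<close> bounds its variation. It
  is applied to profiles of the scheme with an explicit \<open>G\<close>.\<close>

lemma TV_leI:
  assumes "\<And>x y. x \<in> A \<Longrightarrow> y \<in> A \<Longrightarrow> x \<le> y \<Longrightarrow> norm (f y - f x) \<le> G y - G x"
    and "\<And>x. x \<in> A \<Longrightarrow> 0 \<le> G x \<and> G x \<le> B"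
  shows "TV A f \<le> ennreal B"
  unfolding TV_def
proof (rule SUP_least, clarify)
  fix n :: nat and x :: "nat \<Rightarrow> real"
  assume x: "x ` {..n} \<subseteq> A" "mono_on {..n} x"
  have "(\<Sum>i<n. norm (f (x (Suc i)) - f (x i))) \<le> (\<Sum>i<n. G (x (Suc i)) - G (x i))"
    using x by (intro sum_mono assms(1)) (auto simp: mono_on_def)
  also have "\<dots> = G (x n) - G (x 0)" by (rule sum_lessThan_telescope)
  also have "\<dots> \<le> B" using assms(2)[of "x n"] assms(2)[of "x 0"] x(1) by force
  finally show "(\<Sum>i<n. ennreal (norm (f (x (Suc i)) - f (x i)))) \<le> ennreal B"
    by (simp add: sum_ennreal ennreal_leI)
qed

lemma TV_diff_const: "TV A (\<lambda>x. f x - c) = TV A f"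
  by (simp add: TV_def)

lemma TV_mono_set: "A \<subseteq> B \<Longrightarrow> TV A f \<le> TV B f"
  unfolding TV_def by (rule SUP_subset_mono) auto

lemma TV_atMost_add_le:
  assumes "x \<in> A" "y \<in> A" "x \<le> y"
  shows "TV (A \<inter> {..x}) f + ennreal (norm (f y - f x)) \<le> TV (A \<inter> {..y}) f"
proof -
  let ?S = "{(n::nat, p::nat \<Rightarrow> real). p ` {..n} \<subseteq> A \<inter> {..x} \<and> mono_on {..n} p}"
  have ne: "?S \<noteq> {}"
  proof -
    have "(0, \<lambda>_. x) \<in> ?S" using assms by (auto simp: mono_on_def)
    then show ?thesis by blast
  qed
  have "(SUP (n, p)\<in>?S. (\<Sum>i<n. ennreal (norm (f (p (Suc i)) - f (p i))))) + ennreal (norm (f y - f x))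
     = (SUP q\<in>?S. (case q of (n, p) \<Rightarrow> \<Sum>i<n. ennreal (norm (f (p (Suc i)) - f (p i)))) + ennreal (norm (f y - f x)))"
    by (rule ennreal_SUP_add_left[symmetric, OF ne])
  also have "\<dots> \<le> TV (A \<inter> {..y}) f"
  proof (rule SUP_least, clarify)
    fix n :: nat and p :: "nat \<Rightarrow> real"
    assume p: "p ` {..n} \<subseteq> A \<inter> {..x}" "mono_on {..n} p"
    \<comment> \<open>Continue the subdivision by \<open>x\<close> and then \<open>y\<close>; the
      increment from its last point to \<open>x\<close> is dropped at the end.\<close>
    define q where "q = (\<lambda>i. if i \<le> n then p i else if i = Suc n then x else y)"
    have q: "q ` {..Suc (Suc n)} \<subseteq> A \<inter> {..y}"
      using p assms by (auto simp: q_def)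
    have "mono_on {..Suc (Suc n)} q"
      using p assms unfolding mono_on_def q_def by (auto simp: le_Suc_eq intro: order_trans)
    from TV_sum_le[OF q this, of f]
    have "(\<Sum>i<n. ennreal (norm (f (q (Suc i)) - f (q i)))) + ennreal (norm (f (q (Suc n)) - f (q n)))
        + ennreal (norm (f (q (Suc (Suc n))) - f (q (Suc n)))) \<le> TV (A \<inter> {..y}) f"
      by simp
    moreover have "(\<Sum>i<n. ennreal (norm (f (q (Suc i)) - f (q i)))) = (\<Sum>i<n. ennreal (norm (f (p (Suc i)) - f (p i))))"
      by (intro sum.cong) (auto simp: q_def)
    moreover have "ennreal (norm (f (q (Suc (Suc n))) - f (q (Suc n)))) = ennreal (norm (f y - f x))"
      by (simp add: q_def)
    ultimately have "(\<Sum>i<n. ennreal (norm (f (p (Suc i)) - f (p i)))) + ennreal (norm (f (q (Suc n)) - f (q n)))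
        + ennreal (norm (f y - f x)) \<le> TV (A \<inter> {..y}) f"
      by simp
    then show "(\<Sum>i<n. ennreal (norm (f (p (Suc i)) - f (p i)))) + ennreal (norm (f y - f x)) \<le> TV (A \<inter> {..y}) f"
      by (rule order_trans[rotated]) (intro add_right_mono, simp)
  qed
  finally show ?thesis by (simp add: TV_def)
qed

text \<open>By the Jordan decomposition \<open>f = W - (W - f)\<close> into monotone functions.\<close>

lemma TV_finite_measurable_real:
  fixes f :: "real \<Rightarrow> real"
  assumes "TV A f < \<infinity>"
  shows "f \<in> borel_measurable (restrict_space borel A)"
proof -
  define W where "W x = enn2real (TV (A \<inter> {..x}) f)" for x
  have fin: "TV (A \<inter> {..x}) f < \<infinity>" for x
    using assms TV_mono_set[of "A \<inter> {..x}" A f] by (auto intro: le_less_trans)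
  have W: "\<bar>f y - f x\<bar> \<le> W y - W x" if "x \<in> A" "y \<in> A" "x \<le> y" for x y
  proof -
    have "enn2real (TV (A \<inter> {..x}) f + ennreal \<bar>f y - f x\<bar>) \<le> W y"
      unfolding W_def using TV_atMost_add_le[OF that, of f] fin[of y] by (intro enn2real_mono) auto
    then show ?thesis using fin[of x] by (simp add: W_def enn2real_plus)
  qed
  have 1: "mono_on A W" "mono_on A (\<lambda>x. W x - f x)"
    by (auto intro!: mono_onI) (use W in force)+
  have "(\<lambda>x. W x - (W x - f x)) \<in> borel_measurable (restrict_space borel A)"
    by (intro borel_measurable_diff borel_measurable_mono_on_fnc 1)
  then show ?thesis by simp
qed

lemma TV_le_of_increments:
  assumes "\<And>x y. x \<in> A \<Longrightarrow> y \<in> A \<Longrightarrow> norm (g x - g y) \<le> norm (f x - f y)"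
  shows "TV A g \<le> TV A f"
  unfolding TV_def
proof (intro SUP_mono, clarify)
  fix n :: nat and x :: "nat \<Rightarrow> real"
  assume x: "x ` {..n} \<subseteq> A" "mono_on {..n} x"
  have "(\<Sum>i<n. ennreal (norm (g (x (Suc i)) - g (x i)))) \<le> (\<Sum>i<n. ennreal (norm (f (x (Suc i)) - f (x i))))"
    using x by (intro sum_mono ennreal_leI assms) auto
  then show "\<exists>m\<in>{(n, x). x ` {..n} \<subseteq> A \<and> mono_on {..n} x}.
      (\<Sum>i<n. ennreal (norm (g (x (Suc i)) - g (x i))))
      \<le> (case m of (n, x) \<Rightarrow> \<Sum>i<n. ennreal (norm (f (x (Suc i)) - f (x i))))"
    using x by (intro bexI[of _ "(n, x)"]) auto
qed

text \<open>Measurability of the data is derived, not assumed: finite pointwise variation supplies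
  it, first for the cell averages and later for the approximations themselves.\<close>

lemma TV_finite_measurable:
  fixes f :: "real \<Rightarrow> real \<times> real"
  assumes "TV A f < \<infinity>"
  shows "f \<in> borel_measurable (restrict_space borel A)"
proof -
  have "norm (fst (f x) - fst (f y)) \<le> norm (f x - f y)" "norm (snd (f x) - snd (f y)) \<le> norm (f x - f y)" for x y
    using norm_fst_le[of "fst (f x - f y)" "snd (f x - f y)"] norm_snd_le[of "snd (f x - f y)" "fst (f x - f y)"]
    unfolding prod.collapse by simp_all
  then have "TV A (\<lambda>x. fst (f x)) < \<infinity>" "TV A (\<lambda>x. snd (f x)) < \<infinity>"
    using assms TV_le_of_increments[of A "\<lambda>x. fst (f x)" f] TV_le_of_increments[of A "\<lambda>x. snd (f x)" f]
    by (auto intro: le_less_trans)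
  from this[THEN TV_finite_measurable_real]
  have "(\<lambda>x. (fst (f x), snd (f x))) \<in> borel_measurable (restrict_space borel A)"
    by (rule borel_measurable_Pair)
  then show ?thesis by simp
qed

text \<open>On a set of infinite measure an integrable function comes arbitrarily close to zero.\<close>

lemma TV_sup_bound:
  assumes "L1_norm A (\<lambda>x. f x - u) < \<infinity>" "TV A f \<le> ennreal T" "0 \<le> T"
    and A: "A \<in> sets lborel" "emeasure lborel A = \<infinity>" and x: "x \<in> A"
  shows "norm (f x - u) \<le> T"
proof (rule field_le_epsilon)
  fix e :: real assume e: "0 < e"
  have "\<exists>y\<in>A. norm (f y - u) < e"
  proof (rule ccontr)
    assume "\<not> ?thesis"
    then have "(\<integral>\<^sup>+y. ennreal e * indicator A y \<partial>lborel) \<le> L1_norm A (\<lambda>x. f x - u)"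
      unfolding L1_norm_def
      by (intro nn_integral_mono) (auto simp: indicator_def not_less intro!: ennreal_leI)
    moreover have "(\<integral>\<^sup>+y. ennreal e * indicator A y \<partial>lborel) = \<infinity>"
      using A e by (simp add: nn_integral_cmult_indicator ennreal_mult_top)
    ultimately show False using assms(1) by simp
  qed
  then obtain y where y: "y \<in> A" "norm (f y - u) < e" by blast
  have "norm (f x - u) \<le> norm (f x - f y) + norm (f y - u)"
    using norm_triangle_ineq[of "f x - f y" "f y - u"] by simp
  also have "\<dots> \<le> T + e" using TV_dist_le[OF assms(2,3) x y(1)] y(2) by linarith
  finally show "norm (f x - u) \<le> T + e" .
qed

lemma emeasure_lborel_half_line:
  "emeasure lborel {a::real<..} = \<infinity>" "emeasure lborel {..<a::real} = \<infinity>"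
proof -
  have "ennreal (real n) \<le> emeasure lborel {a<..}" "ennreal (real n) \<le> emeasure lborel {..<a}" for n
    using emeasure_mono[of "{a<..<a + real n}" "{a<..}" lborel]
      emeasure_mono[of "{a - real n<..<a}" "{..<a}" lborel] by (auto simp: subset_eq)
  then show "emeasure lborel {a<..} = \<infinity>" "emeasure lborel {..<a} = \<infinity>"
    by (metis ennreal_of_nat_eq_real_of_nat ennreal_Ex_less_of_nat infinity_ennreal_def less_top not_less)+
qed

section \<open>Cell averages\<close>

text \<open>Open cells are used because the cell [0, 2h[ contains the point \<open>0\<close>, which
  lies in neither half-line carrying the data. The scheme averages over half-open cells, which
  differ by a null set (\<open>mean_half_open\<close>).\<close>

definition mean :: "real \<Rightarrow> (real \<Rightarrow> 'a::euclidean_space) \<Rightarrow> real \<Rightarrow> 'a" where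
  "mean l f c = (1 / l) *\<^sub>R (LINT y:{c<..<c + l}|lborel. f y)"

text \<open>One number \<open>T\<close> bounds both the variation and the distance from the base
  state; on a half-line \<open>TV_sup_bound\<close> derives the second bound from the first.\<close>

locale bv_near =
  fixes A :: "real set" and f :: "real \<Rightarrow> real \<times> real" and u :: "real \<times> real" and T l :: real
  assumes A: "A \<in> sets borel" and TV_le: "TV A f \<le> ennreal T" and T: "0 \<le> T"
    and near: "\<And>x. x \<in> A \<Longrightarrow> norm (f x - u) \<le> T" and l: "0 < l"
begin

lemma integrable_cell:
  assumes "{c<..<c + l} \<subseteq> A"
  shows "set_integrable lborel {c<..<c + l} f"
proof -
  have "f \<in> borel_measurable (restrict_space borel A)"
    using TV_le by (intro TV_finite_measurable) (auto intro: le_less_trans)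
  then have "(\<lambda>x. indicator A x *\<^sub>R f x) \<in> borel_measurable borel"
    using A by (subst (asm) borel_measurable_restrict_space_iff) auto
  moreover have "emeasure lborel {c<..<c + l} < \<infinity>"
    using l by (simp add: emeasure_lborel_Ioo)
  ultimately have "integrable lborel (\<lambda>x. indicator {c<..<c + l} x *\<^sub>R (indicator A x *\<^sub>R f x))"
  proof (intro integrableI_bounded_set_indicator[where B = "T + norm u"])
    show "AE x in lborel. x \<in> {c<..<c + l} \<longrightarrow> norm (indicator A x *\<^sub>R f x) \<le> T + norm u"
    proof (intro AE_I2 impI)
      fix x assume "x \<in> {c<..<c + l}"
      then have "x \<in> A" using assms by auto
      then show "norm (indicator A x *\<^sub>R f x) \<le> T + norm u"
        using near[of x] norm_triangle_sub[of "f x" u] by simp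
    qed
  qed auto
  moreover have "indicator {c<..<c + l} x *\<^sub>R (indicator A x *\<^sub>R f x) = indicator {c<..<c + l} x *\<^sub>R f x" for x
    using assms by (auto simp: indicator_def)
  ultimately show ?thesis by (simp only: set_integrable_def)
qed

text \<open>All averages are moved to the common interval ]0, l[, so that a difference of averages
  becomes the average of differences at a common offset \<open>s\<close>.\<close>

lemma mean_shift:
  assumes "{c<..<c + l} \<subseteq> A"
  shows "set_integrable lborel {0<..<l} (\<lambda>s. f (c + s))"
    and "mean l f c = (1 / l) *\<^sub>R (LINT s:{0<..<l}|lborel. f (c + s))"
proof -
  have ind: "indicator {c<..<c + l} (c + s) = (indicator {0<..<l} s :: real)" for s
    by (auto simp: indicator_def)
  show "set_integrable lborel {0<..<l} (\<lambda>s. f (c + s))"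
    using lborel_integrable_real_affine[of "\<lambda>x. indicator {c<..<c + l} x *\<^sub>R f x" 1 c]
      integrable_cell[OF assms] by (simp add: set_integrable_def ind)
  show "mean l f c = (1 / l) *\<^sub>R (LINT s:{0<..<l}|lborel. f (c + s))"
    unfolding mean_def set_lebesgue_integral_def
    by (subst lborel_integral_real_affine[of 1 _ c]) (simp_all add: ind)
qed

lemma integrable_const: "set_integrable lborel {0<..<l} (\<lambda>s. a::'b::euclidean_space)"
  unfolding set_integrable_def using l
  by (intro integrable_scaleR_left integrable_real_indicator) (auto simp: emeasure_lborel_Ioo)

lemma const_mean: "(1 / l) *\<^sub>R (LINT s:{0<..<l}|lborel. (a::'b::euclidean_space)) = a"
  using l by (simp add: set_lebesgue_integral_def)

lemma mean_near:
  assumes "{c<..<c + l} \<subseteq> A"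
  shows "norm (mean l f c - u) \<le> T"
proof -
  note i = mean_shift(1)[OF assms]
  note iu = integrable_const[of u]
  have "mean l f c - u = (1 / l) *\<^sub>R (LINT s:{0<..<l}|lborel. f (c + s) - u)"
    using i iu by (simp add: mean_shift(2)[OF assms] set_integral_diff scaleR_right_diff_distrib const_mean)
  also have "norm \<dots> = (1 / l) * norm (LINT s:{0<..<l}|lborel. f (c + s) - u)"
    using l by simp
  also have "\<dots> \<le> (1 / l) * (LINT s:{0<..<l}|lborel. norm (f (c + s) - u))"
    using l by (intro mult_left_mono set_integral_norm_bound set_integral_diff i iu) auto
  also have "\<dots> \<le> (1 / l) * (LINT s:{0<..<l}|lborel. T)"
    using l assms near
    by (intro mult_left_mono set_integral_mono set_integrable_norm set_integral_diff i iu)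
      (auto simp: integrable_const subset_eq)
  also have "\<dots> = T" using const_mean[of T] by simp
  finally show ?thesis .
qed

text \<open>The conditions \<open>w \<le> wM\<close> and \<open>wm \<le> w\<close> survive
  averaging, so the averaged data respect these limits of their phase.\<close>

lemma snd_mean:
  assumes "{c<..<c + l} \<subseteq> A"
  shows "\<And>B. (\<And>x. x \<in> A \<Longrightarrow> snd (f x) \<le> B) \<Longrightarrow> snd (mean l f c) \<le> B"
    and "\<And>B. (\<And>x. x \<in> A \<Longrightarrow> B \<le> snd (f x)) \<Longrightarrow> B \<le> snd (mean l f c)"
proof -
  note i = mean_shift(1)[OF assms]
  have isnd: "set_integrable lborel {0<..<l} (\<lambda>s. snd (f (c + s)))"
    using integrable_bounded_linear[OF bounded_linear_snd i[unfolded set_integrable_def]]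
    by (simp add: set_integrable_def)
  have eq: "snd (mean l f c) = (1 / l) * (LINT s:{0<..<l}|lborel. snd (f (c + s)))"
    using integral_bounded_linear[OF bounded_linear_snd i[unfolded set_integrable_def]]
    by (simp add: mean_shift(2)[OF assms] set_lebesgue_integral_def)
  note ic = integrable_const
  {
    fix B assume B: "\<And>x. x \<in> A \<Longrightarrow> snd (f x) \<le> B"
    have "snd (mean l f c) \<le> (1 / l) * (LINT s:{0<..<l}|lborel. B)"
      unfolding eq using l B assms by (intro mult_left_mono set_integral_mono isnd ic) (auto simp: subset_eq)
    then show "snd (mean l f c) \<le> B" using const_mean[of B] by simp
  next
    fix B assume B: "\<And>x. x \<in> A \<Longrightarrow> B \<le> snd (f x)"
    have "(1 / l) * (LINT s:{0<..<l}|lborel. B) \<le> snd (mean l f c)"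
      unfolding eq using l B assms by (intro mult_left_mono set_integral_mono isnd ic) (auto simp: subset_eq)
    then show "B \<le> snd (mean l f c)" using const_mean[of B] by simp
  }
qed

text \<open>For a fixed offset \<open>s\<close> the points \<open>c i + s\<close> are ordered, so
  the increments of \<open>f\<close> along them sum to at most the variation; averaging over
  \<open>s\<close> keeps the bound. The decreasing case serves the cells on the left, which are
  numbered away from the boundary.\<close>

lemma mean_variation:
  assumes c: "\<And>i::nat. {c i<..<c i + l} \<subseteq> A" "mono c \<or> antimono c"
  shows "(\<Sum>i<n. norm (mean l f (c (Suc i)) - mean l f (c i))) \<le> T"
proof -
  note i = mean_shift(1)[OF c(1)]
  have id: "set_integrable lborel {0<..<l} (\<lambda>s. f (c (Suc i) + s) - f (c i + s))" for i
    by (intro set_integral_diff i)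
  have "norm (mean l f (c (Suc i)) - mean l f (c i))
      \<le> (1 / l) * (LINT s:{0<..<l}|lborel. norm (f (c (Suc i) + s) - f (c i + s)))" for i
  proof -
    have "mean l f (c (Suc i)) - mean l f (c i) = (1 / l) *\<^sub>R (LINT s:{0<..<l}|lborel. f (c (Suc i) + s) - f (c i + s))"
      using i by (simp add: mean_shift(2)[OF c(1)] set_integral_diff scaleR_right_diff_distrib)
    also have "norm \<dots> = (1 / l) * norm (LINT s:{0<..<l}|lborel. f (c (Suc i) + s) - f (c i + s))"
      using l by simp
    also have "\<dots> \<le> (1 / l) * (LINT s:{0<..<l}|lborel. norm (f (c (Suc i) + s) - f (c i + s)))"
      using l by (intro mult_left_mono set_integral_norm_bound id) auto
    finally show ?thesis .
  qed
  then have "(\<Sum>i<n. norm (mean l f (c (Suc i)) - mean l f (c i)))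
     \<le> (\<Sum>i<n. (1 / l) * (LINT s:{0<..<l}|lborel. norm (f (c (Suc i) + s) - f (c i + s))))"
    by (intro sum_mono)
  also have "\<dots> = (1 / l) * (LINT s:{0<..<l}|lborel. (\<Sum>i<n. norm (f (c (Suc i) + s) - f (c i + s))))"
    unfolding set_lebesgue_integral_def scaleR_sum_right
    using set_integrable_norm[OF id]
    by (subst Bochner_Integration.integral_sum) (simp_all add: sum_distrib_left set_integrable_def)
  also have "\<dots> \<le> (1 / l) * (LINT s:{0<..<l}|lborel. T)"
  proof (intro mult_left_mono set_integral_mono)
    show "set_integrable lborel {0<..<l} (\<lambda>s. \<Sum>i<n. norm (f (c (Suc i) + s) - f (c i + s)))"
      using set_integrable_norm[OF id] unfolding set_integrable_def scaleR_sum_right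
      by (intro Bochner_Integration.integrable_sum) auto
    show "set_integrable lborel {0<..<l} (\<lambda>s. T)" by (rule integrable_const)
    fix s assume s: "s \<in> {0<..<l}"
    have inA: "c i + s \<in> A" for i using c(1)[of i] s by auto
    from c(2) show "(\<Sum>i<n. norm (f (c (Suc i) + s) - f (c i + s))) \<le> T"
    proof
      assume "mono c"
      then show ?thesis
        by (intro TV_sum_le_real[OF TV_le T, of "\<lambda>i. c i + s"]) (auto simp: mono_on_def monoD inA)
    next
      \<comment> \<open>Read the points backwards: the index \<open>n - i\<close> turns the
        decreasing sequence into an increasing one.\<close>
      assume "antimono c"
      then have "(\<Sum>i<n. norm (f (c (n - Suc i) + s) - f (c (n - i) + s))) \<le> T"
        by (intro TV_sum_le_real[OF TV_le T, of "\<lambda>i. c (n - i) + s"]) (auto simp: mono_on_def antimonoD inA)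
      also have "(\<Sum>i<n. norm (f (c (n - Suc i) + s) - f (c (n - i) + s)))
         = (\<Sum>i<n. norm (f (c (n - Suc i) + s) - f (c (Suc (n - Suc i)) + s)))"
        by (intro sum.cong) (auto simp: Suc_diff_Suc)
      also have "\<dots> = (\<Sum>i<n. norm (f (c (Suc i) + s) - f (c i + s)))"
        by (subst sum.nat_diff_reindex[of "\<lambda>i. norm (f (c i + s) - f (c (Suc i) + s))"]) (simp add: norm_minus_commute)
      finally show ?thesis .
    qed
  qed (use l in auto)
  also have "\<dots> = T" using const_mean[of T] by simp
  finally show ?thesis .
qed

end

lemma mean_half_open:
  assumes "set_integrable lborel {c<..<c + l} f" "0 < l"
  shows "mean l f c = (1 / l) *\<^sub>R (LINT y:{c..<c + l}|lborel. f y)"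
proof -
  have "indicator {c..<c + l} y *\<^sub>R f y = indicator {c<..<c + l} y *\<^sub>R f y + indicator {c} y *\<^sub>R f c" for y
    using assms(2) by (auto simp: indicator_def)
  moreover have "integrable lborel (\<lambda>y. indicator {c} y *\<^sub>R f c)" by simp
  ultimately have "(LINT y|lborel. indicator {c..<c + l} y *\<^sub>R f y) = (LINT y|lborel. indicator {c<..<c + l} y *\<^sub>R f y)"
    using assms(1) by (simp add: set_integrable_def)
  then show ?thesis by (simp add: mean_def set_lebesgue_integral_def)
qed

lemma mean_cong:
  assumes "\<And>y. y \<in> {c<..<c + l} \<Longrightarrow> f y = g y"
  shows "mean l f c = mean l g c"
  unfolding mean_def using set_lebesgue_integral_cong[of "{c<..<c + l}" lborel f g] assms by simp

section \<open>Variation of sequences and the interaction functional\<close>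

definition bv_seq :: "(nat \<Rightarrow> real) \<Rightarrow> bool" where
  "bv_seq s \<longleftrightarrow> summable (\<lambda>i. \<bar>s (Suc i) - s i\<bar>)"

definition svar :: "(nat \<Rightarrow> real) \<Rightarrow> real" where
  "svar s = (\<Sum>i. \<bar>s (Suc i) - s i\<bar>)"

definition cvar :: "(nat \<Rightarrow> real) \<Rightarrow> nat \<Rightarrow> real" where
  "cvar s n = (\<Sum>i<n. \<bar>s (Suc i) - s i\<bar>)"

abbreviation push :: "real \<Rightarrow> (nat \<Rightarrow> real) \<Rightarrow> nat \<Rightarrow> real" where
  "push a s \<equiv> case_nat a s"

abbreviation pop :: "(nat \<Rightarrow> real) \<Rightarrow> nat \<Rightarrow> real" where
  "pop s \<equiv> \<lambda>i. s (Suc i)"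

lemma svar_nonneg: "bv_seq s \<Longrightarrow> 0 \<le> svar s"
  unfolding bv_seq_def svar_def by (rule suminf_nonneg) auto

lemma bv_seq_pop [simp]: "bv_seq (pop s) \<longleftrightarrow> bv_seq s"
  unfolding bv_seq_def using summable_Suc_iff[of "\<lambda>i. \<bar>s (Suc i) - s i\<bar>"] by simp

lemma bv_seq_push [simp]: "bv_seq (push a s) \<longleftrightarrow> bv_seq s"
  using bv_seq_pop[of "push a s"] by simp

lemma svar_split: "bv_seq s \<Longrightarrow> svar s = \<bar>s 1 - s 0\<bar> + svar (pop s)"
  unfolding bv_seq_def svar_def by (subst suminf_split_head) auto

lemma svar_push: "bv_seq s \<Longrightarrow> svar (push a s) = \<bar>s 0 - a\<bar> + svar s"
  by (subst svar_split) auto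

lemma bv_seqI:
  assumes "\<And>n. cvar s n \<le> B"
  shows "bv_seq s" "svar s \<le> B"
proof -
  show "bv_seq s" unfolding bv_seq_def
    by (rule summableI_nonneg_bounded[of _ B]) (use assms in \<open>auto simp: cvar_def\<close>)
  then show "svar s \<le> B" unfolding bv_seq_def svar_def
    by (intro suminf_le_const) (use assms in \<open>auto simp: cvar_def\<close>)
qed

lemma cvar_le_svar: "bv_seq s \<Longrightarrow> cvar s n \<le> svar s"
  unfolding bv_seq_def svar_def cvar_def by (rule sum_le_suminf) auto

lemma cvar_nonneg: "0 \<le> cvar s n"
  by (simp add: cvar_def sum_nonneg)

lemma cvar_dist: "i \<le> j \<Longrightarrow> \<bar>s j - s i\<bar> \<le> cvar s j - cvar s i"
  by (induction j rule: dec_induct) (auto simp: cvar_def)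

text \<open>What the functional needs to know about the boundary. Here \<open>x\<close> and
  \<open>y\<close> are the first incoming entries from the left and the right, \<open>z\<close> is
  the first right outgoing entry, \<open>f\<close> is the value emitted to the left and
  \<open>g\<close> the one emitted to the right. By \<open>f_lip3\<close> the value \<open>f\<close>
  sees \<open>z\<close> only in the supersonic regime, and weakly near
  \<open>\<eta> = 0\<close>.\<close>

locale boundary_response =
  fixes f :: "real \<Rightarrow> real \<Rightarrow> real \<Rightarrow> real" and g \<eta> :: "real \<Rightarrow> real \<Rightarrow> real"
    and K r ps xs ys zs :: real
  assumes K: "1 \<le> K" and r: "0 < r"
    and f_lip: "\<And>x y z x' y'. \<bar>x - xs\<bar> \<le> r \<Longrightarrow> \<bar>y - ys\<bar> \<le> r \<Longrightarrow> \<bar>z - zs\<bar> \<le> r \<Longrightarrow>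
        \<bar>x' - xs\<bar> \<le> r \<Longrightarrow> \<bar>y' - ys\<bar> \<le> r \<Longrightarrow> \<bar>f x y z - f x' y' z\<bar> \<le> K * (\<bar>x - x'\<bar> + \<bar>y - y'\<bar>)"
    and f_lip3: "\<And>x y z z'. \<bar>x - xs\<bar> \<le> r \<Longrightarrow> \<bar>y - ys\<bar> \<le> r \<Longrightarrow> \<bar>z - zs\<bar> \<le> r \<Longrightarrow>
        \<bar>z' - zs\<bar> \<le> r \<Longrightarrow> \<bar>f x y z - f x y z'\<bar> \<le> K * \<eta> x y * \<bar>z - z'\<bar>"
    and g_lip: "\<And>x y x' y'. \<bar>x - xs\<bar> \<le> r \<Longrightarrow> \<bar>y - ys\<bar> \<le> r \<Longrightarrow>
        \<bar>x' - xs\<bar> \<le> r \<Longrightarrow> \<bar>y' - ys\<bar> \<le> r \<Longrightarrow> \<bar>g x y - g x' y'\<bar> \<le> K * (\<bar>x - x'\<bar> + \<bar>y - y'\<bar>)"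
    and \<eta>_nonneg: "\<And>x y. 0 \<le> \<eta> x y"
    and \<eta>_lip: "\<And>x y x' y'. \<bar>\<eta> x y - \<eta> x' y'\<bar> \<le> K * (\<bar>x - x'\<bar> + \<bar>y - y'\<bar>)"
    and \<eta>_le: "\<And>x y. \<bar>x - xs\<bar> \<le> r \<Longrightarrow> \<bar>y - ys\<bar> \<le> r \<Longrightarrow> \<eta> x y \<le> K"
    and f_base: "f xs ys zs = ps" and g_base: "g xs ys = zs"
begin

text \<open>The weight \<open>K\<close> pays for the change of \<open>g\<close> when an incoming
  entry is removed. In \<open>W2\<close> the part \<open>K\<close> of the weight pays in the same
  way for the change of \<open>f\<close>, and \<open>K\<^sup>2\<close> pays for the growth of the
  summand with \<open>\<eta>\<close>, once \<open>svar QR \<le> 1\<close> is known.\<close>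

definition W1 where
  "W1 QL PR QR = svar QR + \<bar>QR 0 - g (QL 0) (PR 0)\<bar> + K * (svar QL + svar PR)"

definition W2 where
  "W2 PL QL PR QR = svar PL + \<bar>PL 0 - f (QL 0) (PR 0) (QR 0)\<bar>
     + K * (\<eta> (QL 0) (PR 0) * svar QR) + (K + K\<^sup>2) * (svar QL + svar PR)"

text \<open>The last summand but one of \<open>W2\<close> pays for the change of \<open>f\<close> when the boundary overtakes waves
  on its right: that happens only while \<open>\<eta> > 0\<close>, and the change is then proportional to \<open>\<eta>\<close>.\<close>

definition invariant where
  "invariant b PL QL PR QR \<longleftrightarrow>
     bv_seq PL \<and> bv_seq QL \<and> bv_seq PR \<and> bv_seq QR \<and>
     (\<forall>i. \<bar>QL i - xs\<bar> \<le> b) \<and> (\<forall>i. \<bar>PR i - ys\<bar> \<le> b) \<and> (\<forall>i. \<bar>QR i - zs\<bar> \<le> 2 * K * b) \<and>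
     (\<forall>i. \<bar>PL i - ps\<bar> \<le> (2 * K + 2 * K ^ 3) * b) \<and>
     W1 QL PR QR \<le> (2 + 4 * K) * b \<and>
     W2 PL QL PR QR \<le> (2 + 4 * K + 3 * K\<^sup>2 + 2 * K ^ 3) * b"

text \<open>\<open>2 * K * b \<le> r\<close> keeps all arguments of \<open>f\<close> and
  \<open>g\<close> within the radius of the Lipschitz bounds; \<open>(2 + 4 * K) * b\<close> is the
  bound of \<open>W1\<close>, and its being at most \<open>1\<close> yields
  \<open>svar QR \<le> 1\<close>.\<close>

definition small where
  "small b \<longleftrightarrow> 0 \<le> b \<and> 2 * K * b \<le> r \<and> (2 + 4 * K) * b \<le> 1"

lemma smallD:
  assumes "small b"
  shows "0 \<le> b" "b \<le> r" "2 * K * b \<le> r" "b \<le> 2 * K * b"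
proof -
  show "0 \<le> b" "2 * K * b \<le> r" using assms by (auto simp: small_def)
  show "b \<le> 2 * K * b" using K \<open>0 \<le> b\<close> mult_right_mono[of 1 "2 * K" b] by simp
  then show "b \<le> r" using \<open>2 * K * b \<le> r\<close> by simp
qed

text \<open>First move \<open>x\<close> and \<open>y\<close> at fixed \<open>z\<close>, at a cost of
  \<open>2 * K * b\<close>; then move \<open>z\<close> at the base values of \<open>x\<close> and
  \<open>y\<close>, where \<open>\<eta>\<close> is at most \<open>K\<close>, at a cost of
  \<open>K * K * (2 * K * b)\<close>.\<close>

lemma f_near:
  assumes "small b" "\<bar>x - xs\<bar> \<le> b" "\<bar>y - ys\<bar> \<le> b" "\<bar>z - zs\<bar> \<le> 2 * K * b"
  shows "\<bar>f x y z - ps\<bar> \<le> (2 * K + 2 * K ^ 3) * b"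
proof -
  note b = smallD[OF assms(1)]
  have "\<bar>f x y z - f xs ys z\<bar> \<le> K * (\<bar>x - xs\<bar> + \<bar>y - ys\<bar>)"
    using assms b r by (intro f_lip) auto
  also have "\<dots> \<le> K * (b + b)" using assms K by (intro mult_left_mono) auto
  finally have 1: "\<bar>f x y z - f xs ys z\<bar> \<le> 2 * K * b" by simp
  have "\<bar>f xs ys z - f xs ys zs\<bar> \<le> K * \<eta> xs ys * \<bar>z - zs\<bar>"
    using assms b r by (intro f_lip3) auto
  also have "\<dots> \<le> K * K * (2 * K * b)"
    using \<eta>_le[of xs ys] \<eta>_nonneg[of xs ys] K r assms by (intro mult_mono) auto
  finally have "\<bar>f xs ys z - f xs ys zs\<bar> \<le> 2 * K ^ 3 * b" by (simp add: power3_eq_cube)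
  with 1 show ?thesis using f_base by (simp add: algebra_simps)
qed

lemma g_near:
  assumes "small b" "\<bar>x - xs\<bar> \<le> b" "\<bar>y - ys\<bar> \<le> b"
  shows "\<bar>g x y - zs\<bar> \<le> 2 * K * b"
proof -
  note b = smallD[OF assms(1)]
  have "\<bar>g x y - g xs ys\<bar> \<le> K * (\<bar>x - xs\<bar> + \<bar>y - ys\<bar>)"
    using assms b r by (intro g_lip) auto
  also have "\<dots> \<le> K * (b + b)" using assms K by (intro mult_left_mono) auto
  finally show ?thesis using g_base by simp
qed

text \<open>The constants in \<open>invariant\<close> originate here. For \<open>W1\<close> they are
  \<open>b\<close> for the variation of \<open>QR\<close>, \<open>b + 2 * K * b\<close> for the
  pending jump and \<open>K * (b + b)\<close> for the incoming variation; \<open>W2\<close> collects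
  \<open>b\<close>, \<open>b + (2 * K + 2 * K ^ 3) * b\<close>, \<open>K * (K * b)\<close> and
  \<open>(K + K\<^sup>2) * (b + b)\<close>.\<close>

lemma invariant_initial:
  assumes b: "small b"
    and bv: "bv_seq PL" "bv_seq QL" "bv_seq PR" "bv_seq QR"
    and s: "svar PL \<le> b" "svar QL \<le> b" "svar PR \<le> b" "svar QR \<le> b"
    and near: "\<And>i. \<bar>PL i - ps\<bar> \<le> b" "\<And>i. \<bar>QL i - xs\<bar> \<le> b" "\<And>i. \<bar>PR i - ys\<bar> \<le> b" "\<And>i. \<bar>QR i - zs\<bar> \<le> b"
  shows "invariant b PL QL PR QR"
proof -
  note b' = smallD[OF b]
  have z: "\<bar>QR i - zs\<bar> \<le> 2 * K * b" for i using near(4)[of i] b' by linarith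
  have K3: "b \<le> (2 * K + 2 * K ^ 3) * b"
    using b'(1,4) K by (simp add: distrib_right)
      (smt (verit) mult_nonneg_nonneg zero_le_power)
  have p: "\<bar>PL i - ps\<bar> \<le> (2 * K + 2 * K ^ 3) * b" for i using near(1)[of i] K3 by linarith
  have fn: "\<bar>PL 0 - f (QL 0) (PR 0) (QR 0)\<bar> \<le> b + (2 * K + 2 * K ^ 3) * b"
    using f_near[OF b near(2)[of 0] near(3)[of 0] z[of 0]] near(1)[of 0] by linarith
  have gn: "\<bar>QR 0 - g (QL 0) (PR 0)\<bar> \<le> b + 2 * K * b"
    using g_near[OF b near(2)[of 0] near(3)[of 0]] near(4)[of 0] by linarith
  have K2: "K * (svar QL + svar PR) \<le> K * (b + b)" "(K + K\<^sup>2) * (svar QL + svar PR) \<le> (K + K\<^sup>2) * (b + b)"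
    using s K by (auto intro!: mult_left_mono)
  have "\<eta> (QL 0) (PR 0) * svar QR \<le> K * b"
    using s svar_nonneg[OF bv(4)] \<eta>_le[of "QL 0" "PR 0"] \<eta>_nonneg near(2)[of 0] near(3)[of 0] b' K
    by (intro mult_mono) auto
  then have "K * (\<eta> (QL 0) (PR 0) * svar QR) \<le> K * (K * b)"
    using K by (intro mult_left_mono) auto
  moreover have "W1 QL PR QR \<le> (2 + 4 * K) * b"
    using s gn K2(1) by (simp add: W1_def algebra_simps)
  ultimately show ?thesis unfolding invariant_def
    using bv near z p s fn K2(2) by (auto simp: W2_def algebra_simps power2_eq_square)
qed

lemma invariant_svar:
  assumes "small b" "invariant b PL QL PR QR"
  shows "svar QR \<le> (2 + 4 * K) * b" "svar QR \<le> 1"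
proof -
  have "0 \<le> K * (svar QL + svar PR)"
    using assms(2) K svar_nonneg by (auto simp: invariant_def)
  then show "svar QR \<le> (2 + 4 * K) * b"
    using assms(2) by (auto simp: invariant_def W1_def)
  then show "svar QR \<le> 1" using assms(1) by (simp add: small_def)
qed

text \<open>The jump between the emitted value and \<open>PL 0\<close> passes from the second
  summand of \<open>W2\<close> into \<open>svar PL\<close>, so \<open>W2\<close> keeps its value;
  \<open>W1\<close> does not involve \<open>PL\<close>.\<close>

lemma invariant_push_left:
  assumes "small b" "invariant b PL QL PR QR"
  shows "invariant b (push (f (QL 0) (PR 0) (QR 0)) PL) QL PR QR"
  using assms f_near[OF assms(1), of "QL 0" "PR 0" "QR 0"]
  by (auto simp: invariant_def W2_def svar_push split: nat.split)

text \<open>The same exchange takes place in \<open>W1\<close>. A new first entry of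
  \<open>QR\<close> could change \<open>f\<close> and increase the summand with
  \<open>\<eta>\<close> in \<open>W2\<close>; both are excluded by \<open>\<eta> = 0\<close>, which
  holds whenever the boundary is subsonic.\<close>

lemma invariant_push_right:
  assumes "small b" "invariant b PL QL PR QR" "\<eta> (QL 0) (PR 0) = 0"
  shows "invariant b PL QL PR (push (g (QL 0) (PR 0)) QR)"
proof -
  note b = smallD[OF assms(1)]
  have d: "\<bar>QL 0 - xs\<bar> \<le> b" "\<bar>PR 0 - ys\<bar> \<le> b" "\<bar>QR 0 - zs\<bar> \<le> 2 * K * b"
    using assms(2) by (auto simp: invariant_def)
  note gn = g_near[OF assms(1) d(1,2)]
  have "\<bar>f (QL 0) (PR 0) (g (QL 0) (PR 0)) - f (QL 0) (PR 0) (QR 0)\<bar>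
      \<le> K * \<eta> (QL 0) (PR 0) * \<bar>g (QL 0) (PR 0) - QR 0\<bar>"
    using d b gn by (intro f_lip3) auto
  then have "f (QL 0) (PR 0) (g (QL 0) (PR 0)) = f (QL 0) (PR 0) (QR 0)"
    using assms(3) by simp
  then show ?thesis
    using assms(2,3) gn by (auto simp: invariant_def W1_def W2_def svar_push split: nat.split)
qed

text \<open>Removing the first wave may enlarge the pending jump to the right by at most the
  strength of that wave, which \<open>svar QR\<close> loses. The change of \<open>f\<close> is
  balanced by the loss in the summand with \<open>\<eta>\<close>.\<close>

lemma invariant_pop_right_q:
  assumes "small b" "invariant b PL QL PR QR"
  shows "invariant b PL QL PR (pop QR)"
proof -
  note b = smallD[OF assms(1)]
  have d: "\<bar>QL 0 - xs\<bar> \<le> b" "\<bar>PR 0 - ys\<bar> \<le> b" "\<bar>QR i - zs\<bar> \<le> 2 * K * b" for i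
    using assms(2) by (auto simp: invariant_def)
  have "\<bar>f (QL 0) (PR 0) (QR 0) - f (QL 0) (PR 0) (QR 1)\<bar>
      \<le> K * \<eta> (QL 0) (PR 0) * \<bar>QR 0 - QR 1\<bar>"
    using d(1,2) d(3)[of 0] d(3)[of 1] b by (intro f_lip3) auto
  then have f: "\<bar>f (QL 0) (PR 0) (QR 0) - f (QL 0) (PR 0) (QR 1)\<bar>
      \<le> K * (\<eta> (QL 0) (PR 0) * \<bar>QR 1 - QR 0\<bar>)" by (simp add: abs_minus_commute mult.assoc)
  have s: "svar QR = \<bar>QR 1 - QR 0\<bar> + svar (pop QR)"
    using assms(2) by (intro svar_split) (simp add: invariant_def)
  have "W1 QL PR (pop QR) \<le> W1 QL PR QR" using s by (simp add: W1_def)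
  moreover have "W2 PL QL PR (pop QR) \<le> W2 PL QL PR QR"
    using s f by (simp add: W2_def distrib_left)
  ultimately show ?thesis using assms(2) by (auto simp: invariant_def)
qed

text \<open>\<open>d\<close> is the strength of the wave reaching the boundary and is lost by
  \<open>svar QL + svar PR\<close>. It moves \<open>f\<close> and \<open>g\<close> and increases
  \<open>\<eta>\<close> by at most \<open>K * d\<close>; the growth of \<open>\<eta>\<close> enters
  \<open>W2\<close> multiplied by \<open>K * svar QR \<le> K\<close>.\<close>

lemma invariant_pop_incoming:
  assumes b: "small b" and inv: "invariant b PL QL PR QR"
    and upd: "QL' = QL \<and> PR' = pop PR \<or> QL' = pop QL \<and> PR' = PR"
  shows "invariant b PL QL' PR' QR"
proof -
  note b' = smallD[OF b]
  define d where "d = \<bar>QL' 0 - QL 0\<bar> + \<bar>PR' 0 - PR 0\<bar>"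
  have near: "\<bar>QL i - xs\<bar> \<le> b" "\<bar>PR i - ys\<bar> \<le> b" "\<bar>QR i - zs\<bar> \<le> 2 * K * b"
      "\<bar>QL' i - xs\<bar> \<le> b" "\<bar>PR' i - ys\<bar> \<le> b" for i
    using inv upd by (auto simp: invariant_def)
  have bv: "bv_seq PL" "bv_seq QL" "bv_seq PR" "bv_seq QR" "bv_seq QL'" "bv_seq PR'"
    using inv upd by (auto simp: invariant_def)
  have s: "svar QL + svar PR = d + (svar QL' + svar PR')"
    using upd svar_split[OF bv(2)] svar_split[OF bv(3)] by (auto simp: d_def)
  have f: "\<bar>f (QL' 0) (PR' 0) (QR 0) - f (QL 0) (PR 0) (QR 0)\<bar> \<le> K * d"
    unfolding d_def using near[of 0] b' by (intro f_lip) auto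
  have g: "\<bar>g (QL' 0) (PR' 0) - g (QL 0) (PR 0)\<bar> \<le> K * d"
    unfolding d_def using near[of 0] b' by (intro g_lip) auto
  have e: "\<eta> (QL' 0) (PR' 0) \<le> \<eta> (QL 0) (PR 0) + K * d"
    using \<eta>_lip[of "QL' 0" "PR' 0" "QL 0" "PR 0"] by (simp add: d_def)
  have d0: "0 \<le> d" by (simp add: d_def)
  have "\<eta> (QL' 0) (PR' 0) * svar QR \<le> \<eta> (QL 0) (PR 0) * svar QR + K * d * svar QR"
    using mult_right_mono[OF e svar_nonneg[OF bv(4)]] by (simp add: distrib_right)
  also have "K * d * svar QR \<le> K * d * 1"
    using invariant_svar(2)[OF b inv] K d0 by (intro mult_left_mono) auto
  finally have "K * (\<eta> (QL' 0) (PR' 0) * svar QR) \<le> K * (\<eta> (QL 0) (PR 0) * svar QR + K * d)"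
    using K by (intro mult_left_mono) auto
  then have "W2 PL QL' PR' QR \<le> W2 PL QL PR QR"
    using f unfolding W2_def s by (simp add: algebra_simps power2_eq_square)
  moreover have "W1 QL' PR' QR \<le> W1 QL PR QR"
    using g unfolding W1_def s by (simp add: algebra_simps)
  ultimately show ?thesis using inv near bv by (auto simp: invariant_def)
qed

definition Cw :: real where "Cw = 2 + 4 * K + 3 * K\<^sup>2 + 2 * K ^ 3"

text \<open>The bounds are stated for the outgoing sequences with the pending value already in
  front, because between two sampling times the fan at the boundary contains the emitted
  states.\<close>

lemma invariant_bounds:
  assumes b: "small b" and inv: "invariant b PL QL PR QR"
  shows "svar (push (f (QL 0) (PR 0) (QR 0)) PL) \<le> Cw * b" "svar QL \<le> Cw * b" "svar PR \<le> Cw * b"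
    "svar (push (g (QL 0) (PR 0)) QR) \<le> Cw * b"
    "\<bar>push (f (QL 0) (PR 0) (QR 0)) PL i - ps\<bar> \<le> Cw * b" "\<bar>QL i - xs\<bar> \<le> Cw * b"
    "\<bar>PR i - ys\<bar> \<le> Cw * b" "\<bar>push (g (QL 0) (PR 0)) QR i - zs\<bar> \<le> Cw * b"
proof -
  note b' = smallD[OF b]
  have bv: "bv_seq PL" "bv_seq QL" "bv_seq PR" "bv_seq QR" using inv by (auto simp: invariant_def)
  note sv = bv[THEN svar_nonneg]
  have Kp: "0 \<le> K * b" "0 \<le> K\<^sup>2 * b" "0 \<le> K ^ 3 * b" using K b' by auto
  have le: "b \<le> Cw * b" "2 * K * b \<le> Cw * b" "(2 + 4 * K) * b \<le> Cw * b" "(2 * K + 2 * K ^ 3) * b \<le> Cw * b"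
    using Kp b' by (simp_all add: Cw_def algebra_simps)
  have w: "W1 QL PR QR \<le> (2 + 4 * K) * b" "W2 PL QL PR QR \<le> Cw * b"
    using inv by (auto simp: invariant_def Cw_def)
  have m: "svar QL + svar PR \<le> K * (svar QL + svar PR)"
    using K sv mult_right_mono[of 1 K "svar QL + svar PR"] by simp
  have e: "0 \<le> K * (\<eta> (QL 0) (PR 0) * svar QR)" "0 \<le> (K + K\<^sup>2) * (svar QL + svar PR)"
    using K sv \<eta>_nonneg by auto
  show "svar (push (f (QL 0) (PR 0) (QR 0)) PL) \<le> Cw * b"
    using w(2) e by (simp add: svar_push bv W2_def)
  show "svar (push (g (QL 0) (PR 0)) QR) \<le> Cw * b" "svar QL \<le> Cw * b" "svar PR \<le> Cw * b"
    using w(1) m sv le(3) by (simp_all add: svar_push bv W1_def)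
  have near: "\<bar>QL i - xs\<bar> \<le> b" "\<bar>PR i - ys\<bar> \<le> b" "\<bar>QR i - zs\<bar> \<le> 2 * K * b"
      "\<bar>PL i - ps\<bar> \<le> (2 * K + 2 * K ^ 3) * b" for i
    using inv by (auto simp: invariant_def)
  show "\<bar>QL i - xs\<bar> \<le> Cw * b" "\<bar>PR i - ys\<bar> \<le> Cw * b" using near(1,2)[of i] le by linarith+
  show "\<bar>push (f (QL 0) (PR 0) (QR 0)) PL i - ps\<bar> \<le> Cw * b"
    using f_near[OF b near(1-3)[of 0]] near(4)[of "i - 1"] le by (cases i) auto
  show "\<bar>push (g (QL 0) (PR 0)) QR i - zs\<bar> \<le> Cw * b"
    using g_near[OF b near(1,2)[of 0]] near(3)[of "i - 1"] le by (cases i) auto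
qed

end

section \<open>Fans and sampling\<close>

text \<open>The value just to the left of the ray \<open>x = \<alpha> t\<close>. The strict
  inequality, in contrast to \<open>fan_value\<close>, reflects that the scheme samples by left
  limits: at \<open>\<alpha> = s\<close> the state on the left of the discontinuity is
  taken.\<close>

definition fan_sample :: "fan \<Rightarrow> real \<Rightarrow> state" where
  "fan_sample F \<alpha> = fold (\<lambda>(s, u') u. if s < \<alpha> then u' else u) (snd F) (fst F)"

definition fan_states :: "fan \<Rightarrow> state set" where
  "fan_states F = insert (fst F) (snd ` set (snd F))"

lemma fold_select_in:
  "fold (\<lambda>(s, u') u. if P s then u' else u) xs u0 \<in> insert u0 (snd ` set xs)"
proof (induction xs arbitrary: u0)
  case (Cons a xs)
  show ?case using Cons.IH[of u0] Cons.IH[of "snd a"] by (cases a) auto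
qed auto

lemma fan_value_in_states: "fan_value F t x \<in> fan_states F"
  unfolding fan_value_def fan_states_def by (rule fold_select_in)

lemma fan_sample_in_states: "fan_sample F \<alpha> \<in> fan_states F"
  unfolding fan_sample_def fan_states_def by (rule fold_select_in)

lemma fold_select_cong:
  "(\<And>s. s \<in> fst ` set xs \<Longrightarrow> P s \<longleftrightarrow> Q s) \<Longrightarrow>
   fold (\<lambda>(s, u') u. if P s then u' else u) xs u0 = fold (\<lambda>(s, u') u. if Q s then u' else u) xs u0"
  by (induction xs arbitrary: u0) auto

lemma fan_value_0: "fan_value F 0 x = (if 0 \<le> x then fan_value F 0 0 else fst F)"
proof -
  have "fold (\<lambda>(s, u') u. u) xs u0 = u0" for xs :: "(real \<times> state) list" and u0 :: state
    by (induction xs) auto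
  then show ?thesis by (simp add: fan_value_def)
qed

text \<open>The two limits are iterated. For \<open>y\<close> left of \<open>\<xi>\<close> but to
  the right of all positions \<open>s * \<tau> < \<xi>\<close>, every comparison
  \<open>s * (t - t0) \<le> y\<close> is eventually constant in \<open>t\<close>, with the truth
  value of \<open>s < \<xi> / \<tau>\<close>; hence the inner limit no longer depends on
  \<open>y\<close>.\<close>

lemma fan_sample_limit:
  assumes "0 < \<tau>" and u: "\<And>t y. 0 \<le> t \<Longrightarrow> t < \<tau> \<Longrightarrow> y \<in> {-h<..<h} \<Longrightarrow> u (t0 + t) (x0 + y) = fan_value F t y"
    and \<xi>: "\<xi> \<in> {-h<..<h}"
  shows "Lim (at_left (x0 + \<xi>)) (\<lambda>y. Lim (at_left (t0 + \<tau>)) (\<lambda>t. u t y)) = fan_sample F (\<xi> / \<tau>)"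
proof -
  let ?S = "fst ` set (snd F)"
  have inner: "Lim (at_left (t0 + \<tau>)) (\<lambda>t. u t (x0 + y)) = fan_sample F (\<xi> / \<tau>)"
    if y: "y \<in> {-h<..<h}" "y < \<xi>" "\<And>s. s \<in> ?S \<Longrightarrow> s * \<tau> < \<xi> \<Longrightarrow> s * \<tau> < y" for y
  proof (rule tendsto_Lim)
    have "eventually (\<lambda>t. s * (t - t0) \<le> y \<longleftrightarrow> s < \<xi> / \<tau>) (at_left (t0 + \<tau>))" if s: "s \<in> ?S" for s
    proof -
      have lim: "((\<lambda>t. s * (t - t0)) \<longlongrightarrow> s * ((t0 + \<tau>) - t0)) (at_left (t0 + \<tau>))"
        by (intro tendsto_intros)
      show ?thesis
      proof (cases "s * \<tau> < \<xi>")
        case True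
        from order_tendstoD(2)[OF lim, of y] y(3)[OF s True]
        have "eventually (\<lambda>t. s * (t - t0) < y) (at_left (t0 + \<tau>))" by simp
        then show ?thesis by (rule eventually_mono) (use True assms(1) in \<open>auto simp: field_simps\<close>)
      next
        case False
        from order_tendstoD(1)[OF lim, of y] y(2) False
        have "eventually (\<lambda>t. y < s * (t - t0)) (at_left (t0 + \<tau>))" by simp
        then show ?thesis by (rule eventually_mono) (use False assms(1) in \<open>auto simp: field_simps\<close>)
      qed
    qed
    then have "eventually (\<lambda>t. \<forall>s\<in>?S. s * (t - t0) \<le> y \<longleftrightarrow> s < \<xi> / \<tau>) (at_left (t0 + \<tau>))"
      by (intro eventually_ball_finite) auto
    moreover have "eventually (\<lambda>t. t \<in> {t0<..<t0 + \<tau>}) (at_left (t0 + \<tau>))"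
      using assms(1) by (intro eventually_at_left_real) auto
    ultimately have "eventually (\<lambda>t. u t (x0 + y) = fan_sample F (\<xi> / \<tau>)) (at_left (t0 + \<tau>))"
    proof eventually_elim
      case (elim t)
      have "u (t0 + (t - t0)) (x0 + y) = fan_value F (t - t0) y"
        using elim(2) y(1) by (intro u) auto
      also have "\<dots> = fan_sample F (\<xi> / \<tau>)"
        unfolding fan_value_def fan_sample_def using elim(1) by (intro fold_select_cong) auto
      finally show ?case by simp
    qed
    then show "((\<lambda>t. u t (x0 + y)) \<longlongrightarrow> fan_sample F (\<xi> / \<tau>)) (at_left (t0 + \<tau>))"
      by (rule tendsto_eventually)
  qed simp
  show ?thesis
  proof (rule tendsto_Lim)
    have "eventually (\<lambda>y. s * \<tau> < \<xi> \<longrightarrow> x0 + s * \<tau> < y) (at_left (x0 + \<xi>))" for s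
      by (cases "s * \<tau> < \<xi>")
        (auto intro: eventually_mono[OF eventually_at_left_real[of "x0 + s * \<tau>" "x0 + \<xi>"]])
    then have "eventually (\<lambda>y. \<forall>s\<in>?S. s * \<tau> < \<xi> \<longrightarrow> x0 + s * \<tau> < y) (at_left (x0 + \<xi>))"
      by (intro eventually_ball_finite) auto
    moreover have "eventually (\<lambda>y. y \<in> {x0 - h<..<x0 + \<xi>}) (at_left (x0 + \<xi>))"
      using \<xi> by (intro eventually_at_left_real) auto
    ultimately have "eventually (\<lambda>y. Lim (at_left (t0 + \<tau>)) (\<lambda>t. u t y) = fan_sample F (\<xi> / \<tau>)) (at_left (x0 + \<xi>))"
    proof eventually_elim
      case (elim y)
      have "Lim (at_left (t0 + \<tau>)) (\<lambda>t. u t (x0 + (y - x0))) = fan_sample F (\<xi> / \<tau>)"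
        using elim(2) \<xi> by (intro inner) (use elim(1) in \<open>force+\<close>)
      then show ?case by simp
    qed
    then show "((\<lambda>y. Lim (at_left (t0 + \<tau>)) (\<lambda>t. u t y)) \<longlongrightarrow> fan_sample F (\<xi> / \<tau>)) (at_left (x0 + \<xi>))"
      by (rule tendsto_eventually)
  qed simp
qed

section \<open>A Glimm approximation read as a grid of fans\<close>

context phase_model
begin

lemma riemann_ends:
  assumes "riemann ul ur F"
  shows "fst F = ul" "fan_value F 0 0 = ur"
  using assms by (cases; simp add: fan_value_def)+

text \<open>The definition takes the left datum at \<open>(m - 1) * h\<close>. It is moved to the
  left end point \<open>(m - 2) * h\<close> of its cell, on which \<open>u\<close> is constant at
  grid times: as an average at time \<open>0\<close>, as a sample of one fan later. All data are
  then indexed by left end points of cells.\<close>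

lemma glimm_cells:
  assumes G: "glimm_approximation \<tau> h a u0 u" and \<tau>: "0 < \<tau>" and h: "0 < h"
    and a: "\<And>n. 1 \<le> n \<Longrightarrow> a n \<in> {-1<..<1}"
  obtains F where
    "\<And>n m. even (m + int n) \<Longrightarrow>
       riemann (u (real n * \<tau>) ((of_int m - 2) * h)) (u (real n * \<tau>) (of_int m * h)) (F n m)"
    "\<And>n m t x. even (m + int n) \<Longrightarrow> t \<in> {real n * \<tau>..<(real n + 1) * \<tau>} \<Longrightarrow>
       x \<in> {(of_int m - 1) * h..<(of_int m + 1) * h} \<Longrightarrow>
       u t x = fan_value (F n m) (t - real n * \<tau>) (x - of_int m * h)"
    "\<And>n m x. even (m + int n) \<Longrightarrow> x \<in> {(of_int m - 1) * h..<(of_int m + 1) * h} \<Longrightarrow>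
       u (real (Suc n) * \<tau>) x = fan_sample (F n m) (a (Suc n) * h / \<tau>)"
proof -
  have "\<forall>n m. \<exists>F. even (m + int n) \<longrightarrow>
      riemann (u (real n * \<tau>) ((of_int m - 1) * h)) (u (real n * \<tau>) (of_int m * h)) F \<and>
      (\<forall>t\<in>{real n * \<tau>..<(real n + 1) * \<tau>}. \<forall>x\<in>{(of_int m - 1) * h..<(of_int m + 1) * h}.
              u t x = fan_value F (t - real n * \<tau>) (x - of_int m * h))"
    using G unfolding glimm_approximation_def by blast
  then obtain F where F: "\<And>n m. even (m + int n) \<Longrightarrow>
      riemann (u (real n * \<tau>) ((of_int m - 1) * h)) (u (real n * \<tau>) (of_int m * h)) (F n m)"
    and val: "\<And>n m t x. even (m + int n) \<Longrightarrow> t \<in> {real n * \<tau>..<(real n + 1) * \<tau>} \<Longrightarrow>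
       x \<in> {(of_int m - 1) * h..<(of_int m + 1) * h} \<Longrightarrow>
       u t x = fan_value (F n m) (t - real n * \<tau>) (x - of_int m * h)"
    by metis
  have start: "u 0 x = (1 / (2 * h)) *\<^sub>R (LINT y:{of_int m * h..<(of_int m + 2) * h}|lborel. u0 y)"
    if "even m" "x \<in> {of_int m * h..<(of_int m + 2) * h}" for m x
    using G that unfolding glimm_approximation_def by blast
  have later: "u (real n * \<tau>) x =
      Lim (at_left ((of_int m + 1 + a n) * h)) (\<lambda>y. Lim (at_left (real n * \<tau>)) (\<lambda>t. u t y))"
    if "n \<ge> 1" "even (m + int n)" "x \<in> {of_int m * h..<(of_int m + 2) * h}" for n m x
    using G that unfolding glimm_approximation_def by blast
  have smp: "u (real (Suc n) * \<tau>) x = fan_sample (F n m) (a (Suc n) * h / \<tau>)"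
    if e: "even (m + int n)" and x: "x \<in> {(of_int m - 1) * h..<(of_int m + 1) * h}" for n m x
  proof -
    have "even ((m - 1) + int (Suc n))" using e by simp
    then have "u (real (Suc n) * \<tau>) x =
       Lim (at_left ((of_int (m - 1) + 1 + a (Suc n)) * h))
         (\<lambda>y. Lim (at_left (real (Suc n) * \<tau>)) (\<lambda>t. u t y))"
      using x by (intro later) (auto simp: algebra_simps)
    also have "\<dots> = Lim (at_left (of_int m * h + a (Suc n) * h))
         (\<lambda>y. Lim (at_left (real n * \<tau> + \<tau>)) (\<lambda>t. u t y))"
      by (simp add: algebra_simps)
    also have "\<dots> = fan_sample (F n m) (a (Suc n) * h / \<tau>)"
    proof (rule fan_sample_limit[OF \<tau>])
      show "a (Suc n) * h \<in> {- h<..<h}"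
        using a[of "Suc n"] h mult_strict_right_mono[of "-1" "a (Suc n)" h]
          mult_strict_right_mono[of "a (Suc n)" 1 h] by auto
      fix t y assume "0 \<le> t" "t < \<tau>" "y \<in> {- h<..<h}"
      then show "u (real n * \<tau> + t) (of_int m * h + y) = fan_value (F n m) t y"
        using val[OF e, of "real n * \<tau> + t" "of_int m * h + y"] by (auto simp: algebra_simps)
    qed
    finally show ?thesis .
  qed
  have left: "u (real n * \<tau>) ((of_int m - 1) * h) = u (real n * \<tau>) ((of_int m - 2) * h)"
    if e: "even (m + int n)" for n m
  proof -
    show ?thesis
    proof (cases n)
      case 0
      have "even (m - 2)" using e 0 by simp
      from start[OF this, of "(of_int m - 1) * h"] start[OF this, of "(of_int m - 2) * h"] show ?thesis
        using 0 h by (simp add: algebra_simps)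
    next
      case (Suc k)
      have e': "even ((m - 1) + int k)" using e Suc by simp
      show ?thesis
        using smp[OF e', of "(of_int m - 1) * h"] smp[OF e', of "(of_int m - 2) * h"] h Suc
        by (simp add: algebra_simps)
    qed
  qed
  show ?thesis
    by (rule that[of F]) (use F left val smp in auto)
qed

end

section \<open>The Riemann solver in Riemann invariants\<close>

text \<open>The state with Riemann invariants \<open>v + c w = p\<close> and
  \<open>v - c w = q\<close>; \<open>p\<close> is transported with speed \<open>-c\<close> and
  \<open>q\<close> with speed \<open>c\<close>.\<close>

definition wave_state :: "real \<Rightarrow> real \<Rightarrow> real \<Rightarrow> state" where
  "wave_state c p q = ((p + q) / 2, (p - q) / (2 * c))"

lemma wave_state_sel [simp]:
  "fst (wave_state c p q) = (p + q) / 2" "snd (wave_state c p q) = (p - q) / (2 * c)"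
  by (simp_all add: wave_state_def)

lemma wave_state_of:
  "c \<noteq> 0 \<Longrightarrow> wave_state c (fst u + c * snd u) (fst u - c * snd u) = u"
  by (cases u) (simp add: wave_state_def field_simps)

lemma wave_state_dist:
  assumes "0 < c"
  shows "norm (wave_state c p q - wave_state c p' q') \<le> (1 + 1 / c) * (\<bar>p - p'\<bar> + \<bar>q - q'\<bar>)"
proof -
  have aux: "\<bar>(a + b) / 2\<bar> \<le> \<bar>a\<bar> + \<bar>b\<bar>" for a b :: real
  proof -
    have "\<bar>(a + b) / 2\<bar> = \<bar>a + b\<bar> / 2" by simp
    also have "\<dots> \<le> \<bar>a + b\<bar>" by simp
    also have "\<dots> \<le> \<bar>a\<bar> + \<bar>b\<bar>" by (rule abs_triangle_ineq)
    finally show ?thesis .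
  qed
  have "norm (wave_state c p q - wave_state c p' q') \<le> \<bar>(p + q) / 2 - (p' + q') / 2\<bar> + \<bar>(p - q) / (2 * c) - (p' - q') / (2 * c)\<bar>"
    unfolding wave_state_def minus_prod_def fst_conv snd_conv
    using norm_Pair_le[of "(p + q) / 2 - (p' + q') / 2" "(p - q) / (2 * c) - (p' - q') / (2 * c)"] by simp
  also have "(p + q) / 2 - (p' + q') / 2 = ((p - p') + (q - q')) / 2" by (simp add: field_simps)
  also have "(p - q) / (2 * c) - (p' - q') / (2 * c) = ((p - p') - (q - q')) / (2 * c)"
    using assms by (simp add: field_simps)
  also have "\<bar>((p - p') + (q - q')) / 2\<bar> \<le> \<bar>p - p'\<bar> + \<bar>q - q'\<bar>"
    by (rule aux)
  also have "\<bar>((p - p') - (q - q')) / (2 * c)\<bar> \<le> 1 / c * (\<bar>p - p'\<bar> + \<bar>q - q'\<bar>)"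
  proof -
    have "\<bar>((p - p') - (q - q')) / (2 * c)\<bar> = 1 / c * (\<bar>(p - p') - (q - q')\<bar> / 2)"
      using assms by (simp add: abs_mult)
    also have "\<dots> \<le> 1 / c * (\<bar>p - p'\<bar> + \<bar>q - q'\<bar>)"
    proof (intro mult_left_mono)
      have "\<bar>(p - p') - (q - q')\<bar> / 2 \<le> \<bar>(p - p') - (q - q')\<bar>" by simp
      also have "\<dots> \<le> \<bar>p - p'\<bar> + \<bar>q - q'\<bar>" by (rule abs_triangle_ineq4)
      finally show "\<bar>(p - p') - (q - q')\<bar> / 2 \<le> \<bar>p - p'\<bar> + \<bar>q - q'\<bar>" .
    qed (use assms in simp)
    finally show ?thesis .
  qed
  finally show ?thesis by (simp add: distrib_right)
qed

lemma riemann_invariant_dist: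
  assumes "0 \<le> c"
  shows "\<bar>(fst u + c * snd u) - (fst u' + c * snd u')\<bar> \<le> (1 + c) * norm (u - u')"
    and "\<bar>(fst u - c * snd u) - (fst u' - c * snd u')\<bar> \<le> (1 + c) * norm (u - u')"
proof -
  have 1: "\<bar>fst u - fst u'\<bar> \<le> norm (u - u')" "\<bar>snd u - snd u'\<bar> \<le> norm (u - u')"
    using norm_fst_le[of "fst (u - u')" "snd (u - u')"] norm_snd_le[of "snd (u - u')" "fst (u - u')"]
    unfolding prod.collapse by simp_all
  have "\<bar>c * snd u - c * snd u'\<bar> \<le> c * norm (u - u')"
    using 1(2) assms by (simp add: right_diff_distrib[symmetric] abs_mult mult_left_mono)
  with 1(1) show "\<bar>(fst u + c * snd u) - (fst u' + c * snd u')\<bar> \<le> (1 + c) * norm (u - u')"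
    "\<bar>(fst u - c * snd u) - (fst u' - c * snd u')\<bar> \<le> (1 + c) * norm (u - u')"
    by (simp_all add: distrib_right abs_le_iff)
qed

locale two_phase = phase_model +
  assumes k3_pos: "0 < k3" and k13: "k3 < k1" and wM_pos: "0 < wM" and wMm: "wM < wm"
begin

lemma c_simps: "0 < c1" "0 < c3" "c3 < c1" "c1\<^sup>2 = k1" "c3\<^sup>2 = k3" "c1 * c1 = k1" "c3 * c3 = k3"
  using k3_pos k13 by (simp_all add: less_imp_le)

lemma c_neq: "c1 \<noteq> 0" "c3 \<noteq> 0"
  using k3_pos k13 by simp_all

text \<open>The sound speeds are kept as atoms; otherwise comparisons between them would be
  rewritten into comparisons between \<open>k1\<close> and \<open>k3\<close>.\<close>

declare real_sqrt_less_iff [simp del] real_sqrt_le_iff [simp del] real_sqrt_gt_0_iff [simp del]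
  real_sqrt_ge_0_iff [simp del] real_sqrt_eq_0_iff [simp del] real_sqrt_eq_iff [simp del]
  real_sqrt_lt_0_iff [simp del] real_sqrt_le_0_iff [simp del] real_sqrt_mult_self [simp del]
  real_sqrt_pow2_iff [simp del]

lemma H_disjoint: "u \<in> H1 \<Longrightarrow> u \<in> H3 \<Longrightarrow> False"
  using wMm by (auto simp: H1_def H3_def)

lemma H1_iff: "u \<in> H1 \<longleftrightarrow> -1 < snd u \<and> snd u \<le> wM" by (cases u) (simp add: H1_def)
lemma H3_iff: "u \<in> H3 \<longleftrightarrow> wm \<le> snd u" by (cases u) (simp add: H3_def)

text \<open>The left contact changes only \<open>p\<close> and the right one only \<open>q\<close>,
  so the middle state has the \<open>p\<close> of the right datum and the \<open>q\<close> of the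
  left one.\<close>

lemma phase_middle:
  assumes "c \<noteq> 0" "h = ((p - q) / (2 * c) + (p' - q') / (2 * c)) / 2 + ((p' + q') / 2 - (p + q) / 2) / (2 * c)"
  shows "((p + q) / 2 + c * (h - (p - q) / (2 * c)), h) = wave_state c p' q"
proof -
  have h: "h = (p' - q) / (2 * c)"
    unfolding assms(2) using assms(1) by (simp add: divide_simps)
  show ?thesis unfolding h using assms(1) by (simp add: wave_state_def divide_simps)
qed

definition phase_fan :: "real \<Rightarrow> real \<Rightarrow> real \<Rightarrow> real \<Rightarrow> real \<Rightarrow> fan" where
  "phase_fan c p q p' q' = (wave_state c p q, [(- c, wave_state c p' q), (c, wave_state c p' q')])"

lemma riemann_phase1:
  assumes "riemann (wave_state c1 p q) (wave_state c1 p' q') F"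
    and "wave_state c1 p q \<in> H1" "wave_state c1 p' q' \<in> H1"
  shows "F = phase_fan c1 p q p' q'" "fan_states F \<subseteq> H1"
proof -
  have "F = phase_fan c1 p q p' q' \<and> wave_state c1 p' q \<in> H1"
    using assms(1)
  proof cases
    case (phase1 vl wl vr wr h)
    have e: "vl = (p + q) / 2" "wl = (p - q) / (2 * c1)" "vr = (p' + q') / 2" "wr = (p' - q') / (2 * c1)"
      using phase1(1,2) by (simp_all add: wave_state_def)
    have m: "(vl + c1 * (h - wl), h) = wave_state c1 p' q"
      using phase_middle[of c1 h p q p' q'] phase1(6) c_neq unfolding e by simp
    show ?thesis using phase1(3,7) unfolding m phase_fan_def phase1(1,2) by simp
  qed (use assms H_disjoint in auto)
  then show "F = phase_fan c1 p q p' q'" "fan_states F \<subseteq> H1"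
    using assms by (auto simp: phase_fan_def fan_states_def)
qed

lemma riemann_phase3:
  assumes "riemann (wave_state c3 p q) (wave_state c3 p' q') F"
    and "wave_state c3 p q \<in> H3" "wave_state c3 p' q' \<in> H3"
  shows "F = phase_fan c3 p q p' q'" "fan_states F \<subseteq> H3"
proof -
  have "F = phase_fan c3 p q p' q' \<and> wave_state c3 p' q \<in> H3"
    using assms(1)
  proof cases
    case (phase3 vl wl vr wr h)
    have e: "vl = (p + q) / 2" "wl = (p - q) / (2 * c3)" "vr = (p' + q') / 2" "wr = (p' - q') / (2 * c3)"
      using phase3(1,2) by (simp_all add: wave_state_def)
    have m: "(vl + c3 * (h - wl), h) = wave_state c3 p' q"
      using phase_middle[of c3 h p q p' q'] phase3(6) c_neq unfolding e by simp
    show ?thesis using phase3(3,7) unfolding m phase_fan_def phase3(1,2) by simp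
  qed (use assms H_disjoint in auto)
  then show "F = phase_fan c3 p q p' q'" "fan_states F \<subseteq> H3"
    using assms by (auto simp: phase_fan_def fan_states_def)
qed

lemma riemann_phase1I:
  assumes "wave_state c1 p q \<in> H1" "wave_state c1 p' q' \<in> H1" "wave_state c1 p' q \<in> H1"
  shows "riemann (wave_state c1 p q) (wave_state c1 p' q') (phase_fan c1 p q p' q')"
proof -
  define h where "h = ((p - q) / (2 * c1) + (p' - q') / (2 * c1)) / 2 + ((p' + q') / 2 - (p + q) / 2) / (2 * c1)"
  have m: "((p + q) / 2 + c1 * (h - (p - q) / (2 * c1)), h) = wave_state c1 p' q"
    by (rule phase_middle[OF _ h_def]) (use c_neq(1) in simp)
  have "riemann ((p + q) / 2, (p - q) / (2 * c1)) ((p' + q') / 2, (p' - q') / (2 * c1))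
      (((p + q) / 2, (p - q) / (2 * c1)), [(- c1, ((p + q) / 2 + c1 * (h - (p - q) / (2 * c1)), h)),
        (c1, ((p' + q') / 2, (p' - q') / (2 * c1)))])"
    by (rule phase1[OF _ _ h_def]) (unfold m, use assms in \<open>simp_all add: wave_state_def\<close>)
  then show ?thesis unfolding m by (simp add: wave_state_def phase_fan_def)
qed

lemma riemann_phase3I:
  assumes "wave_state c3 p q \<in> H3" "wave_state c3 p' q' \<in> H3" "wave_state c3 p' q \<in> H3"
  shows "riemann (wave_state c3 p q) (wave_state c3 p' q') (phase_fan c3 p q p' q')"
proof -
  define h where "h = ((p - q) / (2 * c3) + (p' - q') / (2 * c3)) / 2 + ((p' + q') / 2 - (p + q) / 2) / (2 * c3)"
  have m: "((p + q) / 2 + c3 * (h - (p - q) / (2 * c3)), h) = wave_state c3 p' q"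
    by (rule phase_middle[OF _ h_def]) (use c_neq(2) in simp)
  have "riemann ((p + q) / 2, (p - q) / (2 * c3)) ((p' + q') / 2, (p' - q') / (2 * c3))
      (((p + q) / 2, (p - q) / (2 * c3)), [(- c3, ((p + q) / 2 + c3 * (h - (p - q) / (2 * c3)), h)),
        (c3, ((p' + q') / 2, (p' - q') / (2 * c3)))])"
    by (rule phase3[OF _ _ h_def]) (unfold m, use assms in \<open>simp_all add: wave_state_def\<close>)
  then show ?thesis unfolding m by (simp add: wave_state_def phase_fan_def)
qed

text \<open>The data determine the strength \<open>h\<close> of the phase boundary through the incoming invariants
  \<open>q = x\<close> on its left and \<open>p = y\<close> on its right.\<close>

definition h_in :: "real \<Rightarrow> real \<Rightarrow> real" where
  "h_in x y = (y - x) / (c1 + c3)"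

definition w_minus :: "real \<Rightarrow> real \<Rightarrow> real" where
  "w_minus V h = (c3 + V) / (c1 + V) * h"

definition w_plus :: "real \<Rightarrow> real \<Rightarrow> real" where
  "w_plus V h = (c1 - V) / (c3 - V) * h"

definition kinetic :: "real \<Rightarrow> real \<Rightarrow> bool" where
  "kinetic h V \<longleftrightarrow> V \<in> {-c3<..<c3} \<and>
     kinetic_relation V ((k1 - k3) / 2 * (wM * wm - w_minus V h * w_plus V h))"

text \<open>The strain behind a supersonic boundary as a function of \<open>h\<close> and the strain
  \<open>w\<close> in front of it: the solution of the linear equation in
  \<open>supersonic_state\<close>. It is written as \<open>h\<close> times a quotient that lies
  between \<open>0\<close> and \<open>1\<close> for \<open>h \<le> 0 < w\<close>.\<close>

definition w_super :: "real \<Rightarrow> real \<Rightarrow> real" where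
  "w_super h w = h * ((2 * c3 * w - (c1 + c3) * h) / ((c1 + c3) * w - 2 * c1 * h))"

definition boundary_speed :: "real \<Rightarrow> real" where
  "boundary_speed h = (THE V. kinetic h V)"

text \<open>As \<open>p - q = 2 * c * w\<close>, the incoming \<open>q = x\<close> and the strain
  next to the boundary determine the emitted \<open>p\<close>.\<close>

definition p_out :: "real \<Rightarrow> real \<Rightarrow> real \<Rightarrow> real" where
  "p_out x y z = x + 2 * c1 *
     (if h_in x y > 0 then w_minus (boundary_speed (h_in x y)) (h_in x y)
      else w_super (h_in x y) ((y - z) / (2 * c3)))"

text \<open>For \<open>h \<le> 0\<close> no wave is emitted to the right; the value \<open>w\<^sub>0\<close> only serves to continue the
  strength of the emitted wave.\<close>

definition q_out :: "real \<Rightarrow> real \<Rightarrow> real \<Rightarrow> real" where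
  "q_out w\<^sub>0 x y = y - 2 * c3 *
     (if h_in x y > 0 then w_plus (boundary_speed (h_in x y)) (h_in x y) else w\<^sub>0)"

section \<open>The kinetic relation\<close>

text \<open>The strains adjacent to the boundary enter the kinetic relation only through their
  product \<open>h\<^sup>2 * PP V\<close>. As \<open>PP\<close> increases from \<open>0\<close> to
  infinity on ]-c3, c3[, the left-hand side of the relation decreases in \<open>V\<close> while
  \<open>\<phi>\<close> increases.\<close>

definition PP :: "real \<Rightarrow> real" where
  "PP V = ((c3 + V) * (c1 - V)) / ((c1 + V) * (c3 - V))"

lemma w_minus_w_plus: "w_minus V h * w_plus V h = h\<^sup>2 * PP V"
  by (simp add: w_minus_def w_plus_def PP_def power2_eq_square)

lemma V_pos:
  assumes "V \<in> {-c3<..<c3}"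
  shows "0 < c3 + V" "0 < c1 - V" "0 < c1 + V" "0 < c3 - V"
  using assms c_simps(3) unfolding greaterThanLessThan_iff by linarith+

lemma PP_pos: "V \<in> {-c3<..<c3} \<Longrightarrow> 0 < PP V"
  using V_pos[of V] by (simp add: PP_def)

lemma PP_diff:
  assumes V: "V \<in> {-c3<..<c3}" "V' \<in> {-c3<..<c3}"
  shows "PP V' - PP V = 2 * (c1 - c3) * (V' - V) * (c1 * c3 + V * V') /
    (((c1 + V) * (c3 - V)) * ((c1 + V') * (c3 - V')))"
proof -
  have "(c1 + V) * (c3 - V) \<noteq> 0" "(c1 + V') * (c3 - V') \<noteq> 0"
    using V_pos[OF V(1)] V_pos[OF V(2)] by auto
  then have "PP V' - PP V = (((c3 + V') * (c1 - V')) * ((c1 + V) * (c3 - V)) - ((c3 + V) * (c1 - V)) * ((c1 + V') * (c3 - V'))) /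
     (((c1 + V) * (c3 - V)) * ((c1 + V') * (c3 - V')))"
    unfolding PP_def by (subst diff_frac_eq) (simp_all add: mult.commute)
  also have "((c3 + V') * (c1 - V')) * ((c1 + V) * (c3 - V)) - ((c3 + V) * (c1 - V)) * ((c1 + V') * (c3 - V'))
      = 2 * (c1 - c3) * (V' - V) * (c1 * c3 + V * V')"
    by algebra
  finally show ?thesis .
qed

text \<open>In \<open>PP_diff\<close>, \<open>c1 * c3 + V * V'\<close> is at least
  \<open>(c1 - c3) * c3\<close> because \<open>\<bar>V * V'\<bar> \<le> c3 * c3\<close>, and the
  denominator is at most \<open>16 * c1\<^sup>2 * c3\<^sup>2\<close>; this gives the
  constant.\<close>

definition pp_slope :: real where "pp_slope = (c1 - c3)\<^sup>2 * c3 / (8 * (c1\<^sup>2 * c3\<^sup>2))"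

lemma PP_lower:
  assumes V: "V \<in> {-c3<..<c3}" "V' \<in> {-c3<..<c3}" "V \<le> V'"
  shows "pp_slope * (V' - V) \<le> PP V' - PP V"
proof -
  note v = V_pos[OF V(1)] V_pos[OF V(2)]
  have VV: "(c1 - c3) * c3 \<le> c1 * c3 + V * V'"
  proof -
    have "\<bar>V * V'\<bar> \<le> c3 * c3" unfolding abs_mult using V(1,2) c_simps(2) by (intro mult_mono) auto
    then show ?thesis unfolding left_diff_distrib by linarith
  qed
  moreover have "0 \<le> (c1 - c3) * c3" using c_simps(2,3) by simp
  ultimately have VV0: "0 \<le> c1 * c3 + V * V'" by linarith
  have slope_eq: "(a - b)\<^sup>2 * b / (8 * (a\<^sup>2 * b\<^sup>2)) * W =
      2 * (a - b) * W * ((a - b) * b) / (((2 * a) * (2 * b)) * ((2 * a) * (2 * b)))"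
    if "a \<noteq> 0" "b \<noteq> 0" for a b W :: real
    using that by (simp add: power2_eq_square divide_simps)
  have d: "(c1 + V) * (c3 - V) \<le> (2 * c1) * (2 * c3)" "(c1 + V') * (c3 - V') \<le> (2 * c1) * (2 * c3)"
    using V(1,2) v c_simps(1-3) unfolding greaterThanLessThan_iff by (intro mult_mono; linarith)+
  have D: "((c1 + V) * (c3 - V)) * ((c1 + V') * (c3 - V')) \<le> ((2 * c1) * (2 * c3)) * ((2 * c1) * (2 * c3))"
    using v by (intro mult_mono d) auto
  have D0: "0 < ((c1 + V) * (c3 - V)) * ((c1 + V') * (c3 - V'))" using v by simp
  have "pp_slope * (V' - V) = 2 * (c1 - c3) * (V' - V) * ((c1 - c3) * c3) / (((2 * c1) * (2 * c3)) * ((2 * c1) * (2 * c3)))"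
    unfolding pp_slope_def by (rule slope_eq[OF c_neq])
  also have "\<dots> \<le> 2 * (c1 - c3) * (V' - V) * (c1 * c3 + V * V') / (((c1 + V) * (c3 - V)) * ((c1 + V') * (c3 - V')))"
    using VV VV0 D D0 V(3) c_simps(1-3) by (intro frac_le mult_left_mono mult_nonneg_nonneg) (simp_all add: less_imp_le)
  finally show ?thesis using PP_diff[OF V(1,2)] by simp
qed

lemma pp_slope_pos: "0 < pp_slope"
proof -
  have "0 < (c1 - c3)\<^sup>2" using c_simps(3) by (intro zero_less_power) linarith
  then show ?thesis unfolding pp_slope_def using c_simps(1,2) by (intro divide_pos_pos mult_pos_pos) auto
qed

lemma PP_less: "V \<in> {-c3<..<c3} \<Longrightarrow> V' \<in> {-c3<..<c3} \<Longrightarrow> V < V' \<Longrightarrow> PP V < PP V'"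
  using PP_lower[of V V'] mult_pos_pos[OF pp_slope_pos, of "V' - V"] by simp

lemma PP_le: "V \<in> {-c3<..<c3} \<Longrightarrow> V' \<in> {-c3<..<c3} \<Longrightarrow> V \<le> V' \<Longrightarrow> PP V \<le> PP V'"
  using PP_less[of V V'] by (cases "V = V'") auto

end

section \<open>Uniqueness, Lipschitz dependence and existence of the boundary speed\<close>

locale kinetic_phase = two_phase +
  assumes ent: entropy_dissipation
begin

lemma ent_mono: "-c3 < V \<Longrightarrow> V \<le> V' \<Longrightarrow> V' \<le> c3 \<Longrightarrow> \<phi> V \<le> \<phi> V'"
  using ent unfolding entropy_dissipation_def by (auto simp: mono_on_def)

lemma ent_derivs:
  obtains \<phi>' \<phi>'' where
    "\<And>V. V \<in> {-c3<..<0} \<union> {0<..c3} \<Longrightarrow> (\<phi> has_real_derivative \<phi>' V) (at V within {-c3<..<0} \<union> {0<..c3})"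
    "\<And>V. V \<in> {-c3<..<0} \<union> {0<..c3} \<Longrightarrow> (\<phi>' has_real_derivative \<phi>'' V) (at V within {-c3<..<0} \<union> {0<..c3})"
    "continuous_on ({-c3<..<0} \<union> {0<..c3}) \<phi>''"
  using ent unfolding entropy_dissipation_def Let_def by blast

lemma ent_limits:
  obtains l l' where "(\<phi> \<longlongrightarrow> l) (at_left 0)" "(\<phi> \<longlongrightarrow> l') (at_right 0)"
    "Lim (at_left 0) \<phi> = l" "Lim (at_right 0) \<phi> = l'"
proof -
  obtain l l' where "(\<phi> \<longlongrightarrow> l) (at_left 0)" "(\<phi> \<longlongrightarrow> l') (at_right 0)"
    using ent unfolding entropy_dissipation_def Let_def by blast
  then show ?thesis using that[of l l'] tendsto_Lim[of "at_left (0::real)" \<phi> l] tendsto_Lim[of "at_right (0::real)" \<phi> l']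
    by simp
qed

lemma ent_left_le: "-c3 < V \<Longrightarrow> V < 0 \<Longrightarrow> \<phi> V \<le> Lim (at_left 0) \<phi>"
proof -
  assume V: "-c3 < V" "V < 0"
  obtain l where l: "(\<phi> \<longlongrightarrow> l) (at_left 0)" "Lim (at_left 0) \<phi> = l" using ent_limits by metis
  have "eventually (\<lambda>x. \<phi> V \<le> \<phi> x) (at_left 0)"
    by (rule eventually_mono[OF eventually_at_left_real[OF V(2)]]) (use V c_simps(2) in \<open>intro ent_mono, auto\<close>)
  then show ?thesis using l tendsto_lowerbound[OF l(1)] by simp
qed

lemma ent_right_ge: "0 < V \<Longrightarrow> V \<le> c3 \<Longrightarrow> Lim (at_right 0) \<phi> \<le> \<phi> V"
proof -
  assume V: "0 < V" "V \<le> c3"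
  obtain l where l: "(\<phi> \<longlongrightarrow> l) (at_right 0)" "Lim (at_right 0) \<phi> = l" using ent_limits by metis
  have "eventually (\<lambda>x. \<phi> x \<le> \<phi> V) (at_right 0)"
    by (rule eventually_mono[OF eventually_at_right_real[OF V(1)]]) (use V c_simps(2) in \<open>intro ent_mono, auto\<close>)
  then show ?thesis using l tendsto_upperbound[OF l(1)] by simp
qed

text \<open>Filling in the jump at \<open>0\<close> keeps the graph monotone, as the one-sided
  limits separate the values on either side.\<close>

lemma kinetic_relation_mono:
  assumes "kinetic_relation V y" "kinetic_relation V' y'" "V < V'" "-c3 < V" "V' < c3"
  shows "y \<le> y'"
proof -
  consider "V = 0" "V' \<noteq> 0" | "V \<noteq> 0" "V' = 0" | "V \<noteq> 0" "V' \<noteq> 0" using assms(3) by linarith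
  then show ?thesis
  proof cases
    case 1 then show ?thesis using assms ent_right_ge[of V'] by (simp add: kinetic_relation_def)
  next
    case 2 then show ?thesis using assms ent_left_le[of V] by (simp add: kinetic_relation_def)
  next
    case 3 then show ?thesis using assms ent_mono[of V V'] by (simp add: kinetic_relation_def)
  qed
qed

text \<open>A faster boundary has a larger \<open>\<phi>\<close> and hence a smaller product of
  strains. Together with the growth of \<open>PP\<close> this gives both uniqueness and the
  Lipschitz bound for the speed.\<close>

lemma kinetic_mono:
  assumes "kinetic h V" "kinetic h' V'" "V < V'"
  shows "h'\<^sup>2 * PP V' \<le> h\<^sup>2 * PP V"
proof -
  have "(k1 - k3) / 2 * (wM * wm - h\<^sup>2 * PP V) \<le> (k1 - k3) / 2 * (wM * wm - h'\<^sup>2 * PP V')"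
    using assms by (intro kinetic_relation_mono[OF _ _ assms(3)]) (auto simp: kinetic_def w_minus_w_plus)
  then show ?thesis using k13 by (simp add: mult_le_cancel_left)
qed

lemma kinetic_V: "kinetic h V \<Longrightarrow> V \<in> {-c3<..<c3}" by (simp add: kinetic_def)

lemma kinetic_unique:
  assumes "kinetic h V" "kinetic h V'" "0 < h"
  shows "V = V'"
proof -
  have False if "kinetic h V" "kinetic h V'" "V < V'" for V V'
    using kinetic_mono[OF that] PP_less[OF kinetic_V[OF that(1)] kinetic_V[OF that(2)] that(3)] assms(3)
    by simp
  then show ?thesis using assms by (meson linorder_neqE)
qed

lemma boundary_speed_eq: "kinetic h V \<Longrightarrow> 0 < h \<Longrightarrow> boundary_speed h = V"
  unfolding boundary_speed_def by (intro the_equality) (auto intro: kinetic_unique)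

text \<open>\<open>PP\<close> blows up at \<open>c3\<close>, so this keeps the speed away from
  \<open>c3\<close> as long as \<open>h\<close> stays above \<open>h0 / 2\<close>. For
  \<open>V > V0\<close> it follows from \<open>h0\<^sup>2 * PP V \<le> 4 * h\<^sup>2 * PP V \<le> 4
  * h0\<^sup>2 * PP V0\<close>.\<close>

lemma kinetic_PP_bound:
  assumes "kinetic h0 V0" "kinetic h V" "h0 / 2 \<le> h" "0 < h0"
  shows "PP V \<le> 4 * PP V0"
proof (cases "V \<le> V0")
  case True
  then show ?thesis using PP_le[of V V0] assms kinetic_V PP_pos[of V0] by force
next
  case False
  have p: "0 < PP V" "0 < PP V0" using assms kinetic_V PP_pos by auto
  have "h0\<^sup>2 \<le> 4 * h\<^sup>2" using power_mono[OF assms(3), of 2] assms(4) by (simp add: power_divide)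
  then have "h0\<^sup>2 * PP V \<le> 4 * h\<^sup>2 * PP V" using p by (intro mult_right_mono) auto
  also have "\<dots> \<le> 4 * (h0\<^sup>2 * PP V0)" using kinetic_mono[OF assms(1,2)] False by simp
  finally have "h0\<^sup>2 * PP V \<le> h0\<^sup>2 * (4 * PP V0)" by simp
  then show ?thesis using assms(4) by (simp add: mult_le_cancel_left)
qed

text \<open>Monotonicity of \<open>\<phi>\<close> suffices. If \<open>V' < V\<close>, then
  \<open>kinetic_mono\<close> bounds \<open>h'\<^sup>2 * (PP V - PP V')\<close> by
  \<open>(h'\<^sup>2 - h\<^sup>2) * PP V\<close>, and the slope of \<open>PP\<close> bounds the
  left-hand side from below by a multiple of \<open>V - V'\<close>.\<close>

lemma kinetic_speed_lipschitz:
  assumes "kinetic h0 V0" "0 < h0"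
  obtains L where "0 \<le> L"
    "\<And>h V h' V'. h0 / 2 \<le> h \<Longrightarrow> h \<le> 2 * h0 \<Longrightarrow> h0 / 2 \<le> h' \<Longrightarrow> h' \<le> 2 * h0 \<Longrightarrow>
       kinetic h V \<Longrightarrow> kinetic h' V' \<Longrightarrow> \<bar>V - V'\<bar> \<le> L * \<bar>h - h'\<bar>"
proof -
  \<comment> \<open>Obtained by solving \<open>(h0 / 2)\<^sup>2 * pp_slope * (V - V') \<le> (4 * h0)
    * (4 * PP V0) * \<bar>h - h'\<bar>\<close> for \<open>V - V'\<close>.\<close>
  define L where "L = 64 * PP V0 / (pp_slope * h0)"
  have p0: "0 < PP V0" using assms kinetic_V PP_pos by auto
  have *: "V - V' \<le> L * \<bar>h - h'\<bar>" if "h0 / 2 \<le> h" "h \<le> 2 * h0" "h0 / 2 \<le> h'" "h' \<le> 2 * h0"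
       "kinetic h V" "kinetic h' V'" "V' < V" for h V h' V'
  proof -
    have h: "0 < h" "0 < h'" using that assms by auto
    have VV: "V \<in> {-c3<..<c3}" "V' \<in> {-c3<..<c3}" using that kinetic_V by auto
    have "h'\<^sup>2 * PP V - h'\<^sup>2 * PP V' \<le> h'\<^sup>2 * PP V - h\<^sup>2 * PP V"
      using kinetic_mono[OF that(6,5,7)] by simp
    also have "\<dots> = (h' - h) * (h + h') * PP V" by (simp add: algebra_simps power2_eq_square)
    also have "\<dots> \<le> \<bar>h - h'\<bar> * (4 * h0) * (4 * PP V0)"
      using that h kinetic_PP_bound[OF assms(1) that(5,1) assms(2)] PP_pos[OF VV(1)]
      by (intro mult_mono) auto
    finally have 1: "h'\<^sup>2 * (PP V - PP V') \<le> 16 * h0 * PP V0 * \<bar>h - h'\<bar>" by (simp add: algebra_simps)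
    have "(h0 / 2)\<^sup>2 * (pp_slope * (V - V')) \<le> h'\<^sup>2 * (PP V - PP V')"
      using that assms(2) PP_lower[OF VV(2,1)] pp_slope_pos
      by (intro mult_mono power_mono mult_nonneg_nonneg) (auto intro: less_imp_le)
    with 1 have "h0\<^sup>2 / 4 * (pp_slope * (V - V')) \<le> 16 * h0 * PP V0 * \<bar>h - h'\<bar>" by (simp add: power_divide)
    then have "h0 * (h0 / 4 * (pp_slope * (V - V'))) \<le> h0 * (16 * PP V0 * \<bar>h - h'\<bar>)"
      by (simp add: power2_eq_square mult_ac)
    then have "h0 / 4 * (pp_slope * (V - V')) \<le> 16 * PP V0 * \<bar>h - h'\<bar>"
      using assms(2) by (simp only: mult_le_cancel_left_pos)
    then show ?thesis unfolding L_def using assms(2) pp_slope_pos by (simp add: pos_le_divide_eq mult.commute mult.left_commute)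
  qed
  have L0: "0 \<le> L" unfolding L_def using p0 pp_slope_pos assms(2) by (intro divide_nonneg_nonneg mult_nonneg_nonneg) auto
  show ?thesis
  proof (rule that[OF L0])
    fix h V h' V' assume a: "h0 / 2 \<le> h" "h \<le> 2 * h0" "h0 / 2 \<le> h'" "h' \<le> 2 * h0" "kinetic h V" "kinetic h' V'"
    show "\<bar>V - V'\<bar> \<le> L * \<bar>h - h'\<bar>"
      using *[OF a(1-6)] *[OF a(3,4,1,2,6,5)] L0 unfolding abs_minus_commute[of h' h]
      by (cases V V' rule: linorder_cases) auto
  qed
qed

lemma PP_continuous: "V \<in> {-c3<..<c3} \<Longrightarrow> isCont PP V"
  unfolding PP_def using V_pos[of V] by (intro continuous_intros) auto

lemma PP_near_c3:
  assumes "0 \<le> V" "V < c3"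
  shows "c3 * (c1 - c3) / (2 * c1 * (c3 - V)) \<le> PP V"
proof -
  have "c3 * (c1 - c3) \<le> (c3 + V) * (c1 - V)" "(c1 + V) * (c3 - V) \<le> 2 * c1 * (c3 - V)"
    using assms c_simps(1-3) by (intro mult_mono; linarith)+
  moreover have "0 < (c1 + V) * (c3 - V)"
    using assms c_simps(1-3) by (intro mult_pos_pos; linarith)
  moreover have "0 \<le> c3 * (c1 - c3)" using c_simps(2,3) by (intro mult_nonneg_nonneg) auto
  ultimately show ?thesis unfolding PP_def by (intro frac_le) auto
qed

lemma phi_cont:
  assumes "V \<in> {-c3<..<c3}" "V \<noteq> 0"
  shows "isCont \<phi> V"
proof -
  obtain \<phi>' where d: "\<And>V. V \<in> {-c3<..<0} \<union> {0<..c3} \<Longrightarrow> (\<phi> has_real_derivative \<phi>' V) (at V within {-c3<..<0} \<union> {0<..c3})"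
    using ent_derivs by metis
  have "(\<phi> has_real_derivative \<phi>' V) (at V within {-c3<..<0} \<union> {0<..<c3})"
    by (rule has_field_derivative_subset[OF d]) (use assms in auto)
  moreover have "at V within {-c3<..<0} \<union> {0<..<c3} = at V"
    using assms by (intro at_within_open) auto
  ultimately show ?thesis by (auto intro: DERIV_isCont)
qed

text \<open>An intermediate value argument for a continuous decreasing \<open>F\<close> and an
  increasing \<open>\<phi>\<close> that may jump. The supremum \<open>s\<close> of the set where
  \<open>\<phi> \<le> F\<close> satisfies \<open>\<phi>(s-) \<le> F s \<le> \<phi>(s+)\<close>. For
  \<open>s \<noteq> 0\<close> this is an equality by continuity, and for \<open>s = 0\<close> it is
  the filled-in jump.\<close>

lemma kinetic_exists:
  assumes "0 < h"
  shows "\<exists>V. kinetic h V"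
proof -
  define F where "F V = (k1 - k3) / 2 * (wM * wm - h\<^sup>2 * PP V)" for V
  have F_anti: "F V' \<le> F V" if "V \<in> {-c3<..<c3}" "V' \<in> {-c3<..<c3}" "V \<le> V'" for V V'
    unfolding F_def using PP_le[OF that] k13 by (intro mult_left_mono diff_left_mono) auto
  have F_cont: "isCont F V" if "V \<in> {-c3<..<c3}" for V
    unfolding F_def by (intro continuous_intros PP_continuous that)
  define S where "S = {V\<in>{-c3<..<c3}. \<phi> V \<le> F V}"
  have down: "V \<in> S" if "V' \<in> S" "V \<le> V'" "-c3 < V" for V V'
    using that F_anti[of V V'] ent_mono[of V V'] by (auto simp: S_def)
  \<comment> \<open>\<open>S\<close> is nonempty since \<open>\<phi>\<close> tends to minus infinity
    at \<open>-c3\<close> while \<open>F \<ge> F 0\<close> at negative speeds.\<close>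
  have "eventually (\<lambda>V. \<phi> V \<le> F 0) (at_right (-c3))"
    using ent unfolding entropy_dissipation_def filterlim_at_bot by blast
  moreover have "eventually (\<lambda>V. V \<in> {-c3<..<0}) (at_right (-c3))"
    by (rule eventually_at_right_real) (use c_simps(2) in linarith)
  ultimately have "eventually (\<lambda>V. \<phi> V \<le> F 0 \<and> V \<in> {-c3<..<0}) (at_right (-c3))"
    by (rule eventually_conj)
  then obtain Va where Va: "\<phi> Va \<le> F 0" "Va \<in> {-c3<..<0}"
    using eventually_happens trivial_limit_at_right_real by blast
  have "Va \<in> {-c3<..<c3}" "(0::real) \<in> {-c3<..<c3}" using Va(2) c_simps(2) by auto
  with Va F_anti[of Va 0] have VaS: "Va \<in> S" by (auto simp: S_def)
  obtain Vb where Vb: "0 \<le> Vb" "Vb < c3" "F Vb < \<phi> Vb"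
  proof -
    \<comment> \<open>At this distance from \<open>c3\<close>, \<open>PP_near_c3\<close> makes
      \<open>h\<^sup>2 * PP\<close> at least \<open>2 * wM * wm\<close>, so \<open>F\<close> is
      negative there while \<open>\<phi> \<ge> 0\<close>.\<close>
    let ?e = "min c3 (h\<^sup>2 * (c3 * (c1 - c3)) / (4 * c1 * (wM * wm)))"
    have wp: "0 < wM * wm" using wM_pos wMm by simp
    have q: "0 < h\<^sup>2 * (c3 * (c1 - c3))" using assms c_simps(2,3) by (intro mult_pos_pos) auto
    have e: "0 < ?e" using q wp c_simps(1,2) by (auto intro!: divide_pos_pos mult_pos_pos)
    have "?e \<le> h\<^sup>2 * (c3 * (c1 - c3)) / (4 * c1 * (wM * wm))" by simp
    then have "?e * (4 * c1 * (wM * wm)) \<le> h\<^sup>2 * (c3 * (c1 - c3))"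
      using wp c_simps(1) by (subst (asm) pos_le_divide_eq) auto
    then have "2 * (wM * wm) \<le> h\<^sup>2 * (c3 * (c1 - c3)) / (2 * c1 * ?e)"
      using e c_simps(1) by (subst pos_le_divide_eq) (auto simp: algebra_simps intro!: mult_pos_pos)
    also have "\<dots> = h\<^sup>2 * (c3 * (c1 - c3) / (2 * c1 * (c3 - (c3 - ?e))))" by simp
    also have "\<dots> \<le> h\<^sup>2 * PP (c3 - ?e)" using e by (intro mult_left_mono PP_near_c3) auto
    finally have "wM * wm < h\<^sup>2 * PP (c3 - ?e)" using wp by linarith
    then have "F (c3 - ?e) < 0" unfolding F_def using k13 by (intro mult_pos_neg) auto
    moreover have "0 \<le> \<phi> (c3 - ?e)"
      using ent e unfolding entropy_dissipation_def by (auto simp: min_def split: if_splits)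
    ultimately show ?thesis using e by (intro that[of "c3 - ?e"]) auto
  qed
  have ub: "V \<le> Vb" if "V \<in> S" for V
    using down[OF that, of Vb] Vb c_simps(2) by (cases "V \<le> Vb") (auto simp: S_def)
  then have bdd: "bdd_above S" by (rule bdd_aboveI)
  define s where "s = Sup S"
  have s: "s \<in> {-c3<..<c3}"
  proof -
    have "Sup S \<le> Vb" using VaS ub by (intro cSup_least) auto
    then show ?thesis using cSup_upper[OF VaS bdd] Va(2) Vb(2) unfolding s_def by auto
  qed
  have le: "\<phi> V \<le> F V" if V: "-c3 < V" "V < s" for V
  proof -
    obtain V' where "V' \<in> S" "V < V'" using less_cSupD[of S V] VaS V(2) unfolding s_def by auto
    then show ?thesis using down[of V' V] V by (auto simp: S_def)
  qed
  have ge: "F V \<le> \<phi> V" if V: "s < V" "V < c3" for V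
    using cSup_upper[of V S] bdd s V unfolding s_def[symmetric] by (force simp: S_def)
  have Fl: "(F \<longlongrightarrow> F s) (at_left s)" and Fr: "(F \<longlongrightarrow> F s) (at_right s)"
    using F_cont[OF s] by (auto simp: isCont_def filterlim_at_split)
  have evl: "eventually (\<lambda>V. \<phi> V \<le> F V) (at_left s)"
    by (rule eventually_mono[OF eventually_at_left_real[of "-c3" s]]) (use s le in auto)
  have evr: "eventually (\<lambda>V. F V \<le> \<phi> V) (at_right s)"
    by (rule eventually_mono[OF eventually_at_right_real[of s c3]]) (use s ge in auto)
  have "kinetic_relation s (F s)"
  proof (cases "s = 0")
    case True
    obtain l l' where l: "(\<phi> \<longlongrightarrow> l) (at_left 0)" "(\<phi> \<longlongrightarrow> l') (at_right 0)"
      "Lim (at_left 0) \<phi> = l" "Lim (at_right 0) \<phi> = l'" using ent_limits by blast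
    have "l \<le> F 0" using tendsto_le[OF _ _ l(1)] Fl evl True by auto
    moreover have "F 0 \<le> l'" using tendsto_le[OF _ l(2)] Fr evr True by auto
    ultimately show ?thesis using True l by (simp add: kinetic_relation_def)
  next
    case False
    have "(\<phi> \<longlongrightarrow> \<phi> s) (at_left s)" "(\<phi> \<longlongrightarrow> \<phi> s) (at_right s)"
      using phi_cont[OF s False] by (auto simp: isCont_def filterlim_at_split)
    then have "\<phi> s \<le> F s" "F s \<le> \<phi> s"
      using tendsto_le[OF _ Fl _ evl] tendsto_le[OF _ _ Fr evr] by auto
    then show ?thesis using False by (simp add: kinetic_relation_def)
  qed
  then show ?thesis using s unfolding kinetic_def w_minus_w_plus F_def by blast
qed

section \<open>Lipschitz bounds for the strains away from the sonic speed\<close>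

lemma weighted_diff: "a * h - b * h' = a * (h - h') + (a - b) * h'" for a b h h' :: real
  by (simp add: algebra_simps)

lemma minus_ratio:
  assumes "V \<in> {-c3<..<c3}"
  shows "0 \<le> (c3 + V) / (c1 + V)" "(c3 + V) / (c1 + V) \<le> 1"
proof -
  note v = V_pos[OF assms] c_simps(3)
  show "0 \<le> (c3 + V) / (c1 + V)" by (rule divide_nonneg_pos) (use v in linarith)+
  have "c3 + V \<le> 1 * (c1 + V)" using v by simp
  then show "(c3 + V) / (c1 + V) \<le> 1" by (subst pos_divide_le_eq[OF v(3)])
qed

lemma w_minus_bounds:
  assumes "V \<in> {-c3<..<c3}" "0 \<le> h"
  shows "0 \<le> w_minus V h" "w_minus V h \<le> h"
  unfolding w_minus_def
  using mult_nonneg_nonneg[OF minus_ratio(1)[OF assms(1)] assms(2)]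
    mult_right_mono[OF minus_ratio(2)[OF assms(1)] assms(2)] by (simp_all only: mult_1)

text \<open>The denominators \<open>c1 + V\<close> are at least \<open>c1 - c3\<close>, so the bound
  is uniform up to the sonic speed.\<close>

lemma w_minus_lipschitz:
  assumes V: "V \<in> {-c3<..<c3}" "V' \<in> {-c3<..<c3}" and h: "0 \<le> h" "0 \<le> h'" "h' \<le> B"
  shows "\<bar>w_minus V h - w_minus V' h'\<bar> \<le> \<bar>h - h'\<bar> + B / (c1 - c3) * \<bar>V - V'\<bar>"
proof -
  note v = V_pos[OF V(1)] V_pos[OF V(2)]
  let ?r = "\<lambda>V. (c3 + V) / (c1 + V)"
  have d: "0 < c1 - c3" using c_simps(3) by linarith
  have R: "\<bar>?r V\<bar> \<le> 1" using minus_ratio[OF V(1)] by (simp only: abs_of_nonneg)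
  have "?r V - ?r V' = (c1 - c3) * (V - V') / ((c1 + V) * (c1 + V'))"
    using v by (simp add: diff_frac_eq) (simp add: algebra_simps)
  then have "\<bar>?r V - ?r V'\<bar> = (c1 - c3) * \<bar>V - V'\<bar> / ((c1 + V) * (c1 + V'))"
    using v d by (simp add: abs_mult)
  also have "\<dots> \<le> (c1 - c3) * \<bar>V - V'\<bar> / ((c1 - c3) * (c1 - c3))"
    using V d v unfolding greaterThanLessThan_iff by (intro divide_left_mono mult_mono mult_pos_pos; linarith?) auto
  also have "\<dots> = \<bar>V - V'\<bar> / (c1 - c3)" using d by simp
  finally have R': "\<bar>?r V - ?r V'\<bar> \<le> \<bar>V - V'\<bar> / (c1 - c3)" .
  have "w_minus V h - w_minus V' h' = ?r V * (h - h') + (?r V - ?r V') * h'"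
    unfolding w_minus_def by (rule weighted_diff)
  also have "\<bar>\<dots>\<bar> \<le> \<bar>?r V\<bar> * \<bar>h - h'\<bar> + \<bar>?r V - ?r V'\<bar> * \<bar>h'\<bar>"
    unfolding abs_mult[symmetric] by (rule abs_triangle_ineq)
  also have "\<dots> \<le> 1 * \<bar>h - h'\<bar> + \<bar>V - V'\<bar> / (c1 - c3) * B"
    using R R' h d by (intro add_mono mult_mono) auto
  finally show ?thesis by (simp add: mult.commute)
qed

text \<open>The quotient has a pole at \<open>c3\<close>; \<open>\<mu>\<close> measures the distance
  of the speeds from it. The sonic case, where this distance tends to \<open>0\<close>, goes through
  \<open>sonic_profile\<close> instead.\<close>

lemma w_plus_lipschitz:
  assumes V: "V \<in> {-c3<..<c3}" "V' \<in> {-c3<..<c3}" and \<mu>: "0 < \<mu>" "\<mu> \<le> c3 - V" "\<mu> \<le> c3 - V'"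
    and h: "0 \<le> h" "0 \<le> h'" "h' \<le> B"
  shows "\<bar>w_plus V h - w_plus V' h'\<bar> \<le> (1 + (c1 - c3) / \<mu>) * \<bar>h - h'\<bar> + B * (c1 - c3) / \<mu>\<^sup>2 * \<bar>V - V'\<bar>"
proof -
  note v = V_pos[OF V(1)] V_pos[OF V(2)]
  let ?r = "\<lambda>V. (c1 - V) / (c3 - V)"
  have d: "0 < c1 - c3" using c_simps(3) by linarith
  have "?r V = 1 + (c1 - c3) / (c3 - V)" using v by (simp add: field_simps)
  also have "\<dots> \<le> 1 + (c1 - c3) / \<mu>" using v \<mu> d by (intro add_left_mono divide_left_mono) auto
  finally have R: "\<bar>?r V\<bar> \<le> 1 + (c1 - c3) / \<mu>" using v by simp
  have "?r V - ?r V' = (c1 - c3) * (V - V') / ((c3 - V) * (c3 - V'))"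
    using v by (simp add: diff_frac_eq) (simp add: algebra_simps)
  then have "\<bar>?r V - ?r V'\<bar> = (c1 - c3) * \<bar>V - V'\<bar> / ((c3 - V) * (c3 - V'))"
    using v d by (simp add: abs_mult)
  also have "\<dots> \<le> (c1 - c3) * \<bar>V - V'\<bar> / (\<mu> * \<mu>)"
    using \<mu> d v by (intro divide_left_mono mult_mono mult_pos_pos) auto
  finally have R': "\<bar>?r V - ?r V'\<bar> \<le> (c1 - c3) * \<bar>V - V'\<bar> / \<mu>\<^sup>2" by (simp add: power2_eq_square)
  have "w_plus V h - w_plus V' h' = ?r V * (h - h') + (?r V - ?r V') * h'"
    unfolding w_plus_def by (rule weighted_diff)
  also have "\<bar>\<dots>\<bar> \<le> \<bar>?r V\<bar> * \<bar>h - h'\<bar> + \<bar>?r V - ?r V'\<bar> * \<bar>h'\<bar>"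
    unfolding abs_mult[symmetric] by (rule abs_triangle_ineq)
  also have "\<dots> \<le> (1 + (c1 - c3) / \<mu>) * \<bar>h - h'\<bar> + (c1 - c3) * \<bar>V - V'\<bar> / \<mu>\<^sup>2 * B"
    using R R' h d \<mu> by (intro add_mono mult_mono) auto
  finally show ?thesis by (simp add: mult_ac)
qed

lemma subsonic_lipschitz:
  assumes k0: "kinetic h0 V0" and h0: "0 < h0"
  obtains L where "0 \<le> L"
    "\<And>h V h' V'. h0 / 2 \<le> h \<Longrightarrow> h \<le> 2 * h0 \<Longrightarrow> h0 / 2 \<le> h' \<Longrightarrow> h' \<le> 2 * h0 \<Longrightarrow>
       kinetic h V \<Longrightarrow> kinetic h' V' \<Longrightarrow>
       \<bar>w_minus V h - w_minus V' h'\<bar> \<le> L * \<bar>h - h'\<bar> \<and> \<bar>w_plus V h - w_plus V' h'\<bar> \<le> L * \<bar>h - h'\<bar>"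
proof -
  obtain L where L: "0 \<le> L" "\<And>h V h' V'. h0 / 2 \<le> h \<Longrightarrow> h \<le> 2 * h0 \<Longrightarrow> h0 / 2 \<le> h' \<Longrightarrow> h' \<le> 2 * h0 \<Longrightarrow>
       kinetic h V \<Longrightarrow> kinetic h' V' \<Longrightarrow> \<bar>V - V'\<bar> \<le> L * \<bar>h - h'\<bar>"
    using kinetic_speed_lipschitz[OF assms] by blast
  have d: "0 < c1 - c3" using c_simps(3) by linarith
  have P0: "0 < PP V0" using k0 kinetic_V PP_pos by blast
  \<comment> \<open>For \<open>V > 0\<close>, \<open>PP_near_c3\<close> and the bound
    \<open>PP V \<le> 4 * PP V0\<close> force \<open>c3 - V\<close> to be at least the second
    argument; for \<open>V \<le> 0\<close> it is at least \<open>c3\<close>.\<close>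
  define \<mu> where "\<mu> = min c3 (c3 * (c1 - c3) / (8 * c1 * PP V0))"
  have \<mu>: "0 < \<mu>" unfolding \<mu>_def using d P0 c_simps(1,2) by (auto intro!: divide_pos_pos mult_pos_pos)
  have \<mu>_le: "\<mu> \<le> c3 - V" if "kinetic h V" "h0 / 2 \<le> h" for h V
  proof (cases "V \<le> 0")
    case False
    have V: "V \<in> {-c3<..<c3}" using that kinetic_V by blast
    have "c3 * (c1 - c3) / (2 * c1 * (c3 - V)) \<le> 4 * PP V0"
      using PP_near_c3[of V] False V kinetic_PP_bound[OF k0 that h0] by auto
    then have "c3 * (c1 - c3) \<le> (c3 - V) * (8 * c1 * PP V0)"
      using V_pos[OF V] c_simps(1) P0 by (subst (asm) pos_divide_le_eq) (auto simp: algebra_simps intro!: mult_pos_pos)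
    then have "c3 * (c1 - c3) / (8 * c1 * PP V0) \<le> c3 - V"
      using P0 c_simps(1) by (subst pos_divide_le_eq) (auto intro!: mult_pos_pos)
    then show ?thesis by (simp add: \<mu>_def)
  qed (simp add: \<mu>_def)
  define L1 where "L1 = 1 + 2 * h0 / (c1 - c3) * L"
  define L2 where "L2 = (1 + (c1 - c3) / \<mu>) + 2 * h0 * (c1 - c3) / \<mu>\<^sup>2 * L"
  have L12: "0 \<le> L1" "0 \<le> L2" using L(1) d \<mu> h0 by (auto simp: L1_def L2_def)
  show ?thesis
  proof (rule that[of "max L1 L2"])
    fix h V h' V' assume a: "h0 / 2 \<le> h" "h \<le> 2 * h0" "h0 / 2 \<le> h'" "h' \<le> 2 * h0" "kinetic h V" "kinetic h' V'"
    note VV = L(2)[OF a]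
    have hh: "0 \<le> h" "0 \<le> h'" using a h0 by auto
    have "\<bar>w_minus V h - w_minus V' h'\<bar> \<le> \<bar>h - h'\<bar> + 2 * h0 / (c1 - c3) * \<bar>V - V'\<bar>"
      using a hh kinetic_V by (intro w_minus_lipschitz) auto
    also have "\<dots> \<le> \<bar>h - h'\<bar> + 2 * h0 / (c1 - c3) * (L * \<bar>h - h'\<bar>)"
      using VV d h0 by (intro add_left_mono mult_left_mono) auto
    also have "\<dots> = L1 * \<bar>h - h'\<bar>" by (simp add: L1_def distrib_right)
    also have "\<dots> \<le> max L1 L2 * \<bar>h - h'\<bar>" by (intro mult_right_mono) auto
    finally have 1: "\<bar>w_minus V h - w_minus V' h'\<bar> \<le> max L1 L2 * \<bar>h - h'\<bar>" .
    have "\<bar>w_plus V h - w_plus V' h'\<bar> \<le> (1 + (c1 - c3) / \<mu>) * \<bar>h - h'\<bar> + 2 * h0 * (c1 - c3) / \<mu>\<^sup>2 * \<bar>V - V'\<bar>"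
      using a hh kinetic_V \<mu> \<mu>_le by (intro w_plus_lipschitz) auto
    also have "\<dots> \<le> (1 + (c1 - c3) / \<mu>) * \<bar>h - h'\<bar> + 2 * h0 * (c1 - c3) / \<mu>\<^sup>2 * (L * \<bar>h - h'\<bar>)"
      using VV d h0 by (intro add_left_mono mult_left_mono) auto
    also have "\<dots> = L2 * \<bar>h - h'\<bar>" by (simp add: L2_def distrib_right)
    also have "\<dots> \<le> max L1 L2 * \<bar>h - h'\<bar>" by (intro mult_right_mono) auto
    finally show "\<bar>w_minus V h - w_minus V' h'\<bar> \<le> max L1 L2 * \<bar>h - h'\<bar> \<and>
        \<bar>w_plus V h - w_plus V' h'\<bar> \<le> max L1 L2 * \<bar>h - h'\<bar>" using 1 by blast
  qed (use L12 in auto)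
qed

section \<open>The sonic limit\<close>

text \<open>In substance \<open>\<Delta> y\<close> is the integral of
  \<open>\<phi>' (c3 - s * y)\<close> over \<open>s\<close> in [0, 1], so it inherits the Lipschitz
  bound of \<open>\<phi>'\<close>, that is, a bound of \<open>\<phi>''\<close> on
  \<open>[c3 / 2, c3]\<close>.\<close>

lemma sonic_slope:
  assumes D: "(\<phi> has_real_derivative D) (at_left c3)"
  obtains B \<Delta> where "0 \<le> B" "\<Delta> 0 = D"
    "\<And>y. 0 < y \<Longrightarrow> y \<le> c3 / 2 \<Longrightarrow> \<phi> c3 - \<phi> (c3 - y) = y * \<Delta> y"
    "\<And>y y'. 0 \<le> y \<Longrightarrow> y \<le> c3 / 2 \<Longrightarrow> 0 \<le> y' \<Longrightarrow> y' \<le> c3 / 2 \<Longrightarrow> \<bar>\<Delta> y - \<Delta> y'\<bar> \<le> B * \<bar>y - y'\<bar>"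
proof -
  let ?D = "{-c3<..<0} \<union> {0<..c3}" and ?I = "{c3 / 2..c3}"
  note c3 = c_simps(2)
  have "\<exists>\<phi>' \<phi>''. (\<forall>V\<in>?D. (\<phi> has_real_derivative \<phi>' V) (at V within ?D)) \<and>
      (\<forall>V\<in>?D. (\<phi>' has_real_derivative \<phi>'' V) (at V within ?D)) \<and> continuous_on ?D \<phi>''"
    using ent unfolding entropy_dissipation_def Let_def by blast
  then obtain \<phi>' \<phi>'' where d:
    "\<forall>V\<in>?D. (\<phi> has_real_derivative \<phi>' V) (at V within ?D)"
    "\<forall>V\<in>?D. (\<phi>' has_real_derivative \<phi>'' V) (at V within ?D)"
    "continuous_on ?D \<phi>''"
    by (elim exE conjE)
  have I: "?I \<subseteq> ?D" using c3 by auto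
  have d1: "(\<phi> has_real_derivative \<phi>' V) (at V within ?I)" if "V \<in> ?I" for V
    by (rule has_field_derivative_subset[OF bspec[OF d(1)] I]) (use I that in blast)
  have d2: "(\<phi>' has_real_derivative \<phi>'' V) (at V within ?I)" if "V \<in> ?I" for V
    by (rule has_field_derivative_subset[OF bspec[OF d(2)] I]) (use I that in blast)
  have "compact (\<phi>'' ` ?I)"
    using continuous_on_subset[OF d(3) I] by (intro compact_continuous_image) auto
  then have "bounded (\<phi>'' ` ?I)" by (rule compact_imp_bounded)
  then obtain B where "\<forall>x\<in>\<phi>'' ` ?I. norm x \<le> B" unfolding bounded_iff by (rule exE)
  then have B: "\<bar>\<phi>'' V\<bar> \<le> B" if "V \<in> ?I" for V using that by simp
  have B0: "0 \<le> B" using B[of c3] c3 by auto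
  have lip: "\<bar>\<phi>' V - \<phi>' V'\<bar> \<le> B * \<bar>V - V'\<bar>" if "V \<in> ?I" "V' \<in> ?I" for V V'
  proof -
    have "norm (\<phi>' V - \<phi>' V') \<le> B * norm (V - V')"
      by (rule field_differentiable_bound[of ?I, OF _ d2]) (use B that in auto)
    then show ?thesis by simp
  qed
  have D': "\<phi>' c3 = D"
  proof -
    have "at c3 within ?I = at_left c3" using c3 by (intro at_within_Icc_at_left) auto
    then have "(\<phi> has_real_derivative \<phi>' c3) (at_left c3)"
      using d1[of c3] c3 by auto
    from this[unfolded has_field_derivative_iff] D[unfolded has_field_derivative_iff]
    show ?thesis by (rule tendsto_unique[OF trivial_limit_at_left_real])
  qed
  \<comment> \<open>\<open>E y\<close> is a primitive in \<open>s\<close> of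
    \<open>\<phi>' (c3 - s * y)\<close> vanishing at \<open>s = 0\<close>, so the mean value
    inequality for \<open>E y - E y'\<close> replaces the integral. The value at
    \<open>y = 0\<close> is chosen to keep this derivative.\<close>
  define E where "E y s = (if y = 0 then D * s else (\<phi> c3 - \<phi> (c3 - s * y)) / y)" for y s
  have inI: "c3 - s * y \<in> ?I" if "s \<in> {0..1}" "0 \<le> y" "y \<le> c3 / 2" for s y
  proof -
    have "0 \<le> s * y" using that by simp
    moreover have "s * y \<le> 1 * (c3 / 2)" using that by (intro mult_mono) auto
    ultimately show ?thesis by simp
  qed
  have E: "(E y has_real_derivative \<phi>' (c3 - s * y)) (at s within {0..1})"
    if s: "s \<in> {0..1}" and y: "0 \<le> y" "y \<le> c3 / 2" for s y
  proof (cases "y = 0")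
    case True
    then have "E y = (\<lambda>s. D * s)" by (auto simp: E_def)
    moreover have "((\<lambda>s. D * s) has_real_derivative D) (at s within {0..1})"
      using DERIV_cmult[OF DERIV_ident, of D s "{0..1}"] by simp
    ultimately show ?thesis using True D' by simp
  next
    case False
    have sub: "(\<lambda>s. c3 - s * y) ` {0..1} \<subseteq> ?I" using inI y by blast
    have "((\<lambda>s. c3 - s * y) has_real_derivative - y) (at s within {0..1})"
      using DERIV_diff[OF DERIV_const DERIV_cmult_right[OF DERIV_ident, of y], of c3 s "{0..1}"] by simp
    from DERIV_image_chain[OF has_field_derivative_subset[OF d1[OF inI[OF s y]] sub] this]
    have "((\<lambda>s. \<phi> (c3 - s * y)) has_real_derivative \<phi>' (c3 - s * y) * - y) (at s within {0..1})"
      by (simp add: o_def)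
    then have "((\<lambda>s. (\<phi> c3 - \<phi> (c3 - s * y)) / y) has_real_derivative (0 - \<phi>' (c3 - s * y) * - y) / y) (at s within {0..1})"
      by (intro DERIV_cdivide DERIV_diff DERIV_const)
    moreover have "E y = (\<lambda>s. (\<phi> c3 - \<phi> (c3 - s * y)) / y)" using False by (auto simp: E_def)
    ultimately show ?thesis using False by simp
  qed
  define \<Delta> where "\<Delta> y = E y 1" for y
  show ?thesis
  proof (rule that[OF B0])
    show "\<Delta> 0 = D" by (simp add: \<Delta>_def E_def)
    show "\<phi> c3 - \<phi> (c3 - y) = y * \<Delta> y" if "0 < y" "y \<le> c3 / 2" for y
      using that by (simp add: \<Delta>_def E_def)
    fix y y' assume y: "0 \<le> y" "y \<le> c3 / 2" "0 \<le> y'" "y' \<le> c3 / 2"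
    have "norm ((E y 1 - E y' 1) - (E y 0 - E y' 0)) \<le> (B * \<bar>y - y'\<bar>) * norm (1 - 0::real)"
    proof (rule field_differentiable_bound[of "{0..1}"])
      fix s :: real assume s: "s \<in> {0..1}"
      show "((\<lambda>s. E y s - E y' s) has_real_derivative \<phi>' (c3 - s * y) - \<phi>' (c3 - s * y')) (at s within {0..1})"
        using E s y by (intro DERIV_diff) auto
      have "\<bar>\<phi>' (c3 - s * y) - \<phi>' (c3 - s * y')\<bar> \<le> B * \<bar>(c3 - s * y) - (c3 - s * y')\<bar>"
        using inI s y by (intro lip) auto
      also have "(c3 - s * y) - (c3 - s * y') = s * (y' - y)" by (simp add: algebra_simps)
      also have "B * \<bar>s * (y' - y)\<bar> \<le> B * \<bar>y - y'\<bar>"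
        using s B0 mult_right_mono[of s 1 "\<bar>y - y'\<bar>"] by (intro mult_left_mono) (auto simp: abs_mult abs_minus_commute)
      finally show "norm (\<phi>' (c3 - s * y) - \<phi>' (c3 - s * y')) \<le> B * \<bar>y - y'\<bar>" by simp
    qed auto
    moreover have "E y 0 = 0" for y by (simp add: E_def)
    ultimately show "\<bar>\<Delta> y - \<Delta> y'\<bar> \<le> B * \<bar>y - y'\<bar>" by (simp add: \<Delta>_def)
  qed
qed

text \<open>The second term of \<open>psi_upper\<close> vanishes at \<open>c3\<close>. Hence the
  constants cancel in the kinetic relation, which for \<open>V \<noteq> 0\<close> becomes
  \<open>h\<^sup>2 * PP V * ((k1 - k3) / 2) = \<phi> c3 - \<phi> V\<close>.\<close>

lemma phi_c3: "\<phi> c3 = (k1 - k3) / 2 * (wM * wm)"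
proof -
  have "0 < c3" by (rule c_simps)
  obtain \<phi>' where d: "\<And>V. V \<in> {-c3<..<0} \<union> {0<..c3} \<Longrightarrow> (\<phi> has_real_derivative \<phi>' V) (at V within {-c3<..<0} \<union> {0<..c3})"
    using ent_derivs by metis
  have "(\<phi> has_real_derivative \<phi>' c3) (at c3 within {c3 / 2..c3})"
    by (rule has_field_derivative_subset[OF d]) (use \<open>0 < c3\<close> in auto)
  then have "(\<phi> \<longlongrightarrow> \<phi> c3) (at_left c3)"
    using at_within_Icc_at_left[of "c3 / 2" c3] \<open>0 < c3\<close> DERIV_continuous[of \<phi> _ c3] by (auto simp: continuous_within)
  moreover have "(\<phi> \<longlongrightarrow> psi_upper c3) (at_left c3)"
    using ent unfolding entropy_dissipation_def by blast
  ultimately have "\<phi> c3 = psi_upper c3"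
    using tendsto_unique trivial_limit_at_left_real by blast
  then show ?thesis by (simp add: psi_upper_def c_simps(5) mult.commute)
qed

text \<open>Small strengths force speeds close to \<open>c3\<close>: otherwise
  \<open>\<phi> c3 - \<phi> V\<close> would be at least \<open>\<phi> c3 - \<phi> (c3 - y0)\<close>,
  too large for \<open>h\<^sup>2 * PP V\<close> with \<open>PP V \<le> PP (c3 - y0)\<close>.\<close>

lemma sonic_speed:
  assumes "kinetic h V" "0 < y0" "y0 \<le> c3 / 2" "h\<^sup>2 * PP (c3 - y0) * (k1 - k3) < 2 * (\<phi> c3 - \<phi> (c3 - y0))"
  shows "c3 - y0 < V"
proof (rule ccontr)
  assume "\<not> c3 - y0 < V"
  then have le: "V \<le> c3 - y0" by simp
  have V: "V \<in> {-c3<..<c3}" using assms(1) kinetic_V by blast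
  have y: "0 < c3 - y0" "c3 - y0 < c3" using assms(2,3) c_simps(2) by auto
  have "(k1 - k3) / 2 * (wM * wm - h\<^sup>2 * PP V) \<le> \<phi> (c3 - y0)"
  proof (cases "V = 0")
    case True
    then show ?thesis using assms(1) ent_right_ge[of "c3 - y0"] y
      by (simp add: kinetic_def kinetic_relation_def w_minus_w_plus)
  next
    case False
    then show ?thesis using assms(1) ent_mono[of V "c3 - y0"] y le V
      by (simp add: kinetic_def kinetic_relation_def w_minus_w_plus)
  qed
  then have "2 * (\<phi> c3 - \<phi> (c3 - y0)) \<le> (k1 - k3) * (h\<^sup>2 * PP V)"
    unfolding phi_c3 right_diff_distrib by (simp add: field_simps)
  also have "\<dots> \<le> (k1 - k3) * (h\<^sup>2 * PP (c3 - y0))"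
    using PP_le[OF V _ le] y k13 c_simps(2) by (intro mult_left_mono) auto
  finally show False using assms(4) by (simp add: mult_ac)
qed

text \<open>Near the sonic state the strength of the emitted wave is a Lipschitz function \<open>W\<close> of
  \<open>y = c\<^sub>3 - V\<close>, with \<open>W\<^sup>2 = 2 \<Delta>(y) (k\<^sub>1 - V\<^sup>2) / ((k\<^sub>1 - k\<^sub>3) (c\<^sub>3 + V))\<close>,
  where \<open>\<Delta>\<close> is the divided difference of \<open>\<phi>\<close> at \<open>c\<^sub>3\<close>.\<close>

lemma sonic_profile:
  assumes D: "(\<phi> has_real_derivative D) (at_left c3)" and D0: "0 < D"
  obtains W L y0 where "0 \<le> L" "0 < y0" "y0 \<le> c3 / 2" "W 0 = sqrt (D / c3)"
    "\<And>y. 0 < y \<Longrightarrow> y \<le> y0 \<Longrightarrow> \<phi> (c3 - y) < \<phi> c3"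
    "\<And>y y'. 0 \<le> y \<Longrightarrow> y \<le> y0 \<Longrightarrow> 0 \<le> y' \<Longrightarrow> y' \<le> y0 \<Longrightarrow> \<bar>W y - W y'\<bar> \<le> L * \<bar>y - y'\<bar>"
    "\<And>y. 0 \<le> y \<Longrightarrow> y \<le> y0 \<Longrightarrow> sqrt (D / c3) / 2 \<le> W y"
    "\<And>h V. 0 < h \<Longrightarrow> kinetic h V \<Longrightarrow> c3 - y0 < V \<Longrightarrow> w_plus V h = W (c3 - V)"
proof -
  note cs = c_simps(1-3)
  obtain B \<Delta> where B: "0 \<le> B" and \<Delta>0: "\<Delta> 0 = D"
    and \<Delta>: "\<And>y. 0 < y \<Longrightarrow> y \<le> c3 / 2 \<Longrightarrow> \<phi> c3 - \<phi> (c3 - y) = y * \<Delta> y"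
    and \<Delta>_lip: "\<And>y y'. 0 \<le> y \<Longrightarrow> y \<le> c3 / 2 \<Longrightarrow> 0 \<le> y' \<Longrightarrow> y' \<le> c3 / 2 \<Longrightarrow> \<bar>\<Delta> y - \<Delta> y'\<bar> \<le> B * \<bar>y - y'\<bar>"
    using sonic_slope[OF D] by blast
  define \<rho> where "\<rho> y = (k1 - (c3 - y)\<^sup>2) / (c3 + (c3 - y))" for y
  define \<Omega> where "\<Omega> y = 2 / (k1 - k3) * (\<Delta> y * \<rho> y)" for y
  \<comment> \<open>Product rule: the Lipschitz constant \<open>B\<close> of \<open>\<Delta>\<close>
    times the bound \<open>k1 / c3\<close> of \<open>\<rho>\<close>, plus the bound
    \<open>D + B * c3\<close> of \<open>\<Delta>\<close> times the Lipschitz constant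
    \<open>4 * k1 / k3\<close> of \<open>\<rho>\<close>.\<close>
  define L\<Omega> where "L\<Omega> = 2 / (k1 - k3) * (B * (k1 / c3) + (D + B * c3) * (4 * k1 / k3))"
  define w where "w = sqrt (D / c3)"
  have w: "0 < w" using D0 cs by (simp add: w_def real_sqrt_gt_0_iff)
  have wsq: "w\<^sup>2 = D / c3" using D0 cs by (simp add: w_def)
  have kd: "0 < k1 - k3" using k13 by simp
  have L\<Omega>0: "0 \<le> L\<Omega>" unfolding L\<Omega>_def using B D0 cs kd k3_pos k13 by (intro mult_nonneg_nonneg add_nonneg_nonneg divide_nonneg_nonneg) auto
  have \<rho>_bd: "0 \<le> \<rho> y" "\<rho> y \<le> k1 / c3" and \<rho>_pos: "0 < \<rho> y" if "0 \<le> y" "y \<le> c3 / 2" for y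
  proof -
    have "(c3 - y)\<^sup>2 \<le> c3\<^sup>2" using that by (intro power_mono) auto
    then have "0 < k1 - (c3 - y)\<^sup>2" using k13 by (simp add: c_simps)
    then show p: "0 < \<rho> y" unfolding \<rho>_def using that cs by (intro divide_pos_pos) auto
    then show "0 \<le> \<rho> y" by simp
    show "\<rho> y \<le> k1 / c3" unfolding \<rho>_def using that cs k3_pos k13 by (intro frac_le) auto
  qed
  have \<rho>_lip: "\<bar>\<rho> y - \<rho> y'\<bar> \<le> 4 * k1 / k3 * \<bar>y - y'\<bar>" if y: "0 \<le> y" "y \<le> c3 / 2" "0 \<le> y'" "y' \<le> c3 / 2" for y y'
  proof -
    define V V' where "V = c3 - y" and "V' = c3 - y'"
    have V: "c3 / 2 \<le> V" "V \<le> c3" "c3 / 2 \<le> V'" "V' \<le> c3" using y by (auto simp: V_def V'_def)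
    have p: "0 < c3 + V" "0 < c3 + V'" using V cs by auto
    have "\<rho> y - \<rho> y' = ((k1 - V\<^sup>2) * (c3 + V') - (k1 - V'\<^sup>2) * (c3 + V)) / ((c3 + V) * (c3 + V'))"
      unfolding \<rho>_def V_def[symmetric] V'_def[symmetric] using p by (subst diff_frac_eq) auto
    also have "(k1 - V\<^sup>2) * (c3 + V') - (k1 - V'\<^sup>2) * (c3 + V) = (V' - V) * (k1 + c3 * (V + V') + V * V')"
      by (simp add: algebra_simps power2_eq_square)
    finally have "\<bar>\<rho> y - \<rho> y'\<bar> = \<bar>V' - V\<bar> * \<bar>k1 + c3 * (V + V') + V * V'\<bar> / ((c3 + V) * (c3 + V'))"
      using p by (simp add: abs_mult)
    also have "\<dots> \<le> \<bar>V' - V\<bar> * (4 * k1) / (c3 * c3)"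
    proof (intro frac_le mult_left_mono mult_mono)
      have "0 \<le> c3 * (V + V')" "0 \<le> V * V'" using V cs by auto
      moreover have "c3 * (V + V') \<le> c3 * (c3 + c3)" "V * V' \<le> c3 * c3" using V cs by (intro mult_mono; auto)+
      ultimately show "\<bar>k1 + c3 * (V + V') + V * V'\<bar> \<le> 4 * k1"
        using k13 k3_pos unfolding distrib_left[of c3] c_simps(7) by linarith
    qed (use V cs k13 k3_pos in auto)
    also have "\<dots> = 4 * k1 / k3 * \<bar>y - y'\<bar>" by (simp add: c_simps V_def V'_def)
    finally show ?thesis .
  qed
  have \<Omega>_lip: "\<bar>\<Omega> y - \<Omega> y'\<bar> \<le> L\<Omega> * \<bar>y - y'\<bar>" if y: "0 \<le> y" "y \<le> c3 / 2" "0 \<le> y'" "y' \<le> c3 / 2" for y y'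
  proof -
    have "B * \<bar>y' - 0\<bar> \<le> B * c3" using y cs B by (intro mult_left_mono) auto
    then have D': "\<bar>\<Delta> y'\<bar> \<le> D + B * c3" using \<Delta>_lip[of y' 0] y \<Delta>0 D0 cs by auto
    have "\<Delta> y * \<rho> y - \<Delta> y' * \<rho> y' = (\<Delta> y - \<Delta> y') * \<rho> y + \<Delta> y' * (\<rho> y - \<rho> y')" by (simp add: algebra_simps)
    also have "\<bar>\<dots>\<bar> \<le> \<bar>\<Delta> y - \<Delta> y'\<bar> * \<bar>\<rho> y\<bar> + \<bar>\<Delta> y'\<bar> * \<bar>\<rho> y - \<rho> y'\<bar>"
      unfolding abs_mult[symmetric] by (rule abs_triangle_ineq)
    also have "\<dots> \<le> (B * \<bar>y - y'\<bar>) * (k1 / c3) + (D + B * c3) * (4 * k1 / k3 * \<bar>y - y'\<bar>)"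
      using \<Delta>_lip[OF y] \<rho>_bd[OF y(1,2)] \<rho>_lip[OF y] D' B by (intro add_mono mult_mono) auto
    finally have "\<bar>\<Delta> y * \<rho> y - \<Delta> y' * \<rho> y'\<bar> \<le> (B * (k1 / c3) + (D + B * c3) * (4 * k1 / k3)) * \<bar>y - y'\<bar>"
      by (simp add: algebra_simps)
    then have "2 / (k1 - k3) * \<bar>\<Delta> y * \<rho> y - \<Delta> y' * \<rho> y'\<bar> \<le> 2 / (k1 - k3) * ((B * (k1 / c3) + (D + B * c3) * (4 * k1 / k3)) * \<bar>y - y'\<bar>)"
      using kd by (intro mult_left_mono) auto
    moreover have "\<bar>\<Omega> y - \<Omega> y'\<bar> = 2 / (k1 - k3) * \<bar>\<Delta> y * \<rho> y - \<Delta> y' * \<rho> y'\<bar>"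
      unfolding \<Omega>_def right_diff_distrib[symmetric] abs_mult[of "2 / (k1 - k3)"] using kd
      by (simp only: abs_of_pos divide_pos_pos zero_less_numeral)
    ultimately show ?thesis by (simp only: L\<Omega>_def mult.assoc)
  qed
  \<comment> \<open>As \<open>\<rho> 0 = (k1 - k3) / (2 * c3)\<close>, the limit strain is
    \<open>sqrt (D / c3)\<close>; this is the origin of the value prescribed for the right base
    state in the sonic case.\<close>
  have \<Omega>0: "\<Omega> 0 = w\<^sup>2"
    using kd cs unfolding wsq \<Omega>_def \<rho>_def \<Delta>0 by (simp add: c_simps divide_simps)
  \<comment> \<open>Chosen so that \<open>\<Omega>\<close> loses at most half of
    \<open>\<Omega> 0\<close>; it then stays above \<open>(w / 2)\<^sup>2\<close>, where the square
    root is Lipschitz.\<close>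
  define y0 where "y0 = min (c3 / 2) (w\<^sup>2 / (2 * (L\<Omega> + 1)))"
  have y0: "0 < y0" "y0 \<le> c3 / 2"
    using w cs L\<Omega>0 unfolding y0_def by (auto simp only: min.cobounded1 min_less_iff_conj intro!: divide_pos_pos zero_less_power mult_pos_pos add_nonneg_pos)
  have \<Omega>_low: "(w / 2)\<^sup>2 \<le> \<Omega> y" if y: "0 \<le> y" "y \<le> y0" for y
  proof -
    have "y0 \<le> w\<^sup>2 / (2 * (L\<Omega> + 1))" by (simp add: y0_def)
    then have "y0 * (2 * (L\<Omega> + 1)) \<le> w\<^sup>2" using L\<Omega>0 by (subst (asm) pos_le_divide_eq) auto
    then have "2 * (L\<Omega> * y0) + 2 * y0 \<le> w\<^sup>2" by (simp add: algebra_simps)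
    moreover have "L\<Omega> * y \<le> L\<Omega> * y0" using y L\<Omega>0 by (intro mult_left_mono)
    moreover have "\<bar>\<Omega> 0 - \<Omega> y\<bar> \<le> L\<Omega> * y" using \<Omega>_lip[of 0 y] y y0 cs by auto
    ultimately have "w\<^sup>2 / 2 \<le> \<Omega> y" using \<Omega>0 y0 by (simp add: abs_le_iff)
    moreover have "(w / 2)\<^sup>2 = w\<^sup>2 / 4" "0 \<le> w\<^sup>2" by (auto simp: power_divide)
    ultimately show ?thesis by linarith
  qed
  have W_low: "w / 2 \<le> sqrt (\<Omega> y)" if "0 \<le> y" "y \<le> y0" for y
    using \<Omega>_low[OF that] by (rule real_le_rsqrt)
  show ?thesis
  proof (rule that[of "L\<Omega> / w" y0 "\<lambda>y. sqrt (\<Omega> y)"])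
    show "0 \<le> L\<Omega> / w" using L\<Omega>0 w by simp
    show "sqrt (\<Omega> 0) = sqrt (D / c3)" using \<Omega>0 wsq by simp
    show "\<phi> (c3 - y) < \<phi> c3" if y: "0 < y" "y \<le> y0" for y
    proof -
      have "0 < (w / 2)\<^sup>2" using w by simp
      also have "\<dots> \<le> \<Omega> y" using y by (intro \<Omega>_low) auto
      finally have "0 < \<Delta> y * \<rho> y"
        using kd zero_less_mult_pos[of "2 / (k1 - k3)" "\<Delta> y * \<rho> y"] by (simp only: \<Omega>_def divide_pos_pos zero_less_numeral)
      then have "0 < \<Delta> y" using \<rho>_pos[of y] y y0 zero_less_mult_pos2[of "\<Delta> y" "\<rho> y"] by simp
      then show ?thesis using \<Delta>[of y] y y0 mult_pos_pos[of y "\<Delta> y"] by linarith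
    qed
    show "sqrt (D / c3) / 2 \<le> sqrt (\<Omega> y)" if "0 \<le> y" "y \<le> y0" for y
      using W_low[OF that] by (simp add: w_def)
    show "\<bar>sqrt (\<Omega> y) - sqrt (\<Omega> y')\<bar> \<le> L\<Omega> / w * \<bar>y - y'\<bar>" if y: "0 \<le> y" "y \<le> y0" "0 \<le> y'" "y' \<le> y0" for y y'
    proof -
      let ?a = "sqrt (\<Omega> y)" and ?b = "sqrt (\<Omega> y')"
      have ab: "w / 2 \<le> ?a" "w / 2 \<le> ?b" using W_low y by auto
      have nn: "0 \<le> \<Omega> y" "0 \<le> \<Omega> y'" using \<Omega>_low y by (auto intro: order_trans[OF zero_le_power2])
      have "w * \<bar>?a - ?b\<bar> \<le> (?a + ?b) * \<bar>?a - ?b\<bar>" using ab by (intro mult_right_mono) auto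
      also have "\<dots> = \<bar>(?a + ?b) * (?a - ?b)\<bar>" using ab w by (simp add: abs_mult)
      also have "(?a + ?b) * (?a - ?b) = \<Omega> y - \<Omega> y'"
        using nn by (simp add: algebra_simps real_sqrt_mult_self)
      also have "\<bar>\<dots>\<bar> \<le> L\<Omega> * \<bar>y - y'\<bar>" using y y0 by (intro \<Omega>_lip) auto
      finally show ?thesis using w by (simp add: field_simps)
    qed
    fix h V assume h: "0 < h" and kin: "kinetic h V" and V: "c3 - y0 < V"
    have V': "V \<in> {-c3<..<c3}" "V \<noteq> 0" using kinetic_V[OF kin] V y0 cs by auto
    define y where "y = c3 - V"
    have y: "0 < y" "y \<le> y0" "y \<le> c3 / 2" using V V' y0 by (auto simp: y_def)
    note v = V_pos[OF V'(1)]
    have "(k1 - k3) / 2 * (wM * wm - h\<^sup>2 * PP V) = \<phi> V"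
      using kin V'(2) by (simp add: kinetic_def kinetic_relation_def w_minus_w_plus)
    then have "h\<^sup>2 * PP V * ((k1 - k3) / 2) = \<phi> c3 - \<phi> V" unfolding phi_c3 by (simp add: algebra_simps)
    also have "\<dots> = y * \<Delta> y" using \<Delta>[OF y(1,3)] by (simp add: y_def)
    finally have eq: "h\<^sup>2 * PP V = 2 / (k1 - k3) * (y * \<Delta> y)" using kd by (simp add: field_simps)
    have N: "(c1 - V) * (c1 + V) = k1 - V\<^sup>2"
      by (simp add: algebra_simps power2_eq_square c_simps)
    \<comment> \<open>The factor \<open>y\<close> of \<open>\<phi> c3 - \<phi> V\<close> will cancel
      the pole of the quotient at \<open>V = c3\<close>.\<close>
    have "(w_plus V h)\<^sup>2 = h\<^sup>2 * PP V * ((c1 - V) * (c1 + V) / (y * (c3 + V)))"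
      unfolding w_plus_def PP_def y_def using v by (simp add: power2_eq_square divide_simps)
    also have "\<dots> = 2 / (k1 - k3) * (y * \<Delta> y) * ((k1 - V\<^sup>2) / (y * (c3 + V)))"
      by (simp only: N eq)
    also have "\<dots> = 2 / (k1 - k3) * (\<Delta> y * ((k1 - V\<^sup>2) / (c3 + V)))"
      using y(1) by simp
    also have "\<dots> = \<Omega> y" by (simp add: \<Omega>_def \<rho>_def y_def)
    finally have "(w_plus V h)\<^sup>2 = \<Omega> y" .
    moreover have "0 \<le> w_plus V h" unfolding w_plus_def using v h by simp
    ultimately show "w_plus V h = sqrt (\<Omega> (c3 - V))" unfolding y_def by (metis real_sqrt_unique)
  qed (use y0 in auto)
qed

text \<open>With \<open>y = c3 - V\<close> and \<open>d = c1 - c3\<close> the definition of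
  \<open>w_plus\<close> reads \<open>h = y * A y\<close>, where \<open>A y = W y / (d + y)\<close>.
  Since \<open>A\<close> is bounded below and Lipschitz, this relation can be inverted near
  \<open>0\<close> with a Lipschitz bound for \<open>y\<close> in terms of \<open>h\<close>, and
  both strains inherit it.\<close>

lemma sonic_lipschitz:
  assumes D: "(\<phi> has_real_derivative D) (at_left c3)" and D0: "0 < D"
  obtains K \<epsilon> where "0 \<le> K" "0 < \<epsilon>"
    "\<And>h V h' V'. 0 < h \<Longrightarrow> h \<le> \<epsilon> \<Longrightarrow> 0 < h' \<Longrightarrow> h' \<le> \<epsilon> \<Longrightarrow> kinetic h V \<Longrightarrow> kinetic h' V' \<Longrightarrow>
       \<bar>w_minus V h - w_minus V' h'\<bar> \<le> K * \<bar>h - h'\<bar> \<and> \<bar>w_plus V h - w_plus V' h'\<bar> \<le> K * \<bar>h - h'\<bar>"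
    "\<And>h V. 0 < h \<Longrightarrow> h \<le> \<epsilon> \<Longrightarrow> kinetic h V \<Longrightarrow> \<bar>w_plus V h - sqrt (D / c3)\<bar> \<le> K * h"
proof -
  note cs = c_simps(1-3)
  show ?thesis
  proof (rule sonic_profile[OF assms])
    fix W :: "real \<Rightarrow> real" and L y0 :: real
    assume L: "0 \<le> L" and y0: "0 < y0" "y0 \<le> c3 / 2" and W0: "W 0 = sqrt (D / c3)"
      and \<phi>y0: "\<And>y. 0 < y \<Longrightarrow> y \<le> y0 \<Longrightarrow> \<phi> (c3 - y) < \<phi> c3"
      and W_lip: "\<And>y y'. 0 \<le> y \<Longrightarrow> y \<le> y0 \<Longrightarrow> 0 \<le> y' \<Longrightarrow> y' \<le> y0 \<Longrightarrow> \<bar>W y - W y'\<bar> \<le> L * \<bar>y - y'\<bar>"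
      and W_low: "\<And>y. 0 \<le> y \<Longrightarrow> y \<le> y0 \<Longrightarrow> sqrt (D / c3) / 2 \<le> W y"
      and W: "\<And>h V. 0 < h \<Longrightarrow> kinetic h V \<Longrightarrow> c3 - y0 < V \<Longrightarrow> w_plus V h = W (c3 - V)"
    define w where "w = sqrt (D / c3)"
    have w: "0 < w" using D0 cs by (simp add: w_def real_sqrt_gt_0_iff)
    define d where "d = c1 - c3"
    have d: "0 < d" using cs by (simp add: d_def)
    define A where "A y = W y / (d + y)" for y
    define LA where "LA = L / d + (w + L * c3) / d\<^sup>2"
    define a where "a = w / (2 * (d + c3))"
    have LA0: "0 \<le> LA" using L d w cs by (auto simp: LA_def)
    have a: "0 < a" using w d cs by (auto simp: a_def intro!: divide_pos_pos)
    have W_bd: "\<bar>W y\<bar> \<le> w + L * c3" if "0 \<le> y" "y \<le> y0" for y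
    proof -
      have "\<bar>W y - W 0\<bar> \<le> L * y" using W_lip[of y 0] that y0 by auto
      also have "\<dots> \<le> L * c3" using that y0 L cs by (intro mult_left_mono) auto
      finally show ?thesis using W0 w unfolding w_def[symmetric] by (simp add: abs_le_iff)
    qed
    have A_lip: "\<bar>A y - A y'\<bar> \<le> LA * \<bar>y - y'\<bar>" if y: "0 \<le> y" "y \<le> y0" "0 \<le> y'" "y' \<le> y0" for y y'
    proof -
      have "A y - A y' = (W y - W y') / (d + y) + W y' * ((y' - y) / ((d + y) * (d + y')))"
        unfolding A_def using d y by (simp add: divide_simps) (simp add: algebra_simps)
      also have "\<bar>\<dots>\<bar> \<le> \<bar>(W y - W y') / (d + y)\<bar> + \<bar>W y' * ((y' - y) / ((d + y) * (d + y')))\<bar>"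
        by (rule abs_triangle_ineq)
      also have "\<bar>(W y - W y') / (d + y)\<bar> \<le> (L * \<bar>y - y'\<bar>) / d"
        unfolding abs_divide using W_lip[OF y] d y L by (intro frac_le) auto
      also have "\<bar>W y' * ((y' - y) / ((d + y) * (d + y')))\<bar> \<le> (w + L * c3) * (\<bar>y - y'\<bar> / (d * d))"
        unfolding abs_mult abs_divide using W_bd[of y'] d y
        by (intro mult_mono frac_le) (auto simp: abs_minus_commute)
      finally show ?thesis by (simp add: LA_def algebra_simps power2_eq_square)
    qed
    have A_low: "a \<le> A y" if y: "0 \<le> y" "y \<le> y0" for y
    proof -
      have "w / 2 / (d + c3) \<le> W y / (d + y)"
        using W_low[OF y] y y0 d w cs unfolding w_def[symmetric] by (intro frac_le) auto
      then show ?thesis by (simp add: a_def A_def mult.commute)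
    qed
    \<comment> \<open>Makes the error \<open>y' * (A y - A y')\<close> at most half of the main term
      \<open>a * \<bar>y - y'\<bar>\<close>.\<close>
    define y1 where "y1 = min y0 (a / (2 * (LA + 1)))"
    have y1: "0 < y1" "y1 \<le> y0" "LA * y1 \<le> a / 2"
    proof -
      show "0 < y1" using y0 a LA0 by (auto simp: y1_def intro!: divide_pos_pos)
      show "y1 \<le> y0" by (simp add: y1_def)
      have "y1 \<le> a / (2 * (LA + 1))" by (simp add: y1_def)
      then have "y1 * (2 * (LA + 1)) \<le> a" using LA0 by (subst (asm) pos_le_divide_eq) auto
      then have "2 * (LA * y1) + 2 * y1 \<le> a" by (simp add: algebra_simps)
      then show "LA * y1 \<le> a / 2" using \<open>0 < y1\<close> by linarith
    qed
    have y1_phi: "\<phi> (c3 - y1) < \<phi> c3" using y1 by (intro \<phi>y0)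
    define p where "p = PP (c3 - y1) * (k1 - k3)"
    have p: "0 < p" using y1 y0 cs k13 by (auto simp: p_def intro!: mult_pos_pos PP_pos)
    \<comment> \<open>As \<open>\<epsilon> \<le> 1\<close>, one has
      \<open>h\<^sup>2 \<le> h\<close>, so the quotient yields the hypothesis of
      \<open>sonic_speed\<close> at \<open>y1\<close>; the bound \<open>1\<close> also serves as
      \<open>B\<close> in \<open>w_minus_lipschitz\<close>.\<close>
    define \<epsilon> where "\<epsilon> = min 1 ((\<phi> c3 - \<phi> (c3 - y1)) / p)"
    have \<epsilon>: "0 < \<epsilon>" using p y1_phi by (auto simp: \<epsilon>_def intro!: divide_pos_pos)
    have near: "c3 - y1 < V" if "0 < h" "h \<le> \<epsilon>" "kinetic h V" for h V
    proof (rule sonic_speed[OF that(3) y1(1)])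
      show "y1 \<le> c3 / 2" using y1 y0 by linarith
      have "h * h \<le> h * 1" using that by (intro mult_left_mono) (auto simp: \<epsilon>_def)
      also have "h * 1 \<le> (\<phi> c3 - \<phi> (c3 - y1)) / p" using that by (simp add: \<epsilon>_def)
      finally have "h\<^sup>2 \<le> (\<phi> c3 - \<phi> (c3 - y1)) / p" by (simp add: power2_eq_square)
      then have "h\<^sup>2 * p \<le> \<phi> c3 - \<phi> (c3 - y1)" using p by (simp add: pos_le_divide_eq)
      then show "h\<^sup>2 * PP (c3 - y1) * (k1 - k3) < 2 * (\<phi> c3 - \<phi> (c3 - y1))"
        using y1_phi by (simp add: p_def mult.assoc)
    qed
    have hA: "h = y * A y" "0 < y" "y \<le> y1" "y \<le> y0" "w_plus V h = W y"
      if h: "0 < h" "h \<le> \<epsilon>" "kinetic h V" and y: "y = c3 - V" for h V y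
    proof -
      have V: "c3 - y1 < V" "V \<in> {-c3<..<c3}" using near[OF h] kinetic_V[OF h(3)] by auto
      show 1: "0 < y" "y \<le> y1" "y \<le> y0" using V y y1 by auto
      show wp: "w_plus V h = W y" using W[OF h(1,3)] V y1 y by auto
      have "w_plus V h * (c3 - V) = (c1 - V) * h" unfolding w_plus_def using V by simp
      then have "W y * y = (d + y) * h" unfolding wp y by (simp add: d_def)
      moreover have "0 < d + y" using 1 d by simp
      ultimately show "h = y * A y" by (simp add: A_def field_simps)
    qed
    define LV where "LV = 2 / a"
    have V_lip: "\<bar>y - y'\<bar> \<le> LV * \<bar>h - h'\<bar>"
      if h: "0 < h" "h \<le> \<epsilon>" "kinetic h V" "0 < h'" "h' \<le> \<epsilon>" "kinetic h' V'" and y: "y = c3 - V" "y' = c3 - V'" for h V y h' V' y'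
    proof -
      note h1 = hA[OF h(1-3) y(1)] and h2 = hA[OF h(4-6) y(2)]
      have "h - h' = A y * (y - y') + y' * (A y - A y')"
        using h1(1) h2(1) by (simp add: algebra_simps)
      then have "A y * (y - y') = (h - h') - y' * (A y - A y')" by simp
      then have "\<bar>A y * (y - y')\<bar> \<le> \<bar>h - h'\<bar> + \<bar>y' * (A y - A y')\<bar>"
        using abs_triangle_ineq4[of "h - h'" "y' * (A y - A y')"] by simp
      also have "\<bar>y' * (A y - A y')\<bar> \<le> y1 * (LA * \<bar>y - y'\<bar>)"
        unfolding abs_mult using A_lip[of y y'] h1 h2 by (intro mult_mono) auto
      also have "\<dots> = (LA * y1) * \<bar>y - y'\<bar>" by simp
      also have "\<dots> \<le> a / 2 * \<bar>y - y'\<bar>" using y1(3) by (intro mult_right_mono) auto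
      finally have 3: "\<bar>A y * (y - y')\<bar> \<le> \<bar>h - h'\<bar> + a / 2 * \<bar>y - y'\<bar>" by simp
      have "a * \<bar>y - y'\<bar> \<le> \<bar>A y\<bar> * \<bar>y - y'\<bar>" using A_low[of y] h1 by (intro mult_right_mono) auto
      with 3 have "a * \<bar>y - y'\<bar> \<le> \<bar>h - h'\<bar> + a / 2 * \<bar>y - y'\<bar>" by (simp add: abs_mult)
      then have "\<bar>y - y'\<bar> * a \<le> 2 * \<bar>h - h'\<bar>" by (simp add: field_simps)
      then show ?thesis using a by (simp add: LV_def pos_le_divide_eq)
    qed
    have LV0: "0 \<le> LV" using a by (simp add: LV_def)
    define K where "K = max (1 + 1 / (c1 - c3) * LV) (max (L * LV) (L / a))"
    have K: "1 + 1 / (c1 - c3) * LV \<le> K" "L * LV \<le> K" "L / a \<le> K" by (auto simp: K_def)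
    have K0: "0 \<le> K" using K(2) L LV0 mult_nonneg_nonneg[of L LV] by linarith
    show thesis
    proof (rule that[OF K0 \<epsilon>])
      fix h V h' V' assume h: "0 < h" "h \<le> \<epsilon>" "0 < h'" "h' \<le> \<epsilon>" "kinetic h V" "kinetic h' V'"
      define y y' where "y = c3 - V" and "y' = c3 - V'"
      note h1 = hA[OF h(1,2,5) y_def] and h2 = hA[OF h(3,4,6) y'_def]
      note yl = V_lip[OF h(1,2,5,3,4,6) y_def y'_def]
      have VV: "\<bar>V - V'\<bar> \<le> LV * \<bar>h - h'\<bar>" using yl by (simp add: y_def y'_def abs_minus_commute)
      have "h' \<le> 1" using h by (simp add: \<epsilon>_def)
      then have "\<bar>w_minus V h - w_minus V' h'\<bar> \<le> \<bar>h - h'\<bar> + 1 / (c1 - c3) * \<bar>V - V'\<bar>"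
        using h kinetic_V by (intro w_minus_lipschitz) auto
      also have "\<dots> \<le> \<bar>h - h'\<bar> + 1 / (c1 - c3) * (LV * \<bar>h - h'\<bar>)"
        using VV cs by (intro add_left_mono mult_left_mono) auto
      also have "\<dots> = (1 + 1 / (c1 - c3) * LV) * \<bar>h - h'\<bar>" by (simp add: distrib_right)
      also have "\<dots> \<le> K * \<bar>h - h'\<bar>" using K by (intro mult_right_mono) auto
      finally have 1: "\<bar>w_minus V h - w_minus V' h'\<bar> \<le> K * \<bar>h - h'\<bar>" .
      have "\<bar>W y - W y'\<bar> \<le> L * \<bar>y - y'\<bar>" using h1 h2 by (intro W_lip) auto
      also have "\<dots> \<le> L * (LV * \<bar>h - h'\<bar>)" using yl L by (intro mult_left_mono)
      also have "\<dots> \<le> K * \<bar>h - h'\<bar>" unfolding mult.assoc[symmetric] using K by (intro mult_right_mono) auto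
      finally show "\<bar>w_minus V h - w_minus V' h'\<bar> \<le> K * \<bar>h - h'\<bar> \<and> \<bar>w_plus V h - w_plus V' h'\<bar> \<le> K * \<bar>h - h'\<bar>"
        using 1 h1 h2 by simp
    next
      fix h V assume h: "0 < h" "h \<le> \<epsilon>" "kinetic h V"
      define y where "y = c3 - V"
      note h1 = hA[OF h y_def]
      have "a * y \<le> A y * y" using A_low[of y] h1 by (intro mult_right_mono) auto
      then have "y * a \<le> h" using h1(1) by (simp add: mult.commute)
      then have "y \<le> h / a" using a by (simp add: pos_le_divide_eq)
      have "\<bar>W y - W 0\<bar> \<le> L * \<bar>y - 0\<bar>" using h1 y0 by (intro W_lip) auto
      also have "\<dots> \<le> L * (h / a)" using \<open>y \<le> h / a\<close> L h1 by (intro mult_left_mono) auto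
      also have "\<dots> \<le> K * h" using K(3) h mult_right_mono[of "L / a" K h] by simp
      finally show "\<bar>w_plus V h - sqrt (D / c3)\<bar> \<le> K * h" using h1 W0 by simp
    qed
  qed
qed

section \<open>The supersonic branch\<close>

lemma w_super_bounds:
  assumes "h \<le> 0" "0 < w"
  shows "w_super h w \<le> 0" "h \<le> w_super h w"
proof -
  note cs = c_simps(1-3)
  define s where "s = c1 + c3"
  have "0 < s" using cs by (simp add: s_def)
  then have "0 < s * w" "0 < 2 * c3 * w" "2 * c1 * h \<le> 0" "s * h \<le> 0"
    using assms cs by (simp_all add: mult_nonneg_nonpos)
  then have den: "0 < s * w - 2 * c1 * h" and num: "0 \<le> 2 * c3 * w - s * h"
    by linarith+
  have r: "0 \<le> (2 * c3 * w - s * h) / (s * w - 2 * c1 * h)" "(2 * c3 * w - s * h) / (s * w - 2 * c1 * h) \<le> 1"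
  proof -
    have "2 * c3 * w \<le> s * w" using assms cs by (intro mult_right_mono) (auto simp: s_def)
    moreover have "(2 * c1) * h \<le> s * h" using assms cs by (intro mult_right_mono_neg) (auto simp: s_def)
    ultimately show "(2 * c3 * w - s * h) / (s * w - 2 * c1 * h) \<le> 1" using den by (simp add: pos_divide_le_eq)
  qed (use den num in simp)
  show "w_super h w \<le> 0" unfolding w_super_def s_def[symmetric] using assms r by (intro mult_nonpos_nonneg) auto
  show "h \<le> w_super h w" unfolding w_super_def s_def[symmetric]
    using mult_left_mono_neg[OF r(2) assms(1)] by simp
qed

text \<open>The quotient in \<open>w_super\<close> is homogeneous of degree zero in
  \<open>(h, w)\<close>, so its change involves \<open>w * h' - w' * h\<close>. In particular a
  change of \<open>w\<close> alone carries a factor \<open>\<bar>h\<bar>\<close>, which becomes the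
  factor \<open>\<eta>\<close> in \<open>f_lip3\<close>.\<close>

lemma w_super_lipschitz:
  assumes h: "h \<le> 0" "h' \<le> 0" and w: "0 < w0" "w0 \<le> w" "w0 \<le> w'"
  shows "\<bar>w_super h w - w_super h' w'\<bar> \<le> \<bar>h - h'\<bar> + \<bar>h'\<bar> / w0\<^sup>2 * (\<bar>w\<bar> * \<bar>h - h'\<bar> + \<bar>h\<bar> * \<bar>w - w'\<bar>)"
proof -
  note cs = c_simps(1-3)
  define s where "s = c1 + c3"
  define N M where "N h w = 2 * c3 * w - s * h" and "M h w = s * w - 2 * c1 * h" for h w
  have s: "0 < s" using cs by (simp add: s_def)
  have M: "s * w0 \<le> M h w" if "h \<le> 0" "w0 \<le> w" for h w
  proof -
    have "2 * c1 * h \<le> 0" "s * w0 \<le> s * w" using that s cs by (simp_all add: mult_nonneg_nonpos)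
    then show ?thesis unfolding M_def by linarith
  qed
  have sw: "0 < s * w0" using s w by simp
  note M1 = M[OF h(1) w(2)] and M2 = M[OF h(2) w(3)]
  have ws: "w_super h w = (N h w / M h w) * h" for h w by (simp add: w_super_def mult.commute N_def M_def s_def)
  have "N h w / M h w - N h' w' / M h' w' = (c1 - c3)\<^sup>2 * (w * h' - w' * h) / (M h w * M h' w')"
  proof -
    have "N h w * M h' w' - N h' w' * M h w = (c1 - c3)\<^sup>2 * (w * h' - w' * h)"
      unfolding N_def M_def s_def by algebra
    then show ?thesis using M1 M2 sw by (subst diff_frac_eq) auto
  qed
  then have "\<bar>N h w / M h w - N h' w' / M h' w'\<bar> = (c1 - c3)\<^sup>2 * \<bar>w * h' - w' * h\<bar> / (M h w * M h' w')"
    using M1 M2 sw by (simp add: abs_mult)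
  also have "\<dots> \<le> s\<^sup>2 * \<bar>w * h' - w' * h\<bar> / ((s * w0) * (s * w0))"
    using M1 M2 sw cs by (intro frac_le mult_mono power_mono) (auto simp: s_def)
  also have "\<dots> = \<bar>w * h' - w' * h\<bar> / w0\<^sup>2" using s w by (simp add: power2_eq_square)
  also have "\<dots> \<le> (\<bar>w\<bar> * \<bar>h - h'\<bar> + \<bar>h\<bar> * \<bar>w - w'\<bar>) / w0\<^sup>2"
  proof (intro divide_right_mono)
    have "w * h' - w' * h = w * (h' - h) + h * (w - w')" by (simp add: algebra_simps)
    also have "\<bar>\<dots>\<bar> \<le> \<bar>w * (h' - h)\<bar> + \<bar>h * (w - w')\<bar>" by (rule abs_triangle_ineq)
    finally show "\<bar>w * h' - w' * h\<bar> \<le> \<bar>w\<bar> * \<bar>h - h'\<bar> + \<bar>h\<bar> * \<bar>w - w'\<bar>"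
      by (simp add: abs_mult abs_minus_commute)
  qed simp
  finally have R: "\<bar>N h w / M h w - N h' w' / M h' w'\<bar> \<le> (\<bar>w\<bar> * \<bar>h - h'\<bar> + \<bar>h\<bar> * \<bar>w - w'\<bar>) / w0\<^sup>2" .
  have "\<bar>N h w / M h w\<bar> \<le> 1"
  proof -
    have "0 < 2 * c3 * w" "s * h \<le> 0" using h w cs s by (simp_all add: mult_nonneg_nonpos)
    then have "0 \<le> N h w" unfolding N_def by linarith
    moreover have "2 * c3 * w \<le> s * w" using w cs by (intro mult_right_mono) (auto simp: s_def)
    moreover have "(2 * c1) * h \<le> s * h" using h cs by (intro mult_right_mono_neg) (auto simp: s_def)
    ultimately show ?thesis using M1 sw by (simp add: N_def M_def pos_divide_le_eq)
  qed
  moreover have "w_super h w - w_super h' w' = (N h w / M h w) * (h - h') + (N h w / M h w - N h' w' / M h' w') * h'"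
    unfolding ws by (rule weighted_diff)
  then have "\<bar>w_super h w - w_super h' w'\<bar> \<le> \<bar>N h w / M h w\<bar> * \<bar>h - h'\<bar> + \<bar>N h w / M h w - N h' w' / M h' w'\<bar> * \<bar>h'\<bar>"
    unfolding abs_mult[symmetric] by (simp only: abs_triangle_ineq)
  ultimately have "\<bar>w_super h w - w_super h' w'\<bar> \<le> 1 * \<bar>h - h'\<bar> + (\<bar>w\<bar> * \<bar>h - h'\<bar> + \<bar>h\<bar> * \<bar>w - w'\<bar>) / w0\<^sup>2 * \<bar>h'\<bar>"
    using R by (elim order_trans) (intro add_mono mult_right_mono; simp)
  then show ?thesis by (simp add: mult.commute)
qed

end

section \<open>The phase boundary\<close>

locale base_states = kinetic_phase +
  fixes uL uR :: state and V :: real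
  assumes base: "single_phase_boundary uL uR V"
    and sonic: "V = c3 \<Longrightarrow> \<exists>D. (\<phi> has_real_derivative D) (at_left c3) \<and> snd uR = sqrt (D / c3)"
begin

definition xs :: real where "xs = fst uL - c1 * snd uL"
definition ps :: real where "ps = fst uL + c1 * snd uL"
definition ys :: real where "ys = fst uR + c3 * snd uR"
definition zs :: real where "zs = fst uR - c3 * snd uR"

lemma uL_eq: "uL = wave_state c1 ps xs"
  unfolding ps_def xs_def by (rule wave_state_of[symmetric, OF c_neq(1)])

lemma uR_eq: "uR = wave_state c3 ys zs"
  unfolding ys_def zs_def by (rule wave_state_of[symmetric, OF c_neq(2)])

lemma uL_H1: "uL \<in> H1" and uR_H3: "uR \<in> H3"
  using base by (auto simp: single_phase_boundary_def)

lemma wR_pos: "0 < snd uR"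
  using uR_H3 wM_pos wMm by (simp add: H3_iff)

end

context two_phase
begin

lemma h_in_states:
  assumes "ul = wave_state c1 p x" "ur = wave_state c3 y z"
  shows "h_in x y = (c1 * snd ul + c3 * snd ur + fst ur - fst ul) / (c1 + c3)"
proof -
  have e: "c1 * snd ul = (p - x) / 2" "c3 * snd ur = (y - z) / 2" "fst ul = (p + x) / 2" "fst ur = (y + z) / 2"
    using assms c_neq by simp_all
  have "c1 * snd ul + c3 * snd ur + fst ur - fst ul = y - x"
    unfolding e by (simp add: add_divide_distrib diff_divide_distrib)
  then show ?thesis by (simp add: h_in_def)
qed

lemma state_left_of_boundary:
  "c \<noteq> 0 \<Longrightarrow> ((p + x) / 2 + c * (w - (p - x) / (2 * c)), w) = wave_state c (x + 2 * c * w) x"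
  by (simp add: wave_state_def field_simps)

lemma state_right_of_boundary:
  "c \<noteq> 0 \<Longrightarrow> ((y + z) / 2 + c * ((y - z) / (2 * c) - w), w) = wave_state c y (y - 2 * c * w)"
  by (simp add: wave_state_def field_simps)

text \<open>The Rankine--Hugoniot relations across a supersonic boundary reduce to a linear equation for
  the strain on its left.\<close>

lemma supersonic_state:
  assumes ul: "ul = wave_state c1 p x" and ur: "ur = wave_state c3 y z"
    and H: "ul \<in> H1" "(v', w') \<in> H1" "ur \<in> H3" and h: "h_in x y \<le> 0"
    and rh1: "rankine_hugoniot (- c1) ul (v', w')" and rh2: "rankine_hugoniot s (v', w') ur"
  shows "w' = w_super (h_in x y) ((y - z) / (2 * c3))" "(v', w') = wave_state c1 (x + 2 * c1 * w') x"
proof -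
  note cs = c_simps(1-3)
  have v': "v' = x + c1 * w'"
  proof -
    have "c1 * w' - c1 * snd ul = v' - fst ul" using rh1 by (simp add: rankine_hugoniot_def right_diff_distrib)
    moreover have "c1 * snd ul = (p - x) / 2" "fst ul = (p + x) / 2" using ul c_neq by simp_all
    ultimately show ?thesis by (simp add: field_simps)
  qed
  show "(v', w') = wave_state c1 (x + 2 * c1 * w') x"
    unfolding v' wave_state_def using c_neq by simp
  define wr vr where "wr = snd ur" and "vr = fst ur"
  have wr: "wr = (y - z) / (2 * c3)" "0 < wr" "y = vr + c3 * wr"
  proof -
    show "wr = (y - z) / (2 * c3)" using ur by (simp add: wr_def)
    show "0 < wr" using H(3) wM_pos wMm by (simp add: wr_def H3_iff)
    have "c3 * wr = (y - z) / 2" using c_neq ur by (simp add: wr_def)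
    then show "y = vr + c3 * wr" using ur by (simp add: vr_def add_divide_distrib diff_divide_distrib)
  qed
  have sig: "\<sigma> w' = k1 * w'" "\<sigma> wr = k3 * wr"
    using H(2,3) wMm unfolding wr_def by (auto simp: \<sigma>_def H1_iff H3_iff)
  have e1: "- s * (wr - w') = vr - v'" and e2: "- s * (vr - v') = k3 * wr - k1 * w'"
    using rh2 sig unfolding rankine_hugoniot_def wr_def vr_def by auto
  define A where "A = vr - x"
  \<comment> \<open>Multiplying the two relations eliminates \<open>s\<close>. With
    \<open>v' = x + c1 * w'\<close> the quadratic terms in \<open>w'\<close> cancel, because the
    left phase has sound speed \<open>c1\<close>.\<close>
  have "(vr - v') * (vr - v') = (k3 * wr - k1 * w') * (wr - w')"
  proof -
    have "(k3 * wr - k1 * w') * (wr - w') = - s * (vr - v') * (wr - w')" by (simp only: e2)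
    also have "\<dots> = (vr - v') * (- s * (wr - w'))" by simp
    also have "\<dots> = (vr - v') * (vr - v')" by (simp only: e1)
    finally show ?thesis by simp
  qed
  moreover have "vr - v' = A - c1 * w'" by (simp add: A_def v')
  ultimately have "(A - c1 * w') * (A - c1 * w') = (c3 * c3 * wr - c1 * c1 * w') * (wr - w')"
    by (simp add: c_simps)
  then have lin: "w' * ((c1 * c1 + c3 * c3) * wr - 2 * c1 * A) = (c3 * wr) * (c3 * wr) - A * A"
    by algebra
  have hA: "(c1 + c3) * h_in x y = c3 * wr + A"
    using cs by (simp add: h_in_def A_def wr(3))
  then have A: "A = (c1 + c3) * h_in x y - c3 * wr" by simp
  define h0 where "h0 = h_in x y"
  have "w' * ((c1 + c3) * ((c1 + c3) * wr - 2 * c1 * h0)) = (c1 + c3) * (h0 * (2 * c3 * wr - (c1 + c3) * h0))"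
    using lin unfolding A h0_def[symmetric] by algebra
  then have "w' * ((c1 + c3) * wr - 2 * c1 * h0) = h0 * (2 * c3 * wr - (c1 + c3) * h0)"
    using cs by (simp add: mult.left_commute[of w'])
  moreover have "0 < (c1 + c3) * wr - 2 * c1 * h0"
  proof -
    have "0 < (c1 + c3) * wr" "2 * c1 * h0 \<le> 0"
      using wr(2) h cs by (simp_all add: h0_def mult_nonneg_nonpos)
    then show ?thesis by linarith
  qed
  ultimately show "w' = w_super (h_in x y) ((y - z) / (2 * c3))"
    unfolding w_super_def wr(1)[symmetric] h0_def[symmetric] by (simp add: field_simps)
qed

end

context kinetic_phase
begin

text \<open>Normal form of the fan at the boundary for both regimes, with \<open>s\<close> the speed
  of the boundary. In the supersonic regime the state on its right is the datum itself and nothing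
  is emitted to the right.\<close>

definition boundary_fan :: "real \<Rightarrow> fan \<Rightarrow> real \<Rightarrow> real \<Rightarrow> real \<Rightarrow> real \<Rightarrow> real \<Rightarrow> bool" where
  "boundary_fan w0 F s p x y z \<longleftrightarrow> wave_state c1 (p_out x y z) x \<in> H1 \<and>
     (h_in x y > 0 \<and> -c3 < s \<and> s < c3 \<and> wave_state c3 y (q_out w0 x y) \<in> H3 \<and>
       F = (wave_state c1 p x, [(- c1, wave_state c1 (p_out x y z) x),
          (s, wave_state c3 y (q_out w0 x y)), (c3, wave_state c3 y z)]) \<or>
      h_in x y \<le> 0 \<and> c3 \<le> s \<and> s < c1 \<and>
       F = (wave_state c1 p x, [(- c1, wave_state c1 (p_out x y z) x), (s, wave_state c3 y z)]))"

lemma riemann_boundary: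
  assumes r: "riemann (wave_state c1 p x) (wave_state c3 y z) F"
    and H: "wave_state c1 p x \<in> H1" "wave_state c3 y z \<in> H3"
  obtains s where "boundary_fan w0 F s p x y z"
proof -
  note cs = c_simps(1-3)
  from r show ?thesis
  proof cases
    case (boundary_kinetic vl wl vr wr h s w' v' w'' v'')
    have h: "h = h_in x y"
      unfolding boundary_kinetic(6) using h_in_states[OF boundary_kinetic(1)[symmetric] boundary_kinetic(2)[symmetric]] by simp
    have kin: "kinetic h s"
      using boundary_kinetic unfolding kinetic_def w_minus_def w_plus_def by simp
    have s: "boundary_speed (h_in x y) = s" using boundary_speed_eq[OF kin] boundary_kinetic h by simp
    have vl: "vl = (p + x) / 2" "wl = (p - x) / (2 * c1)" "vr = (y + z) / 2" "wr = (y - z) / (2 * c3)"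
      using boundary_kinetic(1,2) by (simp_all add: wave_state_def)
    have "p_out x y z = x + 2 * c1 * w'" "q_out w0 x y = y - 2 * c3 * w''"
      using boundary_kinetic(7,9,12) s h unfolding p_out_def q_out_def w_minus_def w_plus_def by simp_all
    then have "(v', w') = wave_state c1 (p_out x y z) x"
      and "(v'', w'') = wave_state c3 y (q_out w0 x y)"
      using state_left_of_boundary[OF c_neq(1)] state_right_of_boundary[OF c_neq(2)]
      unfolding boundary_kinetic(10,13) vl by simp_all
    then have "boundary_fan w0 F s p x y z"
      unfolding boundary_fan_def using boundary_kinetic h by simp
    then show ?thesis by (rule that)
  next
    case (boundary_supersonic vl wl vr wr h s v' w')
    have h: "h = h_in x y"
      unfolding boundary_supersonic(6) using h_in_states[OF boundary_supersonic(1)[symmetric] boundary_supersonic(2)[symmetric]] by simp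
    note ss = supersonic_state[OF boundary_supersonic(1)[symmetric] boundary_supersonic(2)[symmetric],
        OF boundary_supersonic(4) boundary_supersonic(9) boundary_supersonic(5) _ boundary_supersonic(10,11)]
    have "(v', w') = wave_state c1 (p_out x y z) x"
      using ss boundary_supersonic(7) h by (simp add: p_out_def)
    then have "boundary_fan w0 F s p x y z"
      unfolding boundary_fan_def using boundary_supersonic h by simp
    then show ?thesis by (rule that)
  qed (use H H_disjoint in auto)
qed

section \<open>Solvability of the Riemann problem at the boundary\<close>

lemma supersonic_exists:
  assumes H: "wave_state c1 p x \<in> H1" "wave_state c3 y z \<in> H3" and h: "h_in x y \<le> 0"
    and out: "wave_state c1 (p_out x y z) x \<in> H1"
  shows "\<exists>F. riemann (wave_state c1 p x) (wave_state c3 y z) F"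
proof -
  note cs = c_simps(1-3)
  define wr vr where "wr = snd (wave_state c3 y z)" and "vr = fst (wave_state c3 y z)"
  have wr: "wr = (y - z) / (2 * c3)" "0 < wr" "y = vr + c3 * wr" "wave_state c3 y z = (vr, wr)"
  proof -
    show "wr = (y - z) / (2 * c3)" "wave_state c3 y z = (vr, wr)" by (simp_all add: wr_def vr_def prod_eq_iff)
    show "0 < wr" using H(2) wM_pos wMm by (simp add: wr_def H3_iff)
    have "c3 * wr = (y - z) / 2" using c_neq by (simp add: wr_def)
    then show "y = vr + c3 * wr" by (simp add: vr_def add_divide_distrib diff_divide_distrib)
  qed
  define h0 where "h0 = h_in x y"
  have h0: "h0 \<le> 0" "h0 * (c1 + c3) = c3 * wr + (vr - x)" using h cs by (auto simp: h0_def h_in_def wr(3))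
  define w' where "w' = w_super h0 wr"
  \<comment> \<open>This is \<open>x - vr\<close>. The condition \<open>h0 \<le> 0\<close> is
    equivalent to \<open>a \<ge> c3 * wr\<close>, which is what makes the speed at least
    \<open>c3\<close>.\<close>
  define a where "a = c3 * wr - (c1 + c3) * h0"
  have a: "c3 * wr \<le> a" "a = x - vr" using h0 cs mult_nonneg_nonpos[of "c1 + c3" h0] by (auto simp: a_def algebra_simps)
  have a0: "0 < a" using a(1) mult_pos_pos[of c3 wr] cs wr by linarith
  \<comment> \<open>Adding \<open>c1\<close> times the first Rankine--Hugoniot relation to the
    second eliminates \<open>w'\<close> and leaves
    \<open>s * (a + c1 * wr) = c1 * a + k3 * wr\<close>.\<close>
  define s where "s = (c1 * a + k3 * wr) / (a + c1 * wr)"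
  have den: "0 < a + c1 * wr" using a0 cs wr(2) by (simp add: add_pos_pos)
  have s: "c3 \<le> s" "s < c1"
  proof -
    have "c3 * (a + c1 * wr) \<le> c1 * a + c3 * c3 * wr"
    proof -
      have "(c1 - c3) * (c3 * wr) \<le> (c1 - c3) * a" using a cs by (intro mult_left_mono) auto
      then show ?thesis by (simp add: algebra_simps)
    qed
    then show "c3 \<le> s" unfolding s_def using den by (subst pos_le_divide_eq) (auto simp: c_simps)
    have "k3 * wr < k1 * wr" using k13 wr(2) by simp
    then have "c1 * a + k3 * wr < c1 * (a + c1 * wr)" by (simp add: distrib_left mult.assoc[symmetric] c_simps)
    then show "s < c1" unfolding s_def using den by (subst pos_divide_less_eq)
  qed
  have po: "wave_state c1 (p_out x y z) x = (x + c1 * w', w')"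
    using h cs unfolding p_out_def h0_def[symmetric] wr(1)[symmetric] w'_def[symmetric]
    by (simp add: h0_def wave_state_def)
  have M: "0 < (c1 + c3) * wr - 2 * c1 * h0"
  proof -
    have "0 < (c1 + c3) * wr" "2 * c1 * h0 \<le> 0" using wr(2) h0 cs by (simp_all add: mult_nonneg_nonpos)
    then show ?thesis by linarith
  qed
  have w'M: "w' * ((c1 + c3) * wr - 2 * c1 * h0) = h0 * (2 * c3 * wr - (c1 + c3) * h0)"
    unfolding w'_def w_super_def using M by simp
  have Ms: "(c1 + c3) * ((c1 + c3) * wr - 2 * c1 * h0) = (c1 * c1 + c3 * c3) * wr + 2 * c1 * a"
    unfolding a_def by algebra
  have w'a: "w' * ((c1 * c1 + c3 * c3) * wr + 2 * c1 * a) = (c3 * wr) * (c3 * wr) - a * a"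
    using w'M unfolding Ms[symmetric] a_def by algebra
  have Q: "0 < (c1 * c1 + c3 * c3) * wr + 2 * c1 * a" unfolding Ms[symmetric] using M cs by (intro mult_pos_pos) auto
  \<comment> \<open>Multiplied by the positive coefficient of \<open>w'\<close> in its linear
    equation \<open>w'a\<close>, the claim becomes a polynomial consequence of that
    equation.\<close>
  have e1: "s * (wr - w') = a + c1 * w'"
  proof -
    have "(c1 * a + c3 * c3 * wr) * (wr - w') * ((c1 * c1 + c3 * c3) * wr + 2 * c1 * a)
        = (a + c1 * w') * (a + c1 * wr) * ((c1 * c1 + c3 * c3) * wr + 2 * c1 * a)"
      using w'a by algebra
    then have "(c1 * a + c3 * c3 * wr) * (wr - w') = (a + c1 * w') * (a + c1 * wr)" using Q by simp
    then show ?thesis unfolding s_def using den by (simp add: c_simps field_simps)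
  qed
  have e2: "s * (a + c1 * w') = k3 * wr - k1 * w'"
  proof -
    have "(c1 * a + c3 * c3 * wr) * (a + c1 * w') * ((c1 * c1 + c3 * c3) * wr + 2 * c1 * a)
       = (c3 * c3 * wr - c1 * c1 * w') * (a + c1 * wr) * ((c1 * c1 + c3 * c3) * wr + 2 * c1 * a)"
      using w'a by algebra
    then have "(c1 * a + c3 * c3 * wr) * (a + c1 * w') = (c3 * c3 * wr - c1 * c1 * w') * (a + c1 * wr)"
      using Q by simp
    then show ?thesis unfolding s_def using den by (simp add: c_simps field_simps)
  qed
  have sig: "\<sigma> w' = k1 * w'" "\<sigma> wr = k3 * wr" "\<sigma> ((p - x) / (2 * c1)) = k1 * ((p - x) / (2 * c1))"
    using out H wMm unfolding po wr(4) by (auto simp: \<sigma>_def H1_iff H3_iff)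
  have "riemann ((p + x) / 2, (p - x) / (2 * c1)) (vr, wr)
     (((p + x) / 2, (p - x) / (2 * c1)), [(- c1, (x + c1 * w', w')), (s, (vr, wr))])"
  proof (rule boundary_supersonic[OF _ _ refl])
    show "((p + x) / 2, (p - x) / (2 * c1)) \<in> H1" using H(1) by (simp add: wave_state_def)
    show "(vr, wr) \<in> H3" using H(2) wr(4) by simp
    show "(x + c1 * w', w') \<in> H1" using out po by simp
    have hq: "(c1 * ((p - x) / (2 * c1)) + c3 * wr + vr - (p + x) / 2) / (c1 + c3) = h0"
      unfolding h0_def h_in_states[OF refl[of "wave_state c1 p x"] wr(4)[symmetric]]
      by (simp only: wave_state_sel fst_conv snd_conv)
    show "(c1 * ((p - x) / (2 * c1)) + c3 * wr + vr - (p + x) / 2) / (c1 + c3) \<le> 0"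
      unfolding hq by (rule h0(1))
    show "s \<in> {c3..<c1}" using s by simp
    show "rankine_hugoniot (- c1) ((p + x) / 2, (p - x) / (2 * c1)) (x + c1 * w', w')"
    proof -
      have vl: "(p + x) / 2 = x + c1 * ((p - x) / (2 * c1))"
      proof -
        have "c1 * ((p - x) / (2 * c1)) = (p - x) / 2" using c_neq(1) by simp
        then show ?thesis by (simp only:) (simp add: add_divide_distrib diff_divide_distrib)
      qed
      show ?thesis
        unfolding rankine_hugoniot_def fst_conv snd_conv sig(1,3) vl
        by (simp add: right_diff_distrib distrib_left mult.assoc[symmetric] c_simps(6) del: times_divide_eq_right)
    qed
    show "rankine_hugoniot s (x + c1 * w', w') (vr, wr)"
      unfolding rankine_hugoniot_def fst_conv snd_conv sig using e1 e2 a(2) by (simp add: algebra_simps)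
  qed
  moreover have "((p + x) / 2, (p - x) / (2 * c1)) = wave_state c1 p x" by (simp only: wave_state_def)
  ultimately show ?thesis unfolding wr(4) by (simp only:) (rule exI)
qed

lemma kinetic_boundary_exists:
  assumes H: "wave_state c1 p x \<in> H1" "wave_state c3 y z \<in> H3" and h: "0 < h_in x y"
    and out: "wave_state c1 (p_out x y z) x \<in> H1" "wave_state c3 y (q_out w0 x y) \<in> H3"
  shows "\<exists>F. riemann (wave_state c1 p x) (wave_state c3 y z) F"
proof -
  define h0 where "h0 = h_in x y"
  obtain s where kin: "kinetic h0 s" using kinetic_exists h unfolding h0_def by blast
  have s: "boundary_speed h0 = s" using boundary_speed_eq[OF kin] h by (simp add: h0_def)
  define vl wl vr wr where "vl = (p + x) / 2" and "wl = (p - x) / (2 * c1)" and "vr = (y + z) / 2" and "wr = (y - z) / (2 * c3)"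
  have st: "wave_state c1 p x = (vl, wl)" "wave_state c3 y z = (vr, wr)"
    by (simp_all add: wave_state_def vl_def wl_def vr_def wr_def)
  define w' w'' where "w' = (c3 + s) / (c1 + s) * h0" and "w'' = (c1 - s) / (c3 - s) * h0"
  have o1: "wave_state c1 (p_out x y z) x = (vl + c1 * (w' - wl), w')"
    using h s state_left_of_boundary[OF c_neq(1), of p x w'] unfolding p_out_def h0_def[symmetric] w_minus_def vl_def wl_def
    by (simp add: h0_def w'_def)
  have o2: "wave_state c3 y (q_out w0 x y) = (vr + c3 * (wr - w''), w'')"
    using h s state_right_of_boundary[OF c_neq(2), of y z w''] unfolding q_out_def h0_def[symmetric] w_plus_def vr_def wr_def
    by (simp add: h0_def w''_def)
  have "riemann (vl, wl) (vr, wr) ((vl, wl), [(- c1, (vl + c1 * (w' - wl), w')), (s, (vr + c3 * (wr - w''), w'')), (c3, (vr, wr))])"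
  proof (rule boundary_kinetic)
    show "h0 = (c1 * wl + c3 * wr + vr - vl) / (c1 + c3)"
      unfolding h0_def using h_in_states[OF st[symmetric]] by simp
    show "0 < h0" using h by (simp add: h0_def)
    show "s \<in> {- c3<..<c3}" using kin by (simp add: kinetic_def)
    show "kinetic_relation s ((k1 - k3) / 2 * (wM * wm - w' * w''))"
      using kin by (simp add: kinetic_def w_minus_def w_plus_def w'_def w''_def)
  qed (use H st out o1 o2 w'_def w''_def in auto)
  then show ?thesis using st by auto
qed

end

lemma wave_state_inj: "c \<noteq> 0 \<Longrightarrow> wave_state c p q = wave_state c p' q' \<Longrightarrow> p = p' \<and> q = q'"
proof -
  assume c: "c \<noteq> 0" and e: "wave_state c p q = wave_state c p' q'"
  then have "p + q = p' + q'" "p - q = p' - q'" by (auto simp: wave_state_def)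
  then show ?thesis by linarith
qed

section \<open>The response of the boundary near the base states\<close>

context base_states
begin

abbreviation hs :: real where "hs \<equiv> h_in xs ys"
abbreviation wR :: real where "wR \<equiv> snd uR"

lemma zs_wR: "zs = ys - 2 * c3 * wR"
  by (simp add: zs_def ys_def)

text \<open>The base values are a fixed point of the response. The sonic hypothesis is given in
  terms of \<open>V\<close>, whereas the analysis distinguishes the sign of \<open>hs\<close>; for
  \<open>hs = 0\<close> the boundary emits \<open>p = xs\<close>, so the left strain is
  \<open>0\<close> and Rankine--Hugoniot gives \<open>V\<^sup>2 = k3\<close>.\<close>

lemma base_data:
  shows base_p: "p_out xs ys zs = ps" and base_q: "q_out wR xs ys = zs"
    and base_sonic: "hs = 0 \<Longrightarrow> V = c3"
proof -
  obtain F where r: "riemann uL uR F" and F: "F = (uL, [(- c1, uL), (V, uR), (c3, uR)]) \<or> F = (uL, [(- c1, uL), (V, uR)])"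
  proof -
    from base consider "riemann uL uR (uL, [(- c1, uL), (V, uR), (c3, uR)])" | "riemann uL uR (uL, [(- c1, uL), (V, uR)])"
      unfolding single_phase_boundary_def by blast
    then show thesis by cases (rule that, assumption, simp)+
  qed
  obtain s where bf: "boundary_fan wR F s ps xs ys zs"
  proof (rule riemann_boundary)
    show "riemann (wave_state c1 ps xs) (wave_state c3 ys zs) F" using r uL_eq uR_eq by argo
    show "wave_state c1 ps xs \<in> H1" "wave_state c3 ys zs \<in> H3" using uL_H1 uR_H3 uL_eq uR_eq by argo+
  qed
  note inj = wave_state_inj[OF c_neq(1)] wave_state_inj[OF c_neq(2)]
  have p: "wave_state c1 (p_out xs ys zs) xs = uL"
    using bf F by (auto simp: boundary_fan_def)
  then show "p_out xs ys zs = ps" using inj(1)[OF trans[OF p uL_eq]] by blast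
  have q: "q_out wR xs ys = zs" if "0 < hs"
  proof -
    have "wave_state c3 ys (q_out wR xs ys) = uR" using bf F that by (auto simp: boundary_fan_def)
    from inj(2)[OF trans[OF this uR_eq]] show ?thesis by blast
  qed
  moreover have "q_out wR xs ys = zs" if "\<not> 0 < hs"
    using that by (simp add: q_out_def zs_wR)
  ultimately show "q_out wR xs ys = zs" by blast
  show "V = c3" if h: "hs = 0"
  proof -
    have "p_out xs ys zs = xs" using h by (simp add: p_out_def w_super_def)
    then have wL: "snd uL = 0" using \<open>p_out xs ys zs = ps\<close> c_neq by (simp add: ps_def xs_def)
    have Vs: "c3 \<le> V" and F2: "F = (uL, [(- c1, uL), (V, uR)])"
      using bf F h by (auto simp: boundary_fan_def)
    have "rankine_hugoniot V uL uR"
      using r[unfolded F2] by cases (use uL_H1 uR_H3 H_disjoint in auto)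
    then have rh: "- V * (wR - snd uL) = fst uR - fst uL" "- V * (fst uR - fst uL) = \<sigma> wR - \<sigma> (snd uL)"
      unfolding rankine_hugoniot_def by blast+
    have sg: "\<sigma> 0 = 0" "\<sigma> wR = k3 * wR"
      using uR_H3 wM_pos wMm by (auto simp: \<sigma>_def H3_iff)
    have a: "- V * wR = fst uR - fst uL" using rh(1) by (simp only: wL diff_zero)
    have b: "- V * (fst uR - fst uL) = k3 * wR" using rh(2) by (simp only: wL sg diff_zero)
    have "V * V * wR = - V * (- V * wR)" by simp
    also have "\<dots> = - V * (fst uR - fst uL)" by (simp only: a)
    also have "\<dots> = k3 * wR" by (rule b)
    finally have "V * V * wR = k3 * wR" .
    moreover have "wR \<noteq> 0" using wR_pos by simp
    ultimately have "V * V = k3" using mult_right_cancel[of wR "V * V" k3] by blast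
    then have sq: "V\<^sup>2 = c3\<^sup>2" by (simp only: power2_eq_square c_simps(7))
    show ?thesis by (rule power2_eq_imp_eq[OF sq]) (use Vs c_simps(2) in linarith)+
  qed
qed

abbreviation out_minus :: "real \<Rightarrow> real" where "out_minus h \<equiv> w_minus (boundary_speed h) h"
abbreviation out_plus :: "real \<Rightarrow> real" where "out_plus h \<equiv> w_plus (boundary_speed h) h"

lemma boundary_speed_kinetic: "0 < h \<Longrightarrow> kinetic h (boundary_speed h)"
  using kinetic_exists[of h] boundary_speed_eq by metis

lemma out_minus_bounds: "0 < h \<Longrightarrow> 0 \<le> out_minus h \<and> out_minus h \<le> h"
  using w_minus_bounds[OF kinetic_V[OF boundary_speed_kinetic], of h h] by simp

text \<open>\<open>subsonic_lipschitz\<close> covers \<open>hs > 0\<close> and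
  \<open>sonic_lipschitz\<close> covers \<open>hs = 0\<close>; for \<open>hs < 0\<close> a
  neighbourhood without positive \<open>h\<close> makes the claims vacuous. The second claim has
  content only at \<open>hs = 0\<close>, where both signs of \<open>h\<close> occur arbitrarily
  close to \<open>hs\<close>.\<close>

lemma profile:
  obtains \<epsilon> K where "0 < \<epsilon>" "0 \<le> K"
    "\<And>h h'. \<bar>h - hs\<bar> \<le> \<epsilon> \<Longrightarrow> \<bar>h' - hs\<bar> \<le> \<epsilon> \<Longrightarrow> 0 < h \<Longrightarrow> 0 < h' \<Longrightarrow>
       \<bar>out_minus h - out_minus h'\<bar> \<le> K * \<bar>h - h'\<bar> \<and> \<bar>out_plus h - out_plus h'\<bar> \<le> K * \<bar>h - h'\<bar>"
    "\<And>h h'. \<bar>h - hs\<bar> \<le> \<epsilon> \<Longrightarrow> \<bar>h' - hs\<bar> \<le> \<epsilon> \<Longrightarrow> 0 < h \<Longrightarrow> h' \<le> 0 \<Longrightarrow> \<bar>out_plus h - wR\<bar> \<le> K * h"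
proof -
  consider "0 < hs" | "hs < 0" | "hs = 0" by linarith
  then show ?thesis
  proof cases
    case 1
    show ?thesis
    proof (rule subsonic_lipschitz[OF boundary_speed_kinetic[OF 1] 1])
      fix L assume L: "0 \<le> L" "\<And>h V h' V'. hs / 2 \<le> h \<Longrightarrow> h \<le> 2 * hs \<Longrightarrow> hs / 2 \<le> h' \<Longrightarrow> h' \<le> 2 * hs \<Longrightarrow>
       kinetic h V \<Longrightarrow> kinetic h' V' \<Longrightarrow>
       \<bar>w_minus V h - w_minus V' h'\<bar> \<le> L * \<bar>h - h'\<bar> \<and> \<bar>w_plus V h - w_plus V' h'\<bar> \<le> L * \<bar>h - h'\<bar>"
      have near: "hs / 2 \<le> h" "h \<le> 2 * hs" if "\<bar>h - hs\<bar> \<le> hs / 2" for h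
        using that 1 by linarith+
      show thesis
      proof (rule that[of "hs / 2" L])
        fix h h' assume h: "\<bar>h - hs\<bar> \<le> hs / 2" "\<bar>h' - hs\<bar> \<le> hs / 2" "0 < h" "0 < h'"
        show "\<bar>out_minus h - out_minus h'\<bar> \<le> L * \<bar>h - h'\<bar> \<and> \<bar>out_plus h - out_plus h'\<bar> \<le> L * \<bar>h - h'\<bar>"
          by (rule L(2)[OF near[OF h(1)] near[OF h(2)] boundary_speed_kinetic[OF h(3)] boundary_speed_kinetic[OF h(4)]])
      next
        fix h h' assume "\<bar>h' - hs\<bar> \<le> hs / 2" "h' \<le> 0"
        then show "\<bar>out_plus h - wR\<bar> \<le> L * h" using near(1)[of h'] 1 by simp
      qed (use 1 L in auto)
    qed
  next
    case 2
    have "h < 0" if "\<bar>h - hs\<bar> \<le> - hs / 2" for h using that 2 by (simp add: abs_le_iff)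
    then show ?thesis using 2 by (intro that[of "- hs / 2" 0]) force+
  next
    case 3
    obtain D where D: "(\<phi> has_real_derivative D) (at_left c3)" "wR = sqrt (D / c3)"
      using sonic[OF base_sonic[OF 3]] by blast
    have "0 < D" using D(2) wR_pos c_simps(2) by (simp add: real_sqrt_gt_0_iff zero_less_divide_iff)
    show ?thesis
    proof (rule sonic_lipschitz[OF D(1) \<open>0 < D\<close>])
      fix K \<epsilon> :: real assume K: "0 \<le> K" "0 < \<epsilon>"
        and 1: "\<And>h V h' V'. 0 < h \<Longrightarrow> h \<le> \<epsilon> \<Longrightarrow> 0 < h' \<Longrightarrow> h' \<le> \<epsilon> \<Longrightarrow> kinetic h V \<Longrightarrow> kinetic h' V' \<Longrightarrow>
         \<bar>w_minus V h - w_minus V' h'\<bar> \<le> K * \<bar>h - h'\<bar> \<and> \<bar>w_plus V h - w_plus V' h'\<bar> \<le> K * \<bar>h - h'\<bar>"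
        and 2: "\<And>h V. 0 < h \<Longrightarrow> h \<le> \<epsilon> \<Longrightarrow> kinetic h V \<Longrightarrow> \<bar>w_plus V h - sqrt (D / c3)\<bar> \<le> K * h"
      show thesis
      proof (rule that[OF K(2,1)])
        fix h h' assume "\<bar>h - hs\<bar> \<le> \<epsilon>" "\<bar>h' - hs\<bar> \<le> \<epsilon>" "0 < h" "0 < h'"
        then show "\<bar>out_minus h - out_minus h'\<bar> \<le> K * \<bar>h - h'\<bar> \<and> \<bar>out_plus h - out_plus h'\<bar> \<le> K * \<bar>h - h'\<bar>"
          using 3 by (intro 1 boundary_speed_kinetic) auto
      next
        fix h assume "\<bar>h - hs\<bar> \<le> \<epsilon>" "0 < h"
        then show "\<bar>out_plus h - wR\<bar> \<le> K * h"
          unfolding D(2) using 3 by (intro 2 boundary_speed_kinetic) auto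
      qed
    qed
  qed
qed

definition eta :: "real \<Rightarrow> real \<Rightarrow> real" where
  "eta x y = max 0 (- h_in x y)"

lemma h_in_dist: "\<bar>h_in x y - h_in x' y'\<bar> \<le> 1 / (c1 + c3) * (\<bar>x - x'\<bar> + \<bar>y - y'\<bar>)"
proof -
  have "h_in x y - h_in x' y' = 1 / (c1 + c3) * ((y - y') - (x - x'))"
    by (simp add: h_in_def diff_divide_distrib)
  also have "\<bar>\<dots>\<bar> = 1 / (c1 + c3) * \<bar>(y - y') - (x - x')\<bar>"
    using c_simps(1,2) by (simp add: abs_mult)
  also have "\<dots> \<le> 1 / (c1 + c3) * (\<bar>x - x'\<bar> + \<bar>y - y'\<bar>)"
    using c_simps(1,2) by (intro mult_left_mono) auto
  finally show ?thesis .
qed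

lemma boundary_response_exists:
  obtains K r where "boundary_response p_out (q_out wR) eta K r ps xs ys zs"
proof (rule profile)
  fix \<epsilon> K :: real assume \<epsilon>: "0 < \<epsilon>" and K: "0 \<le> K"
    and P1: "\<And>h h'. \<bar>h - hs\<bar> \<le> \<epsilon> \<Longrightarrow> \<bar>h' - hs\<bar> \<le> \<epsilon> \<Longrightarrow> 0 < h \<Longrightarrow> 0 < h' \<Longrightarrow>
       \<bar>out_minus h - out_minus h'\<bar> \<le> K * \<bar>h - h'\<bar> \<and> \<bar>out_plus h - out_plus h'\<bar> \<le> K * \<bar>h - h'\<bar>"
    and P2: "\<And>h h'. \<bar>h - hs\<bar> \<le> \<epsilon> \<Longrightarrow> \<bar>h' - hs\<bar> \<le> \<epsilon> \<Longrightarrow> 0 < h \<Longrightarrow> h' \<le> 0 \<Longrightarrow> \<bar>out_plus h - wR\<bar> \<le> K * h"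
  note cs = c_simps(1-3)
  define S where "S = 1 / (c1 + c3)"
  define H where "H = \<bar>hs\<bar> + \<epsilon>"
  define w0 where "w0 = wR / 2"
  \<comment> \<open>The first bound keeps \<open>h_in\<close> within \<open>\<epsilon>\<close> of
    \<open>hs\<close>; the second keeps the strain on the right above \<open>w0\<close>, half of its
    base value.\<close>
  define r where "r = min (\<epsilon> / (2 * S)) (c3 * w0)"
  \<comment> \<open>\<open>G\<close> bounds the coefficient
    \<open>\<bar>h'\<bar> / w0\<^sup>2\<close> of \<open>w_super_lipschitz\<close>,
    \<open>Kw\<close> covers the strain on the left of the boundary for all signs of
    \<open>h\<close> and \<open>h'\<close>, and \<open>K'\<close> adds up the constants for all
    clauses of \<open>boundary_response\<close>.\<close>
  define G where "G = H / w0\<^sup>2"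
  define Kw where "Kw = K * S + S + G * (2 * wR * S + H / (2 * c3))"
  define K' where "K' = 1 + 2 * c1 * Kw + 2 * c1 * (G / (2 * c3)) + 2 * c3 * (K * S) + S + H"
  have S: "0 < S" using cs by (simp add: S_def)
  have w0: "0 < w0" using wR_pos by (simp add: w0_def)
  have H: "0 < H" using \<epsilon> by (simp add: H_def)
  have G: "0 \<le> G" using H by (simp add: G_def)
  have r: "0 < r" using \<epsilon> S cs w0 by (simp add: r_def)
  have Kw: "0 \<le> Kw" "K * S \<le> Kw" "S \<le> Kw" "S + G * (2 * wR * S + H / (2 * c3)) \<le> Kw"
  proof -
    have "0 \<le> K * S" "0 \<le> G * (2 * wR * S + H / (2 * c3))"
      using K S G H cs wR_pos by simp_all
    then show "0 \<le> Kw" "K * S \<le> Kw" "S \<le> Kw" "S + G * (2 * wR * S + H / (2 * c3)) \<le> Kw"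
      using S unfolding Kw_def by linarith+
  qed
  have K': "1 \<le> K'" "1 + 2 * c1 * Kw \<le> K'" "2 * c1 * (G / (2 * c3)) \<le> K'" "1 + 2 * c3 * (K * S) \<le> K'" "S \<le> K'" "H \<le> K'"
  proof -
    have "0 \<le> 2 * c1 * Kw" "0 \<le> 2 * c1 * (G / (2 * c3))" "0 \<le> 2 * c3 * (K * S)"
      using K S G Kw cs by simp_all
    then show "1 \<le> K'" "1 + 2 * c1 * Kw \<le> K'" "2 * c1 * (G / (2 * c3)) \<le> K'" "1 + 2 * c3 * (K * S) \<le> K'" "S \<le> K'" "H \<le> K'"
      using S H unfolding K'_def by linarith+
  qed
  have hd: "\<bar>h_in x y - h_in x' y'\<bar> \<le> S * (\<bar>x - x'\<bar> + \<bar>y - y'\<bar>)" for x y x' y'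
    using h_in_dist by (simp add: S_def)
  have hb: "\<bar>h_in x y - hs\<bar> \<le> \<epsilon>" "\<bar>h_in x y\<bar> \<le> H" if "\<bar>x - xs\<bar> \<le> r" "\<bar>y - ys\<bar> \<le> r" for x y
  proof -
    have "\<bar>h_in x y - hs\<bar> \<le> S * (\<bar>x - xs\<bar> + \<bar>y - ys\<bar>)" by (rule hd)
    also have "\<dots> \<le> S * (\<epsilon> / (2 * S) + \<epsilon> / (2 * S))"
      using that S by (intro mult_left_mono add_mono) (auto simp: r_def)
    also have "\<dots> = \<epsilon>" using S by simp
    finally show "\<bar>h_in x y - hs\<bar> \<le> \<epsilon>" .
    then show "\<bar>h_in x y\<bar> \<le> H" unfolding H_def by linarith
  qed
  have wb: "w0 \<le> (y - z) / (2 * c3)" "\<bar>(y - z) / (2 * c3)\<bar> \<le> 2 * wR"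
    if "\<bar>y - ys\<bar> \<le> r" "\<bar>z - zs\<bar> \<le> r" for y z
  proof -
    have "r \<le> c3 * w0" by (simp add: r_def)
    then have "\<bar>(y - z) - 2 * c3 * wR\<bar> \<le> 2 * c3 * w0"
      using that zs_wR by (simp add: abs_le_iff)
    then have "\<bar>((y - z) - 2 * c3 * wR) / (2 * c3)\<bar> \<le> w0"
      using cs by (simp add: abs_divide pos_divide_le_eq mult.commute mult.left_commute)
    moreover have "((y - z) - 2 * c3 * wR) / (2 * c3) = (y - z) / (2 * c3) - wR"
      using cs by (simp add: diff_divide_distrib)
    ultimately have "\<bar>(y - z) / (2 * c3) - wR\<bar> \<le> w0" by simp
    then show "w0 \<le> (y - z) / (2 * c3)" "\<bar>(y - z) / (2 * c3)\<bar> \<le> 2 * wR"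
      using wR_pos unfolding w0_def by linarith+
  qed
  have wd: "\<bar>(y - z) / (2 * c3) - (y' - z') / (2 * c3)\<bar> = \<bar>(y - y') - (z - z')\<bar> / (2 * c3)" for y z y' z'
  proof -
    have "(y - z) / (2 * c3) - (y' - z') / (2 * c3) = ((y - y') - (z - z')) / (2 * c3)"
      by (simp add: diff_divide_distrib)
    then show ?thesis using cs by simp
  qed
  have super: "\<bar>w_super h ((y - z) / (2 * c3)) - w_super h' ((y' - z') / (2 * c3))\<bar>
       \<le> \<bar>h - h'\<bar> + G * (2 * wR * \<bar>h - h'\<bar> + \<bar>h\<bar> * (\<bar>(y - y') - (z - z')\<bar> / (2 * c3)))"
    if "h \<le> 0" "h' \<le> 0" "\<bar>h'\<bar> \<le> H" "\<bar>y - ys\<bar> \<le> r" "\<bar>z - zs\<bar> \<le> r" "\<bar>y' - ys\<bar> \<le> r" "\<bar>z' - zs\<bar> \<le> r" for h h' y y' z z'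
  proof -
    have "\<bar>w_super h ((y - z) / (2 * c3)) - w_super h' ((y' - z') / (2 * c3))\<bar>
       \<le> \<bar>h - h'\<bar> + \<bar>h'\<bar> / w0\<^sup>2 * (\<bar>(y - z) / (2 * c3)\<bar> * \<bar>h - h'\<bar> + \<bar>h\<bar> * \<bar>(y - z) / (2 * c3) - (y' - z') / (2 * c3)\<bar>)"
      using that wb w0 by (intro w_super_lipschitz) auto
    also have "\<dots> \<le> \<bar>h - h'\<bar> + G * (2 * wR * \<bar>h - h'\<bar> + \<bar>h\<bar> * (\<bar>(y - y') - (z - z')\<bar> / (2 * c3)))"
    proof (intro add_left_mono mult_mono)
      show "\<bar>h'\<bar> / w0\<^sup>2 \<le> G" unfolding G_def using that by (intro divide_right_mono) auto
      show "\<bar>(y - z) / (2 * c3)\<bar> * \<bar>h - h'\<bar> + \<bar>h\<bar> * \<bar>(y - z) / (2 * c3) - (y' - z') / (2 * c3)\<bar>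
          \<le> 2 * wR * \<bar>h - h'\<bar> + \<bar>h\<bar> * (\<bar>(y - y') - (z - z')\<bar> / (2 * c3))"
        unfolding wd[of y z y' z'] using that wb(2)[of y z] by (intro add_right_mono mult_right_mono) auto
    qed (use G in auto)
    finally show ?thesis .
  qed
  show thesis
  proof (rule that, unfold_locales)
    show "1 \<le> K'" "0 < r" using K' r by auto
    show "0 \<le> eta x y" for x y by (simp add: eta_def)
    show "p_out xs ys zs = ps" "q_out wR xs ys = zs" by (rule base_p base_q)+
    show "\<bar>eta x y - eta x' y'\<bar> \<le> K' * (\<bar>x - x'\<bar> + \<bar>y - y'\<bar>)" for x y x' y'
    proof -
      have "\<bar>eta x y - eta x' y'\<bar> \<le> \<bar>h_in x y - h_in x' y'\<bar>" unfolding eta_def by linarith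
      also have "\<dots> \<le> S * (\<bar>x - x'\<bar> + \<bar>y - y'\<bar>)" by (rule hd)
      also have "\<dots> \<le> K' * (\<bar>x - x'\<bar> + \<bar>y - y'\<bar>)" using K' by (intro mult_right_mono) auto
      finally show ?thesis .
    qed
    show "eta x y \<le> K'" if "\<bar>x - xs\<bar> \<le> r" "\<bar>y - ys\<bar> \<le> r" for x y
      using hb(2)[OF that] K' H unfolding eta_def by linarith
    show "\<bar>p_out x y z - p_out x' y' z\<bar> \<le> K' * (\<bar>x - x'\<bar> + \<bar>y - y'\<bar>)"
      if b: "\<bar>x - xs\<bar> \<le> r" "\<bar>y - ys\<bar> \<le> r" "\<bar>z - zs\<bar> \<le> r" "\<bar>x' - xs\<bar> \<le> r" "\<bar>y' - ys\<bar> \<le> r" for x y z x' y'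
    proof -
      define e where "e = \<bar>x - x'\<bar> + \<bar>y - y'\<bar>"
      define h h' where "h = h_in x y" and "h' = h_in x' y'"
      define a where "a = (if h > 0 then out_minus h else w_super h ((y - z) / (2 * c3)))"
      define a' where "a' = (if h' > 0 then out_minus h' else w_super h' ((y' - z) / (2 * c3)))"
      have e0: "0 \<le> e" by (simp add: e_def)
      have hh: "\<bar>h - h'\<bar> \<le> S * e" unfolding h_def h'_def e_def by (rule hd)
      note hb1 = hb[OF b(1,2)] and hb2 = hb[OF b(4,5)]
      \<comment> \<open>Across \<open>h = 0\<close> each branch lies between \<open>0\<close> and
        its own argument, so the two join with Lipschitz constant \<open>1\<close>.\<close>
      have mixed: "\<bar>out_minus k - w_super k' w\<bar> \<le> \<bar>k - k'\<bar>" if "0 < k" "k' \<le> 0" "0 < w" for k k' w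
        using out_minus_bounds[OF that(1)] w_super_bounds[OF that(2,3)] by linarith
      have "\<bar>a - a'\<bar> \<le> Kw * e"
      proof -
        consider "0 < h" "0 < h'" | "0 < h" "h' \<le> 0" | "h \<le> 0" "0 < h'" | "h \<le> 0" "h' \<le> 0" by linarith
        then show ?thesis
        proof cases
          case 1
          then have "\<bar>a - a'\<bar> \<le> K * \<bar>h - h'\<bar>" using P1[of h h'] hb1 hb2 by (simp add: a_def a'_def h_def h'_def)
          also have "\<dots> \<le> K * (S * e)" using hh K by (intro mult_left_mono)
          also have "\<dots> \<le> Kw * e" unfolding mult.assoc[symmetric] using Kw e0 by (intro mult_right_mono)
          finally show ?thesis .
        next
          case 2
          then have "\<bar>a - a'\<bar> \<le> \<bar>h - h'\<bar>" using mixed[of h h' "(y' - z) / (2 * c3)"] wb(1)[of y' z] b w0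
            by (simp add: a_def a'_def)
          also have "\<dots> \<le> Kw * e" using hh mult_right_mono[OF Kw(3) e0] by linarith
          finally show ?thesis .
        next
          case 3
          then have "\<bar>a - a'\<bar> \<le> \<bar>h - h'\<bar>" using mixed[of h' h "(y - z) / (2 * c3)"] wb(1)[of y z] b w0
            by (simp add: a_def a'_def abs_minus_commute)
          also have "\<dots> \<le> Kw * e" using hh mult_right_mono[OF Kw(3) e0] by linarith
          finally show ?thesis .
        next
          case 4
          then have "\<bar>a - a'\<bar> \<le> \<bar>h - h'\<bar> + G * (2 * wR * \<bar>h - h'\<bar> + \<bar>h\<bar> * (\<bar>(y - y') - (z - z)\<bar> / (2 * c3)))"
            using super[of h h' y z y' z] b hb2 by (simp add: a_def a'_def h'_def)
          also have "\<dots> \<le> S * e + G * (2 * wR * (S * e) + H * (e / (2 * c3)))"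
            using hh G wR_pos hb1 cs unfolding h_def[symmetric]
            by (intro add_mono mult_left_mono mult_mono divide_right_mono) (auto simp: e_def)
          also have "\<dots> = (S + G * (2 * wR * S + H / (2 * c3))) * e" by (simp add: algebra_simps)
          also have "\<dots> \<le> Kw * e" using Kw e0 by (intro mult_right_mono)
          finally show ?thesis .
        qed
      qed
      then have "2 * c1 * \<bar>a - a'\<bar> \<le> 2 * c1 * (Kw * e)" using cs by (intro mult_left_mono) auto
      moreover have "p_out x y z - p_out x' y' z = (x - x') + 2 * c1 * (a - a')"
        by (simp add: p_out_def a_def a'_def h_def h'_def algebra_simps)
      then have "\<bar>p_out x y z - p_out x' y' z\<bar> \<le> \<bar>x - x'\<bar> + 2 * c1 * \<bar>a - a'\<bar>"
        using abs_triangle_ineq[of "x - x'" "2 * c1 * (a - a')"] cs by (simp add: abs_mult)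
      moreover have "(1 + 2 * c1 * Kw) * e = e + 2 * c1 * (Kw * e)" by (simp add: algebra_simps)
      moreover have "\<bar>x - x'\<bar> \<le> e" by (simp add: e_def)
      ultimately have "\<bar>p_out x y z - p_out x' y' z\<bar> \<le> (1 + 2 * c1 * Kw) * e" by linarith
      also have "\<dots> \<le> K' * e" using K' e0 by (intro mult_right_mono)
      finally show ?thesis by (simp add: e_def)
    qed
    show "\<bar>p_out x y z - p_out x y z'\<bar> \<le> K' * eta x y * \<bar>z - z'\<bar>"
      if b: "\<bar>x - xs\<bar> \<le> r" "\<bar>y - ys\<bar> \<le> r" "\<bar>z - zs\<bar> \<le> r" "\<bar>z' - zs\<bar> \<le> r" for x y z z'
    proof (cases "0 < h_in x y")
      case True
      then show ?thesis by (simp add: p_out_def eta_def)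
    next
      case False
      define h where "h = h_in x y"
      have h: "h \<le> 0" "eta x y = \<bar>h\<bar>" using False by (auto simp: h_def eta_def)
      \<comment> \<open>With equal \<open>h\<close> only the last summand of the Lipschitz bound
        remains, and it carries the factor \<open>\<bar>h\<bar> = eta x y\<close>.\<close>
      have "\<bar>w_super h ((y - z) / (2 * c3)) - w_super h ((y - z') / (2 * c3))\<bar> \<le> G * (\<bar>h\<bar> * (\<bar>z - z'\<bar> / (2 * c3)))"
        using super[of h h y z y z'] h b hb(2)[OF b(1,2)] by (simp add: h_def abs_minus_commute)
      then have "2 * c1 * \<bar>w_super h ((y - z) / (2 * c3)) - w_super h ((y - z') / (2 * c3))\<bar> \<le> 2 * c1 * (G * (\<bar>h\<bar> * (\<bar>z - z'\<bar> / (2 * c3))))"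
        using cs by (intro mult_left_mono) auto
      moreover have "p_out x y z - p_out x y z' = 2 * c1 * (w_super h ((y - z) / (2 * c3)) - w_super h ((y - z') / (2 * c3)))"
        using False by (simp add: p_out_def h_def algebra_simps)
      then have "\<bar>p_out x y z - p_out x y z'\<bar> = 2 * c1 * \<bar>w_super h ((y - z) / (2 * c3)) - w_super h ((y - z') / (2 * c3))\<bar>"
        using cs(1) by (simp only: abs_mult abs_of_pos zero_less_numeral abs_numeral)
      ultimately have "\<bar>p_out x y z - p_out x y z'\<bar> \<le> 2 * c1 * (G * (\<bar>h\<bar> * (\<bar>z - z'\<bar> / (2 * c3))))"
        by simp
      also have "\<dots> = 2 * c1 * (G / (2 * c3)) * (\<bar>h\<bar> * \<bar>z - z'\<bar>)" by simp
      also have "\<dots> \<le> K' * (\<bar>h\<bar> * \<bar>z - z'\<bar>)" using K' by (intro mult_right_mono) auto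
      finally show ?thesis using h by (simp add: mult.assoc)
    qed
    show "\<bar>q_out wR x y - q_out wR x' y'\<bar> \<le> K' * (\<bar>x - x'\<bar> + \<bar>y - y'\<bar>)"
      if b: "\<bar>x - xs\<bar> \<le> r" "\<bar>y - ys\<bar> \<le> r" "\<bar>x' - xs\<bar> \<le> r" "\<bar>y' - ys\<bar> \<le> r" for x y x' y'
    proof -
      define e where "e = \<bar>x - x'\<bar> + \<bar>y - y'\<bar>"
      define h h' where "h = h_in x y" and "h' = h_in x' y'"
      define a where "a = (if h > 0 then out_plus h else wR)"
      define a' where "a' = (if h' > 0 then out_plus h' else wR)"
      have e0: "0 \<le> e" by (simp add: e_def)
      have hh: "\<bar>h - h'\<bar> \<le> S * e" unfolding h_def h'_def e_def by (rule hd)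
      note hb1 = hb(1)[OF b(1,2), folded h_def] and hb2 = hb(1)[OF b(3,4), folded h'_def]
      have "\<bar>a - a'\<bar> \<le> K * \<bar>h - h'\<bar>"
      proof -
        \<comment> \<open>The continuation by the constant \<open>wR\<close> fits because the
          emitted strain differs from \<open>wR\<close> by at most \<open>K * k\<close>, and
          \<open>k \<le> \<bar>k - k'\<bar>\<close> for \<open>k' \<le> 0\<close>.\<close>
        have mixed: "\<bar>out_plus k - wR\<bar> \<le> K * \<bar>k - k'\<bar>" if "0 < k" "k' \<le> 0" "\<bar>k - hs\<bar> \<le> \<epsilon>" "\<bar>k' - hs\<bar> \<le> \<epsilon>" for k k'
          using P2[OF that(3,4,1,2)] mult_left_mono[of k "\<bar>k - k'\<bar>" K] that K by linarith
        consider "0 < h" "0 < h'" | "0 < h" "h' \<le> 0" | "h \<le> 0" "0 < h'" | "h \<le> 0" "h' \<le> 0" by linarith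
        then show ?thesis
        proof cases
          case 1 then show ?thesis using P1[OF hb1 hb2] by (simp add: a_def a'_def)
        next
          case 2 then show ?thesis using mixed[OF 2 hb1 hb2] by (simp add: a_def a'_def)
        next
          case 3 then show ?thesis using mixed[OF 3(2,1) hb2 hb1] by (simp add: a_def a'_def abs_minus_commute)
        next
          case 4 then show ?thesis using K by (simp add: a_def a'_def)
        qed
      qed
      also have "\<dots> \<le> K * (S * e)" using hh K by (intro mult_left_mono)
      finally have "2 * c3 * \<bar>a - a'\<bar> \<le> 2 * c3 * (K * (S * e))" using cs by (intro mult_left_mono) auto
      moreover have "q_out wR x y - q_out wR x' y' = (y - y') - 2 * c3 * (a - a')"
        by (simp add: q_out_def a_def a'_def h_def h'_def algebra_simps)
      then have "\<bar>q_out wR x y - q_out wR x' y'\<bar> \<le> \<bar>y - y'\<bar> + 2 * c3 * \<bar>a - a'\<bar>"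
        using abs_triangle_ineq4[of "y - y'" "2 * c3 * (a - a')"] cs by (simp add: abs_mult)
      moreover have "(1 + 2 * c3 * (K * S)) * e = e + 2 * c3 * (K * (S * e))" by (simp add: algebra_simps)
      moreover have "\<bar>y - y'\<bar> \<le> e" by (simp add: e_def)
      ultimately have "\<bar>q_out wR x y - q_out wR x' y'\<bar> \<le> (1 + 2 * c3 * (K * S)) * e" by linarith
      also have "\<dots> \<le> K' * e" using K' e0 by (intro mult_right_mono)
      finally show ?thesis by (simp add: e_def)
    qed
  qed
qed

end

section \<open>One time step\<close>

context two_phase
begin

lemma fan_sample_phase:
  assumes "0 < c"
  shows "fan_sample (phase_fan c p q p' q') \<alpha> = wave_state c (if - c < \<alpha> then p' else p) (if c < \<alpha> then q' else q)"
  using assms by (auto simp: fan_sample_def phase_fan_def)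

lemma fan_value_phase:
  assumes "0 < c" "0 \<le> t"
  shows "fan_value (phase_fan c p q p' q') t \<xi> = wave_state c (if - c * t \<le> \<xi> then p' else p) (if c * t \<le> \<xi> then q' else q)"
proof -
  have "- c * t \<le> c * t" using assms by simp
  then show ?thesis by (auto simp: fan_value_def phase_fan_def)
qed

definition layout :: "(int \<Rightarrow> state) \<Rightarrow> int \<Rightarrow> (nat \<Rightarrow> real) \<Rightarrow> (nat \<Rightarrow> real) \<Rightarrow> (nat \<Rightarrow> real) \<Rightarrow> (nat \<Rightarrow> real) \<Rightarrow> bool" where
  "layout U M PL QL PR QR \<longleftrightarrow>
     (\<forall>i. U (M - 2 - 2 * int i) = wave_state c1 (PL i) (QL i) \<and> wave_state c1 (PL i) (QL i) \<in> H1) \<and>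
     (\<forall>i. U (M + 2 * int i) = wave_state c3 (PR i) (QR i) \<and> wave_state c3 (PR i) (QR i) \<in> H3)"

text \<open>Cells are indexed by their left end points; \<open>PL i, QL i\<close> (\<open>PR i, QR i\<close>) are the invariants in
  the \<open>i\<close>-th cell to the left (right) of the boundary.\<close>

definition solves :: "(int \<Rightarrow> state) \<Rightarrow> int \<Rightarrow> (int \<Rightarrow> fan) \<Rightarrow> bool" where
  "solves U M F \<longleftrightarrow> (\<forall>m. even (m - M) \<longrightarrow> riemann (U (m - 2)) (U m) (F m))"

lemma fan_left:
  assumes "layout U M PL QL PR QR" "solves U M F"
  shows "F (M - 2 - 2 * int i) = phase_fan c1 (PL (Suc i)) (QL (Suc i)) (PL i) (QL i)"
    and "fan_states (F (M - 2 - 2 * int i)) \<subseteq> H1"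
proof -
  have "even ((M - 2 - 2 * int i) - M)" by simp
  then have "riemann (U ((M - 2 - 2 * int i) - 2)) (U (M - 2 - 2 * int i)) (F (M - 2 - 2 * int i))"
    using assms(2) unfolding solves_def by blast
  moreover have "(M - 2 - 2 * int i) - 2 = M - 2 - 2 * int (Suc i)" by simp
  ultimately have r: "riemann (wave_state c1 (PL (Suc i)) (QL (Suc i))) (wave_state c1 (PL i) (QL i)) (F (M - 2 - 2 * int i))"
    using assms(1) unfolding layout_def by metis
  have H: "wave_state c1 (PL (Suc i)) (QL (Suc i)) \<in> H1" "wave_state c1 (PL i) (QL i) \<in> H1"
    using assms(1) unfolding layout_def by blast+
  show "F (M - 2 - 2 * int i) = phase_fan c1 (PL (Suc i)) (QL (Suc i)) (PL i) (QL i)"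
    "fan_states (F (M - 2 - 2 * int i)) \<subseteq> H1"
    using riemann_phase1[OF r H] by auto
qed

lemma fan_right:
  assumes "layout U M PL QL PR QR" "solves U M F"
  shows "F (M + 2 + 2 * int i) = phase_fan c3 (PR i) (QR i) (PR (Suc i)) (QR (Suc i))"
    and "fan_states (F (M + 2 + 2 * int i)) \<subseteq> H3"
proof -
  have "even ((M + 2 + 2 * int i) - M)" by simp
  then have "riemann (U ((M + 2 + 2 * int i) - 2)) (U (M + 2 + 2 * int i)) (F (M + 2 + 2 * int i))"
    using assms(2) unfolding solves_def by blast
  moreover have "(M + 2 + 2 * int i) - 2 = M + 2 * int i" "M + 2 + 2 * int i = M + 2 * int (Suc i)" by simp_all
  ultimately have r: "riemann (wave_state c3 (PR i) (QR i)) (wave_state c3 (PR (Suc i)) (QR (Suc i))) (F (M + 2 + 2 * int i))"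
    using assms(1) unfolding layout_def by metis
  have H: "wave_state c3 (PR (Suc i)) (QR (Suc i)) \<in> H3" "wave_state c3 (PR i) (QR i) \<in> H3"
    using assms(1) unfolding layout_def by blast+
  show "F (M + 2 + 2 * int i) = phase_fan c3 (PR i) (QR i) (PR (Suc i)) (QR (Suc i))"
    "fan_states (F (M + 2 + 2 * int i)) \<subseteq> H3"
    using riemann_phase3[OF r H(2,1)] by auto
qed

lemma layoutI:
  assumes "\<And>i. U (M - 2 - 2 * int i) = wave_state c1 (PL i) (QL i)" "\<And>i. U (M - 2 - 2 * int i) \<in> H1"
    "\<And>i. U (M + 2 * int i) = wave_state c3 (PR i) (QR i)" "\<And>i. U (M + 2 * int i) \<in> H3"
  shows "layout U M PL QL PR QR"
  unfolding layout_def using assms by simp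

end

context kinetic_phase
begin

lemma fan_middle:
  assumes "layout U M PL QL PR QR" "solves U M F"
  obtains s where "boundary_fan w0 (F M) s (PL 0) (QL 0) (PR 0) (QR 0)"
proof (rule riemann_boundary)
  have "riemann (U (M - 2)) (U M) (F M)" using assms(2) unfolding solves_def by simp
  moreover have "U (M - 2 - 2 * int 0) = wave_state c1 (PL 0) (QL 0)" "U (M + 2 * int 0) = wave_state c3 (PR 0) (QR 0)"
    using assms(1) unfolding layout_def by blast+
  ultimately show "riemann (wave_state c1 (PL 0) (QL 0)) (wave_state c3 (PR 0) (QR 0)) (F M)" by simp
  show "wave_state c1 (PL 0) (QL 0) \<in> H1" "wave_state c3 (PR 0) (QR 0) \<in> H3"
    using assms(1) unfolding layout_def by blast+
qed

end

context base_states
begin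

context
  fixes K r :: real
  assumes br: "boundary_response p_out (q_out wR) eta K r ps xs ys zs"
begin

interpretation br: boundary_response p_out "q_out wR" eta K r ps xs ys zs by (rule br)

text \<open>Each wave is shifted by a cell or not according to the position of
  \<open>\<alpha>\<close> relative to its speed. The node of the boundary moves right if the sample
  falls on its left side (\<open>\<alpha> \<le> s\<close>) and left otherwise; the new sequences are
  numbered from the new node.\<close>

lemma scheme_step:
  assumes b: "br.small b" and inv: "br.invariant b PL QL PR QR"
    and lay: "layout U M PL QL PR QR" and sol: "solves U M F"
    and U': "\<And>m. even (m - M) \<Longrightarrow> U' (m - 1) = fan_sample (F m) \<alpha>"
  shows "\<exists>M' PL' QL' PR' QR'. layout U' M' PL' QL' PR' QR' \<and> br.invariant b PL' QL' PR' QR' \<and> (M' = M + 1 \<or> M' = M - 1)"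
proof -
  note cs = c_simps(1-3)
  note pos = cs(1) cs(2)
  have L: "U' (M - 3 - 2 * int i) = wave_state c1 (if - c1 < \<alpha> then PL i else PL (Suc i)) (if c1 < \<alpha> then QL i else QL (Suc i))"
    and LH: "U' (M - 3 - 2 * int i) \<in> H1" for i
  proof -
    have e: "U' (M - 3 - 2 * int i) = fan_sample (F (M - 2 - 2 * int i)) \<alpha>"
      using U'[of "M - 2 - 2 * int i"] by (simp add: algebra_simps)
    show "U' (M - 3 - 2 * int i) = wave_state c1 (if - c1 < \<alpha> then PL i else PL (Suc i)) (if c1 < \<alpha> then QL i else QL (Suc i))"
      unfolding e fan_left(1)[OF lay sol] by (rule fan_sample_phase[OF pos(1)])
    show "U' (M - 3 - 2 * int i) \<in> H1"
      unfolding e using fan_sample_in_states fan_left(2)[OF lay sol] by blast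
  qed
  have R: "U' (M + 1 + 2 * int i) = wave_state c3 (if - c3 < \<alpha> then PR (Suc i) else PR i) (if c3 < \<alpha> then QR (Suc i) else QR i)"
    and RH: "U' (M + 1 + 2 * int i) \<in> H3" for i
  proof -
    have e: "U' (M + 1 + 2 * int i) = fan_sample (F (M + 2 + 2 * int i)) \<alpha>"
      using U'[of "M + 2 + 2 * int i"] by (simp add: algebra_simps)
    show "U' (M + 1 + 2 * int i) = wave_state c3 (if - c3 < \<alpha> then PR (Suc i) else PR i) (if c3 < \<alpha> then QR (Suc i) else QR i)"
      unfolding e fan_right(1)[OF lay sol] by (rule fan_sample_phase[OF pos(2)])
    show "U' (M + 1 + 2 * int i) \<in> H3"
      unfolding e using fan_sample_in_states fan_right(2)[OF lay sol] by blast
  qed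
  have mid: "U' (M - 1) = fan_sample (F M) \<alpha>" using U'[of M] by simp
  obtain s where bf: "boundary_fan wR (F M) s (PL 0) (QL 0) (PR 0) (QR 0)" by (rule fan_middle[OF lay sol])
  define p' q' where "p' = p_out (QL 0) (PR 0) (QR 0)" and "q' = q_out wR (QL 0) (PR 0)"
  have ul: "wave_state c1 (PL 0) (QL 0) \<in> H1" and ur: "wave_state c3 (PR 0) (QR 0) \<in> H3"
    using lay by (auto simp: layout_def)
  have s: "- c3 < s" "s < c1" using bf cs unfolding boundary_fan_def by (elim conjE disjE; linarith)+
  show ?thesis
  proof (cases "\<alpha> \<le> s")
    case True
    define PL' where "PL' = (if - c1 < \<alpha> then push p' PL else PL)"
    define PR' where "PR' = (if - c3 < \<alpha> then pop PR else PR)"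
    \<comment> \<open>\<open>c3 < \<alpha> \<le> s\<close> happens only for a supersonic boundary,
      which then overtakes the first wave of \<open>QR\<close>.\<close>
    define QR' where "QR' = (if c3 < \<alpha> then pop QR else QR)"
    have m: "U' (M - 1) = wave_state c1 (PL' 0) (QL 0)" "U' (M - 1) \<in> H1"
      using bf True s cs ul unfolding mid boundary_fan_def PL'_def p'_def[symmetric]
      by (auto simp: fan_sample_def)
    have "layout U' (M + 1) PL' QL PR' QR'"
    proof (rule layoutI)
      fix i
      have "U' (M + 1 - 2 - 2 * int i) = wave_state c1 (PL' i) (QL i) \<and> U' (M + 1 - 2 - 2 * int i) \<in> H1"
      proof (cases i)
        case 0 then show ?thesis using m by simp
      next
        case (Suc j)
        have e: "M + 1 - 2 - 2 * int i = M - 3 - 2 * int j" using Suc by simp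
        have "\<not> c1 < \<alpha>" using True s by linarith
        then show ?thesis unfolding e using L[of j] LH[of j] Suc by (simp add: PL'_def)
      qed
      then show "U' (M + 1 - 2 - 2 * int i) = wave_state c1 (PL' i) (QL i)" "U' (M + 1 - 2 - 2 * int i) \<in> H1" by auto
      show "U' (M + 1 + 2 * int i) = wave_state c3 (PR' i) (QR' i)" "U' (M + 1 + 2 * int i) \<in> H3"
        using R[of i] RH[of i] by (auto simp: PR'_def QR'_def)
    qed
    moreover have "br.invariant b PL' QL PR' QR'"
    proof -
      \<comment> \<open>The emission comes first because the emitted value is computed from the
        entries before the step.\<close>
      have 1: "br.invariant b PL' QL PR QR"
        using inv br.invariant_push_left[OF b inv] by (simp add: PL'_def p'_def)
      have 2: "br.invariant b PL' QL PR' QR"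
        using 1 br.invariant_pop_incoming[OF b 1, of QL "pop PR"] by (simp add: PR'_def)
      show ?thesis using 2 br.invariant_pop_right_q[OF b 2] by (simp add: QR'_def)
    qed
    ultimately show ?thesis by blast
  next
    case False
    define QL' where "QL' = (if c1 < \<alpha> then QL else pop QL)"
    define QR' where "QR' = (if c3 < \<alpha> then QR else push q' QR)"
    have c1\<alpha>: "- c1 < \<alpha>" "- c3 < \<alpha>" using False s cs by linarith+
    have m: "U' (M - 1) = wave_state c3 (PR 0) (QR' 0)" "U' (M - 1) \<in> H3"
      using bf False c1\<alpha> cs ur unfolding mid boundary_fan_def QR'_def q'_def[symmetric]
      by (auto simp: fan_sample_def)
    have "layout U' (M - 1) PL QL' PR QR'"
    proof (rule layoutI)
      fix i
      have "M - 1 - 2 - 2 * int i = M - 3 - 2 * int i" by simp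
      then show "U' (M - 1 - 2 - 2 * int i) = wave_state c1 (PL i) (QL' i)" "U' (M - 1 - 2 - 2 * int i) \<in> H1"
        using L[of i] LH[of i] c1\<alpha> by (auto simp: QL'_def)
      have "U' (M - 1 + 2 * int i) = wave_state c3 (PR i) (QR' i) \<and> U' (M - 1 + 2 * int i) \<in> H3"
      proof (cases i)
        case 0 then show ?thesis using m by simp
      next
        case (Suc j)
        have e: "M - 1 + 2 * int i = M + 1 + 2 * int j" using Suc by simp
        show ?thesis unfolding e using R[of j] RH[of j] c1\<alpha> Suc by (simp add: QR'_def)
      qed
      then show "U' (M - 1 + 2 * int i) = wave_state c3 (PR i) (QR' i)" "U' (M - 1 + 2 * int i) \<in> H3" by auto
    qed
    moreover have "br.invariant b PL QL' PR QR'"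
    proof -
      have 1: "br.invariant b PL QL PR QR'"
      proof (cases "c3 < \<alpha>")
        case True then show ?thesis using inv by (simp add: QR'_def)
      next
        \<comment> \<open>\<open>s < \<alpha> \<le> c3\<close> excludes the supersonic regime, so
          \<open>\<eta> = 0\<close> as \<open>invariant_push_right\<close> requires.\<close>
        case nc: False
        then have "s < c3" using False by linarith
        then have "0 < h_in (QL 0) (PR 0)" using bf by (auto simp: boundary_fan_def)
        then have "eta (QL 0) (PR 0) = 0" by (simp add: eta_def)
        then show ?thesis using br.invariant_push_right[OF b inv] nc by (simp add: QR'_def q'_def)
      qed
      show ?thesis using 1 br.invariant_pop_incoming[OF b 1, of "pop QL" PR] by (simp add: QL'_def)
    qed
    ultimately show ?thesis by blast
  qed
qed

end

end

section \<open>Estimates for the approximation\<close>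

text \<open>In these four lemmas \<open>\<theta>\<close> is the position in a cell relative to a
  wave, in units of the cell length, and \<open>k\<close> the distance of the cell from the
  boundary. The rounding formulas for the indices depend only on whether the wave has been passed.
  The truncated \<open>k - 1\<close> at \<open>k = 0\<close> is intended: only the first entry is
  visible there.\<close>

lemma nat_ceiling_index:
  assumes "- 1 \<le> \<theta>" "\<theta> < 1"
  shows "nat \<lceil>real k - \<theta>\<rceil> = (if 0 \<le> \<theta> then k else Suc k)"
proof -
  have "\<lceil>real k - \<theta>\<rceil> = (if 0 \<le> \<theta> then int k else int k + 1)"
    by (rule ceiling_unique) (use assms in auto)
  then show ?thesis by auto
qed

lemma nat_ceiling_index':
  assumes "- 1 \<le> \<theta>" "\<theta> < 1"
  shows "nat \<lceil>real k - 1 - \<theta>\<rceil> = (if 0 \<le> \<theta> then k - 1 else k)"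
proof -
  have "\<lceil>real k - 1 - \<theta>\<rceil> = (if 0 \<le> \<theta> then int k - 1 else int k)"
    by (rule ceiling_unique) (use assms in auto)
  then show ?thesis by auto
qed

lemma nat_floor_index:
  assumes "- 1 \<le> \<theta>" "\<theta> < 1"
  shows "nat (\<lfloor>real k + \<theta>\<rfloor> + 1) = (if 0 \<le> \<theta> then Suc k else k)"
proof -
  have "\<lfloor>real k + \<theta>\<rfloor> = (if 0 \<le> \<theta> then int k else int k - 1)"
    by (rule floor_unique) (use assms in auto)
  then show ?thesis by auto
qed

lemma nat_floor_index':
  assumes "- 1 \<le> \<theta>" "\<theta> < 1"
  shows "nat (\<lfloor>real k - 1 + \<theta>\<rfloor> + 1) = (if 0 \<le> \<theta> then k else k - 1)"
proof -
  have "\<lfloor>real k - 1 + \<theta>\<rfloor> = (if 0 \<le> \<theta> then int k - 1 else int k - 2)"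
    by (rule floor_unique) (use assms in auto)
  then show ?thesis by auto
qed

lemma int_sign_cases:
  fixes k :: int
  obtains (neg) i where "k = - int (Suc i)" | (mid) "k = 0" | (pos) i where "k = int (Suc i)"
proof (cases k "0::int" rule: linorder_cases)
  case less then show ?thesis using neg[of "nat (- k - 1)"] by simp
next
  case equal then show ?thesis using mid by simp
next
  case greater then show ?thesis using pos[of "nat (k - 1)"] by simp
qed

lemma cell_exists:
  fixes h x :: real and M :: int
  assumes "0 < h"
  obtains k :: int where "x \<in> {(of_int (M + 2 * k) - 1) * h..<(of_int (M + 2 * k) + 1) * h}"
proof
  define k where "k = \<lfloor>(x - of_int M * h + h) / (2 * h)\<rfloor>"
  have "of_int k \<le> (x - of_int M * h + h) / (2 * h)" "(x - of_int M * h + h) / (2 * h) < of_int k + 1"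
    unfolding k_def by linarith+
  then have "of_int k * (2 * h) \<le> x - of_int M * h + h" "x - of_int M * h + h < (of_int k + 1) * (2 * h)"
    using assms by (simp_all add: pos_le_divide_eq pos_divide_less_eq)
  then show "x \<in> {(of_int (M + 2 * k) - 1) * h..<(of_int (M + 2 * k) + 1) * h}"
    by (simp add: algebra_simps)
qed

context base_states
begin

text \<open>Choosing the reference state by the phase of the value avoids the position of the
  boundary; \<open>profile_phase\<close> shows that it agrees with the reference function of the
  theorem.\<close>

definition base_state :: "state \<Rightarrow> state" where
  "base_state u = (if u \<in> H1 then uL else uR)"

definition deviation :: "state \<Rightarrow> state" where
  "deviation u = u - base_state u"

definition Ws :: real where "Ws = 1 + 1 / c3"

lemma Ws: "1 \<le> Ws" "1 + 1 / c1 \<le> Ws"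
  using c_simps(1-3) by (auto simp: Ws_def frac_le)

lemma state_dist1: "norm (wave_state c1 p q - wave_state c1 p' q') \<le> Ws * (\<bar>p - p'\<bar> + \<bar>q - q'\<bar>)"
  using wave_state_dist[OF c_simps(1), of p q p' q'] mult_right_mono[OF Ws(2), of "\<bar>p - p'\<bar> + \<bar>q - q'\<bar>"] by linarith

lemma state_dist3: "norm (wave_state c3 p q - wave_state c3 p' q') \<le> Ws * (\<bar>p - p'\<bar> + \<bar>q - q'\<bar>)"
  using wave_state_dist[OF c_simps(2), of p q p' q'] by (simp add: Ws_def)

text \<open>The two indices on either side are monotone in \<open>x\<close>, so that a profile inherits the variation
  of the four sequences.\<close>

definition profile_of ::
    "(real \<Rightarrow> state) \<Rightarrow> real \<Rightarrow> real \<Rightarrow> (nat \<Rightarrow> real) \<Rightarrow> (nat \<Rightarrow> real) \<Rightarrow> (nat \<Rightarrow> real) \<Rightarrow> (nat \<Rightarrow> real) \<Rightarrow> bool" where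
  "profile_of y xb B S1 S2 S3 S4 \<longleftrightarrow>
     (\<exists>i1 i2 i3 i4. antimono i1 \<and> antimono i2 \<and> mono i3 \<and> mono i4 \<and>
       (\<forall>x<xb. y x = wave_state c1 (S1 (i1 x)) (S2 (i2 x)) \<and> y x \<in> H1) \<and>
       (\<forall>x\<ge>xb. y x = wave_state c3 (S3 (i3 x)) (S4 (i4 x)) \<and> y x \<in> H3)) \<and>
     bv_seq S1 \<and> bv_seq S2 \<and> bv_seq S3 \<and> bv_seq S4 \<and>
     svar S1 \<le> B \<and> svar S2 \<le> B \<and> svar S3 \<le> B \<and> svar S4 \<le> B \<and>
     (\<forall>i::nat. \<bar>S1 i - ps\<bar> \<le> B \<and> \<bar>S2 i - xs\<bar> \<le> B \<and> \<bar>S3 i - ys\<bar> \<le> B \<and> \<bar>S4 i - zs\<bar> \<le> B)"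

lemma profile_phase:
  assumes "profile_of y xb B S1 S2 S3 S4"
  shows "x < xb \<Longrightarrow> y x \<in> H1" "xb \<le> x \<Longrightarrow> y x \<in> H3" "deviation (y x) = y x - (if x < xb then uL else uR)"
proof -
  show 1: "x < xb \<Longrightarrow> y x \<in> H1" and 2: "xb \<le> x \<Longrightarrow> y x \<in> H3"
    using assms unfolding profile_of_def by blast+
  show "deviation (y x) = y x - (if x < xb then uL else uR)"
  proof (cases "x < xb")
    case True then show ?thesis using 1 by (simp add: deviation_def base_state_def)
  next
    case False
    have "y x \<in> H3" by (rule 2) (use False in simp)
    then have "y x \<notin> H1" using H_disjoint by blast
    then show ?thesis using False by (simp add: deviation_def base_state_def)
  qed
qed

lemma profile_bounds:
  assumes P: "profile_of y xb B S1 S2 S3 S4"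
  shows "norm (deviation (y x)) \<le> 2 * Ws * B"
    and "TV UNIV (\<lambda>x. deviation (y x)) \<le> ennreal (8 * Ws * B)"
proof -
  obtain i1 i2 i3 i4 where mono: "antimono i1" "antimono i2" "mono i3" "mono i4"
    and L: "\<forall>x<xb. y x = wave_state c1 (S1 (i1 x)) (S2 (i2 x)) \<and> y x \<in> H1"
    and R: "\<forall>x\<ge>xb. y x = wave_state c3 (S3 (i3 x)) (S4 (i4 x)) \<and> y x \<in> H3"
    using P unfolding profile_of_def by (elim conjE exE)
  have bv: "bv_seq S1" "bv_seq S2" "bv_seq S3" "bv_seq S4"
    and sv: "svar S1 \<le> B" "svar S2 \<le> B" "svar S3 \<le> B" "svar S4 \<le> B"
    and near: "\<forall>i. \<bar>S1 i - ps\<bar> \<le> B \<and> \<bar>S2 i - xs\<bar> \<le> B \<and> \<bar>S3 i - ys\<bar> \<le> B \<and> \<bar>S4 i - zs\<bar> \<le> B"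
    using P unfolding profile_of_def by blast+
  note ph = profile_phase[OF P]
  have W0: "0 \<le> Ws" using Ws by linarith
  have dl: "deviation (y x) = wave_state c1 (S1 (i1 x)) (S2 (i2 x)) - wave_state c1 ps xs" if "x < xb" for x
    using ph(3)[of x] L that uL_eq by simp
  have dr: "deviation (y x) = wave_state c3 (S3 (i3 x)) (S4 (i4 x)) - wave_state c3 ys zs" if "xb \<le> x" for x
    using ph(3)[of x] R that uR_eq by simp
  show nb: "norm (deviation (y x)) \<le> 2 * Ws * B" for x
  proof (cases "x < xb")
    case True
    have "norm (deviation (y x)) \<le> Ws * (\<bar>S1 (i1 x) - ps\<bar> + \<bar>S2 (i2 x) - xs\<bar>)"
      unfolding dl[OF True] by (rule state_dist1)
    also have "\<dots> \<le> Ws * (B + B)" using near W0 by (intro mult_left_mono add_mono) auto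
    finally show ?thesis by simp
  next
    case False
    then have "norm (deviation (y x)) \<le> Ws * (\<bar>S3 (i3 x) - ys\<bar> + \<bar>S4 (i4 x) - zs\<bar>)"
      using dr[of x] state_dist3[of "S3 (i3 x)" "S4 (i4 x)" ys zs] by simp
    also have "\<dots> \<le> Ws * (B + B)" using near W0 by (intro mult_left_mono add_mono) auto
    finally show ?thesis by simp
  qed
  \<comment> \<open>\<open>G\<close> takes values in [0, 2B] on the left and in [6B, 8B] on the
    right. The gap \<open>4B\<close> pays for the jump of the deviation across the boundary, which
    is at most twice the bound \<open>2 * Ws * B\<close>.\<close>
  define G where "G x = (if x < xb then 2 * B - (cvar S1 (i1 x) + cvar S2 (i2 x)) else 6 * B + (cvar S3 (i3 x) + cvar S4 (i4 x)))" for x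
  have G1: "0 \<le> G x" "G x \<le> 2 * B" if "x < xb" for x
    using that cvar_le_svar[OF bv(1), of "i1 x"] cvar_le_svar[OF bv(2), of "i2 x"] sv
      cvar_nonneg[of S1 "i1 x"] cvar_nonneg[of S2 "i2 x"] by (auto simp: G_def)
  have G2: "6 * B \<le> G x" "G x \<le> 8 * B" if "xb \<le> x" for x
    using that cvar_le_svar[OF bv(3), of "i3 x"] cvar_le_svar[OF bv(4), of "i4 x"] sv
      cvar_nonneg[of S3 "i3 x"] cvar_nonneg[of S4 "i4 x"] by (auto simp: G_def)
  have B0: "0 \<le> B" using near by (metis abs_ge_zero order_trans)
  show "TV UNIV (\<lambda>x. deviation (y x)) \<le> ennreal (8 * Ws * B)"
  proof (rule TV_leI[where G = "\<lambda>x. Ws * G x"])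
    fix x x' :: real assume xx: "x \<le> x'"
    consider "x' < xb" | "x < xb" "xb \<le> x'" | "xb \<le> x" by linarith
    then have "norm (deviation (y x') - deviation (y x)) \<le> Ws * (G x' - G x)"
    proof cases
      case 1
      have "deviation (y x') - deviation (y x) = wave_state c1 (S1 (i1 x')) (S2 (i2 x')) - wave_state c1 (S1 (i1 x)) (S2 (i2 x))"
        using dl[of x] dl[of x'] 1 xx by simp
      then have "norm (deviation (y x') - deviation (y x)) \<le> Ws * (\<bar>S1 (i1 x') - S1 (i1 x)\<bar> + \<bar>S2 (i2 x') - S2 (i2 x)\<bar>)"
        using state_dist1 by simp
      also have "\<dots> \<le> Ws * (G x' - G x)"
      proof (intro mult_left_mono W0)
        have "i1 x' \<le> i1 x" "i2 x' \<le> i2 x" using mono xx by (auto dest: antimonoD)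
        from cvar_dist[OF this(1), of S1] cvar_dist[OF this(2), of S2]
        show "\<bar>S1 (i1 x') - S1 (i1 x)\<bar> + \<bar>S2 (i2 x') - S2 (i2 x)\<bar> \<le> G x' - G x"
          using 1 xx by (simp add: G_def abs_minus_commute)
      qed
      finally show ?thesis .
    next
      case 2
      have "norm (deviation (y x') - deviation (y x)) \<le> 2 * Ws * B + 2 * Ws * B"
        using norm_triangle_ineq4[of "deviation (y x')" "deviation (y x)"] nb[of x] nb[of x'] by linarith
      also have "\<dots> = Ws * (4 * B)" by simp
      also have "\<dots> \<le> Ws * (G x' - G x)"
        using G1[OF 2(1)] G2[OF 2(2)] W0 by (intro mult_left_mono) auto
      finally show ?thesis .
    next
      case 3
      have "deviation (y x') - deviation (y x) = wave_state c3 (S3 (i3 x')) (S4 (i4 x')) - wave_state c3 (S3 (i3 x)) (S4 (i4 x))"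
        using dr[of x] dr[of x'] 3 xx by simp
      then have "norm (deviation (y x') - deviation (y x)) \<le> Ws * (\<bar>S3 (i3 x') - S3 (i3 x)\<bar> + \<bar>S4 (i4 x') - S4 (i4 x)\<bar>)"
        using state_dist3 by simp
      also have "\<dots> \<le> Ws * (G x' - G x)"
      proof (intro mult_left_mono W0)
        have "i3 x \<le> i3 x'" "i4 x \<le> i4 x'" using mono xx by (auto dest: monoD)
        from cvar_dist[OF this(1), of S3] cvar_dist[OF this(2), of S4]
        show "\<bar>S3 (i3 x') - S3 (i3 x)\<bar> + \<bar>S4 (i4 x') - S4 (i4 x)\<bar> \<le> G x' - G x"
          using 3 xx by (simp add: G_def)
      qed
      finally show ?thesis .
    qed
    then show "norm (deviation (y x') - deviation (y x)) \<le> Ws * G x' - Ws * G x"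
      by (simp add: right_diff_distrib)
  next
    fix x
    have "0 \<le> G x \<and> G x \<le> 8 * B" using G1[of x] G2[of x] B0 by (cases "x < xb") auto
    then show "0 \<le> Ws * G x \<and> Ws * G x \<le> 8 * Ws * B"
      using W0 mult_left_mono[of "G x" "8 * B" Ws] by simp
  qed
qed

context
  fixes K r :: real
  assumes br: "boundary_response p_out (q_out wR) eta K r ps xs ys zs"
begin

interpretation br: boundary_response p_out "q_out wR" eta K r ps xs ys zs by (rule br)

lemma step_profile:
  assumes b: "br.small b" and inv: "br.invariant b PL QL PR QR"
    and lay: "layout U M PL QL PR QR" and sol: "solves U M F"
    and h: "0 < h" and t: "0 \<le> t" "c1 * t < h"
    and y: "\<And>m x. even (m - M) \<Longrightarrow> x \<in> {(of_int m - 1) * h..<(of_int m + 1) * h} \<Longrightarrow> y x = fan_value (F m) t (x - of_int m * h)"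
    and bf: "boundary_fan wR (F M) s (PL 0) (QL 0) (PR 0) (QR 0)"
  shows "profile_of y (of_int M * h + s * t) (br.Cw * b)
     (push (p_out (QL 0) (PR 0) (QR 0)) PL) QL PR (push (q_out wR (QL 0) (PR 0)) QR)"
proof -
  note cs = c_simps(1-3)
  define p' q' where "p' = p_out (QL 0) (PR 0) (QR 0)" and "q' = q_out wR (QL 0) (PR 0)"
  define xb where "xb = of_int M * h + s * t"
  define S1 S4 where "S1 = push p' PL" and "S4 = push q' QR"
  \<comment> \<open>\<open>i1 x\<close> counts the waves at \<open>(M - 2j) h - c1 t\<close>, with j
    a natural number, to the right of \<open>x\<close>, and \<open>i2 x\<close> those at
    \<open>(M - 2 - 2j) h + c1 t\<close>. On the other side \<open>i3 x\<close> and
    \<open>i4 x\<close> count the waves at \<open>(M + 2 + 2j) h - c3 t\<close> and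
    \<open>(M + 2j) h + c3 t\<close> that are not to the right of \<open>x\<close>. The contacts
    issued from the node of the boundary belong to \<open>i1\<close> and \<open>i4\<close>, whose
    sequences start with the emitted values.\<close>
  define i1 i2 i3 i4 where "i1 x = nat \<lceil>(of_int M * h - c1 * t - x) / (2 * h)\<rceil>"
    and "i2 x = nat \<lceil>((of_int M - 2) * h + c1 * t - x) / (2 * h)\<rceil>"
    and "i3 x = nat (\<lfloor>(x - (of_int M + 2) * h + c3 * t) / (2 * h)\<rfloor> + 1)"
    and "i4 x = nat (\<lfloor>(x - of_int M * h - c3 * t) / (2 * h)\<rfloor> + 1)" for x :: real
  have anti: "antimono i1" "antimono i2" unfolding i1_def i2_def
    using h by (auto intro!: antimonoI nat_mono ceiling_mono divide_right_mono)
  have mon: "mono i3" "mono i4" unfolding i3_def i4_def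
    using h by (auto intro!: monoI nat_mono floor_mono divide_right_mono)
  have s: "- c3 < s" "s < c1" using bf cs unfolding boundary_fan_def by (elim conjE disjE; linarith)+
  have ul: "wave_state c1 (PL 0) (QL 0) \<in> H1" and ur: "wave_state c3 (PR 0) (QR 0) \<in> H3"
    using lay by (auto simp: layout_def)
  have c3t: "0 \<le> c1 * t" "0 \<le> c3 * t" "c3 * t < h" and st: "- c3 * t \<le> s * t" "s * t \<le> c1 * t"
    using t cs s mult_right_mono[of c3 c1 t] mult_right_mono[of "-c3" s t] mult_right_mono[of s c1 t] by auto
  have main: "(x < xb \<longrightarrow> y x = wave_state c1 (S1 (i1 x)) (QL (i2 x)) \<and> y x \<in> H1) \<and>
     (xb \<le> x \<longrightarrow> y x = wave_state c3 (PR (i3 x)) (S4 (i4 x)) \<and> y x \<in> H3)" for x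
  proof -
    obtain k :: int where k: "x \<in> {(of_int (M + 2 * k) - 1) * h..<(of_int (M + 2 * k) + 1) * h}"
      by (rule cell_exists[OF h])
    define \<xi> where "\<xi> = x - of_int (M + 2 * k) * h"
    have \<xi>: "- h \<le> \<xi>" "\<xi> < h" using k by (auto simp: \<xi>_def algebra_simps)
    have x: "x = of_int M * h + 2 * of_int k * h + \<xi>" by (simp add: \<xi>_def algebra_simps)
    have yx: "y x = fan_value (F (M + 2 * k)) t \<xi>" using y[OF _ k] by (simp add: \<xi>_def)
    have th: "- 1 \<le> (c * t + \<xi>) / (2 * h)" "(c * t + \<xi>) / (2 * h) < 1"
       "0 \<le> (c * t + \<xi>) / (2 * h) \<longleftrightarrow> - c * t \<le> \<xi>"
       "- 1 \<le> (\<xi> - c * t) / (2 * h)" "(\<xi> - c * t) / (2 * h) < 1" "0 \<le> (\<xi> - c * t) / (2 * h) \<longleftrightarrow> c * t \<le> \<xi>"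
       if "0 \<le> c * t" "c * t < h" for c
      using that \<xi> h by (auto simp: pos_le_divide_eq pos_divide_less_eq zero_le_divide_iff)
    note th1 = th[OF c3t(1) t(2)] and th3 = th[OF c3t(2,3)]
    have I1: "i1 x = (if - c1 * t \<le> \<xi> then n else Suc n)" and I2: "i2 x = (if c1 * t \<le> \<xi> then n - 1 else n)"
      if "k = - int n" for n
    proof -
      have "(of_int M * h - c1 * t - x) / (2 * h) = real n - (c1 * t + \<xi>) / (2 * h)"
        using h that unfolding x by (simp add: field_simps)
      then show "i1 x = (if - c1 * t \<le> \<xi> then n else Suc n)"
        unfolding i1_def using nat_ceiling_index[OF th1(1,2), of n] th1(3) by simp
      have "((of_int M - 2) * h + c1 * t - x) / (2 * h) = real n - 1 - (\<xi> - c1 * t) / (2 * h)"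
        using h that unfolding x by (simp add: field_simps)
      then show "i2 x = (if c1 * t \<le> \<xi> then n - 1 else n)"
        unfolding i2_def using nat_ceiling_index'[OF th1(4,5), of n] th1(6) by simp
    qed
    have I3: "i3 x = (if - c3 * t \<le> \<xi> then n else n - 1)" and I4: "i4 x = (if c3 * t \<le> \<xi> then Suc n else n)"
      if "k = int n" for n
    proof -
      have "(x - (of_int M + 2) * h + c3 * t) / (2 * h) = real n - 1 + (c3 * t + \<xi>) / (2 * h)"
        using h that unfolding x by (simp add: field_simps)
      then show "i3 x = (if - c3 * t \<le> \<xi> then n else n - 1)"
        unfolding i3_def using nat_floor_index'[OF th3(1,2), of n] th3(3) by simp
      have "(x - of_int M * h - c3 * t) / (2 * h) = real n + (\<xi> - c3 * t) / (2 * h)"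
        using h that unfolding x by (simp add: field_simps)
      then show "i4 x = (if c3 * t \<le> \<xi> then Suc n else n)"
        unfolding i4_def using nat_floor_index[OF th3(4,5), of n] th3(6) by simp
    qed
    have side: "x < xb" if "k < 0"
    proof -
      have "of_int k \<le> (-1::real)" using that by linarith
      then have "2 * of_int k * h \<le> - 2 * h" using h mult_right_mono[of "2 * of_int k" "-2::real" h] by simp
      then show ?thesis using \<xi> st c3t unfolding x xb_def by linarith
    qed
    have side': "xb \<le> x" if "0 < k"
    proof -
      have "1 \<le> (of_int k :: real)" using that by linarith
      then have "2 * h \<le> 2 * of_int k * h" using h mult_right_mono[of 2 "2 * of_int k" h] by simp
      then show ?thesis using \<xi> st t unfolding x xb_def by linarith
    qed
    show ?thesis
    proof (cases k rule: int_sign_cases)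
      case (neg i)
      have m: "M + 2 * k = M - 2 - 2 * int i" using neg by simp
      have "y x \<in> H1" unfolding yx m using fan_value_in_states fan_left(2)[OF lay sol] by blast
      moreover have "y x = wave_state c1 (S1 (i1 x)) (QL (i2 x))"
        unfolding yx m fan_left(1)[OF lay sol] fan_value_phase[OF cs(1) t(1)] I1[OF neg] I2[OF neg] S1_def by auto
      ultimately show ?thesis using side neg by simp
    next
      case (pos i)
      have m: "M + 2 * k = M + 2 + 2 * int i" using pos by simp
      have "y x \<in> H3" unfolding yx m using fan_value_in_states fan_right(2)[OF lay sol] by blast
      moreover have "y x = wave_state c3 (PR (i3 x)) (S4 (i4 x))"
        unfolding yx m fan_right(1)[OF lay sol] fan_value_phase[OF cs(2) t(1)] I3[OF pos] I4[OF pos] S4_def by auto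
      ultimately show ?thesis using side' pos by simp
    next
      case mid
      have x0: "x < xb \<longleftrightarrow> \<xi> < s * t" "xb \<le> x \<longleftrightarrow> s * t \<le> \<xi>"
        using mid unfolding x xb_def by simp_all
      have j: "i1 x = (if - c1 * t \<le> \<xi> then 0 else Suc 0)" "i2 x = 0"
        "i3 x = 0" "i4 x = (if c3 * t \<le> \<xi> then Suc 0 else 0)"
        using I1[of 0] I2[of 0] I3[of 0] I4[of 0] mid by auto
      have c1t: "- c1 * t \<le> s * t" using st c3t t cs mult_right_mono[of "- c1" "- c3" t] by simp
      have yx: "y x = fan_value (F M) t \<xi>" using yx mid by simp
      from bf consider (kin) "s < c3" "wave_state c1 p' (QL 0) \<in> H1" "wave_state c3 (PR 0) q' \<in> H3"
          "F M = (wave_state c1 (PL 0) (QL 0), [(- c1, wave_state c1 p' (QL 0)), (s, wave_state c3 (PR 0) q'), (c3, wave_state c3 (PR 0) (QR 0))])"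
        | (super) "c3 \<le> s" "wave_state c1 p' (QL 0) \<in> H1"
          "F M = (wave_state c1 (PL 0) (QL 0), [(- c1, wave_state c1 p' (QL 0)), (s, wave_state c3 (PR 0) (QR 0))])"
        unfolding boundary_fan_def p'_def q'_def by blast
      then show ?thesis
      proof cases
        case kin
        have "s * t \<le> c3 * t" using kin(1) t by (intro mult_right_mono) auto
        then show ?thesis
          unfolding yx kin(4) x0 j fan_value_def S1_def S4_def using kin ul ur c1t
          by (auto simp: not_less not_le)
      next
        case super
        have "c3 * t \<le> s * t" using super(1) t by (intro mult_right_mono) auto
        then show ?thesis
          unfolding yx super(3) x0 j fan_value_def S1_def S4_def using super ul ur c1t
          by (auto simp: not_less not_le)
      qed
    qed
  qed
  have bv: "bv_seq PL" "bv_seq QL" "bv_seq PR" "bv_seq QR" using inv unfolding br.invariant_def by blast+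
  note ib = br.invariant_bounds[OF b inv, folded p'_def q'_def, folded S1_def S4_def]
  show ?thesis
    unfolding profile_of_def p'_def[symmetric] q'_def[symmetric] S1_def[symmetric] S4_def[symmetric] xb_def[symmetric]
  proof (intro conjI)
    show "\<exists>i1 i2 i3 i4. antimono i1 \<and> antimono i2 \<and> mono i3 \<and> mono i4 \<and>
       (\<forall>x<xb. y x = wave_state c1 (S1 (i1 x)) (QL (i2 x)) \<and> y x \<in> H1) \<and>
       (\<forall>x\<ge>xb. y x = wave_state c3 (PR (i3 x)) (S4 (i4 x)) \<and> y x \<in> H3)"
      by (rule exI[of _ i1], rule exI[of _ i2], rule exI[of _ i3], rule exI[of _ i4]) (use anti mon main in blast)
    show "bv_seq S1" "bv_seq S4" using bv by (simp_all add: S1_def S4_def)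
    show "\<forall>i. \<bar>S1 i - ps\<bar> \<le> br.Cw * b \<and> \<bar>QL i - xs\<bar> \<le> br.Cw * b \<and> \<bar>PR i - ys\<bar> \<le> br.Cw * b \<and> \<bar>S4 i - zs\<bar> \<le> br.Cw * b"
      using ib(5-8) by blast
  qed (fact bv ib)+
qed

end

end

section \<open>Continuity in time with respect to the L1 norm\<close>

lemma L1_triangle:
  fixes f g k :: "real \<Rightarrow> 'a::{real_normed_vector, second_countable_topology}"
  assumes [measurable]: "f \<in> borel_measurable borel" "g \<in> borel_measurable borel" "k \<in> borel_measurable borel"
  shows "L1_norm UNIV (\<lambda>x. f x - g x) \<le> L1_norm UNIV (\<lambda>x. f x - k x) + L1_norm UNIV (\<lambda>x. k x - g x)"
proof -
  have "L1_norm UNIV (\<lambda>x. f x - g x) \<le> (\<integral>\<^sup>+x. ennreal (norm (f x - k x)) + ennreal (norm (k x - g x)) \<partial>lborel)"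
    unfolding L1_norm_def
  proof (rule nn_integral_mono)
    fix x
    have "norm (f x - g x) \<le> norm (f x - k x) + norm (k x - g x)"
      using norm_triangle_ineq[of "f x - k x" "k x - g x"] by simp
    then show "ennreal (norm (f x - g x)) * indicator UNIV x \<le> ennreal (norm (f x - k x)) + ennreal (norm (k x - g x))"
      by (simp add: ennreal_leI flip: ennreal_plus)
  qed
  also have "\<dots> = (\<integral>\<^sup>+x. ennreal (norm (f x - k x)) \<partial>lborel) + (\<integral>\<^sup>+x. ennreal (norm (k x - g x)) \<partial>lborel)"
    by (rule nn_integral_add) measurable
  finally show ?thesis by (simp add: L1_norm_def)
qed

lemma L1_norm_commute: "L1_norm A (\<lambda>x. f x - g x) = L1_norm A (\<lambda>x. g x - f x)"
  by (simp add: L1_norm_def norm_minus_commute)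

text \<open>Each of the two times is compared with the beginning of its step at a cost
  \<open>c\<close>, and the number of whole steps between is at most
  \<open>\<bar>t - t'\<bar> / \<tau> + 1\<close>; this gives the \<open>3\<close>.\<close>

lemma L1_time_steps:
  fixes A :: "real \<Rightarrow> real \<Rightarrow> 'a::{real_normed_vector, second_countable_topology}"
  assumes \<tau>: "0 < \<tau>" and c: "0 \<le> c"
    and meas: "\<And>t. 0 \<le> t \<Longrightarrow> A t \<in> borel_measurable borel"
    and step: "\<And>n t. real n * \<tau> \<le> t \<Longrightarrow> t \<le> (real n + 1) * \<tau> \<Longrightarrow> L1_norm UNIV (\<lambda>x. A t x - A (real n * \<tau>) x) \<le> ennreal c"
    and t: "0 \<le> t" "0 \<le> t'"
  shows "L1_norm UNIV (\<lambda>x. A t x - A t' x) \<le> ennreal (c * (\<bar>t - t'\<bar> / \<tau> + 3))"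
proof -
  have grid: "L1_norm UNIV (\<lambda>x. A (real (n + k) * \<tau>) x - A (real n * \<tau>) x) \<le> ennreal (real k * c)" for n k
  proof (induction k)
    case 0
    then show ?case by (simp add: L1_norm_def)
  next
    case (Suc k)
    have m: "A (real j * \<tau>) \<in> borel_measurable borel" for j :: nat using \<tau> by (intro meas) auto
    have "L1_norm UNIV (\<lambda>x. A (real (n + Suc k) * \<tau>) x - A (real n * \<tau>) x)
        \<le> L1_norm UNIV (\<lambda>x. A (real (n + Suc k) * \<tau>) x - A (real (n + k) * \<tau>) x)
          + L1_norm UNIV (\<lambda>x. A (real (n + k) * \<tau>) x - A (real n * \<tau>) x)"
      by (intro L1_triangle m)
    also have "\<dots> \<le> ennreal c + ennreal (real k * c)"
      using \<tau> by (intro add_mono Suc step) (auto simp: algebra_simps)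
    also have "\<dots> = ennreal (real (Suc k) * c)" using c by (simp add: distrib_right flip: ennreal_plus)
    finally show ?case .
  qed
  have ordered: "L1_norm UNIV (\<lambda>x. A t x - A t' x) \<le> ennreal (c * (\<bar>t - t'\<bar> / \<tau> + 3))"
    if t: "0 \<le> t'" "t' \<le> t" for t t'
  proof -
    define n n' where "n = nat \<lfloor>t' / \<tau>\<rfloor>" and "n' = nat \<lfloor>t / \<tau>\<rfloor>"
    have q: "0 \<le> t' / \<tau>" "t' / \<tau> \<le> t / \<tau>" using t \<tau> by (auto intro: divide_right_mono)
    have n: "real n \<le> t' / \<tau>" "t' / \<tau> < real n + 1" "real n' \<le> t / \<tau>" "t / \<tau> < real n' + 1"
      using q unfolding n_def n'_def by linarith+
    have nn: "n \<le> n'" unfolding n_def n'_def using q by (intro nat_mono floor_mono)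
    have b: "real n * \<tau> \<le> t'" "t' \<le> (real n + 1) * \<tau>" "real n' * \<tau> \<le> t" "t \<le> (real n' + 1) * \<tau>"
      using n \<tau> by (simp_all add: pos_le_divide_eq pos_divide_less_eq)
    have t0: "0 \<le> t" using t by simp
    have m: "A (real j * \<tau>) \<in> borel_measurable borel" for j :: nat using \<tau> by (intro meas) auto
    have "L1_norm UNIV (\<lambda>x. A t x - A t' x)
        \<le> L1_norm UNIV (\<lambda>x. A t x - A (real n' * \<tau>) x) + L1_norm UNIV (\<lambda>x. A (real n' * \<tau>) x - A t' x)"
      by (intro L1_triangle meas m t0 t)
    also have "L1_norm UNIV (\<lambda>x. A (real n' * \<tau>) x - A t' x)
        \<le> L1_norm UNIV (\<lambda>x. A (real n' * \<tau>) x - A (real n * \<tau>) x) + L1_norm UNIV (\<lambda>x. A (real n * \<tau>) x - A t' x)"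
      by (intro L1_triangle meas m t0 t)
    also have "L1_norm UNIV (\<lambda>x. A (real n * \<tau>) x - A t' x) \<le> ennreal c"
      unfolding L1_norm_commute[of UNIV "A (real n * \<tau>)"] by (intro step b)
    also have "L1_norm UNIV (\<lambda>x. A (real n' * \<tau>) x - A (real n * \<tau>) x) \<le> ennreal (real (n' - n) * c)"
      using grid[of n "n' - n"] nn by simp
    also have "L1_norm UNIV (\<lambda>x. A t x - A (real n' * \<tau>) x) \<le> ennreal c" by (intro step b)
    finally have "L1_norm UNIV (\<lambda>x. A t x - A t' x) \<le> ennreal c + (ennreal (real (n' - n) * c) + ennreal c)"
      by (simp add: add_mono)
    also have "\<dots> = ennreal (c * (real (n' - n) + 2))" using c by (simp add: algebra_simps flip: ennreal_plus)
    also have "\<dots> \<le> ennreal (c * (\<bar>t - t'\<bar> / \<tau> + 3))"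
    proof (intro ennreal_leI mult_left_mono c)
      have "\<bar>t - t'\<bar> / \<tau> = t / \<tau> - t' / \<tau>" using t by (simp add: diff_divide_distrib)
      then show "real (n' - n) + 2 \<le> \<bar>t - t'\<bar> / \<tau> + 3" using n nn by (simp add: of_nat_diff)
    qed
    finally show ?thesis .
  qed
  show ?thesis
    using ordered[of t' t] ordered[of t t'] t L1_norm_commute[of UNIV "A t" "A t'"]
    by (cases "t \<le> t'") (auto simp: abs_minus_commute)
qed

text \<open>All cells have length \<open>2h\<close>, so bounds per cell that are summable on either
  side give an L1 bound proportional to \<open>h\<close>. The cell around the boundary node has its
  own bound \<open>J\<close>.\<close>

lemma L1_cells:
  fixes f :: "real \<Rightarrow> 'a::real_normed_vector" and M :: int
  assumes h: "0 < h" and J: "0 \<le> J" and d: "\<And>i. 0 \<le> dL i" "\<And>i. 0 \<le> dR i" "summable dL" "summable dR"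
    and f: "\<And>x. x \<in> {(of_int M - 1) * h..<(of_int M + 1) * h} \<Longrightarrow> norm (f x) \<le> J"
      "\<And>x i. x \<in> {(of_int (M - 2 - 2 * int i) - 1) * h..<(of_int (M - 2 - 2 * int i) + 1) * h} \<Longrightarrow> norm (f x) \<le> dL i"
      "\<And>x i. x \<in> {(of_int (M + 2 + 2 * int i) - 1) * h..<(of_int (M + 2 + 2 * int i) + 1) * h} \<Longrightarrow> norm (f x) \<le> dR i"
  shows "L1_norm UNIV f \<le> ennreal (2 * h * (J + (\<Sum>i. dL i) + (\<Sum>i. dR i)))"
proof -
  define cell where "cell m = {(of_int m - 1) * h..<(of_int m + 1) * h}" for m :: int
  have cell: "cell m \<in> sets lborel" "emeasure lborel (cell m) = ennreal (2 * h)" for m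
  proof -
    show "cell m \<in> sets lborel" by (simp add: cell_def)
    have "(of_int m - 1) * h \<le> (of_int m + 1) * h" using h by simp
    then show "emeasure lborel (cell m) = ennreal (2 * h)"
      unfolding cell_def by (subst emeasure_lborel_Ico) (auto simp: algebra_simps)
  qed
  let ?B = "\<lambda>x. ennreal J * indicator (cell M) x + ((\<Sum>i. ennreal (dL i) * indicator (cell (M - 2 - 2 * int i)) x)
     + (\<Sum>i. ennreal (dR i) * indicator (cell (M + 2 + 2 * int i)) x))"
  have pw: "ennreal (norm (f x)) \<le> ?B x" for x
  proof -
    obtain k :: int where k: "x \<in> cell (M + 2 * k)" unfolding cell_def by (rule cell_exists[OF h])
    have ser: "g i \<le> (\<Sum>i. g i)" for g :: "nat \<Rightarrow> ennreal" and i
      using sum_le_suminf[of g "{i}"] by (simp add: summableI)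
    show ?thesis
    proof (cases k rule: int_sign_cases)
      case (neg i)
      then have e: "M + 2 * k = M - 2 - 2 * int i" by simp
      have x: "x \<in> cell (M - 2 - 2 * int i)" using k unfolding e .
      have "ennreal (norm (f x)) \<le> ennreal (dL i) * indicator (cell (M - 2 - 2 * int i)) x"
        using f(2)[OF x[unfolded cell_def]] x by (simp add: ennreal_leI)
      also note ser[of "\<lambda>i. ennreal (dL i) * indicator (cell (M - 2 - 2 * int i)) x" i]
      finally show ?thesis by (rule order_trans) (simp add: add_increasing add_increasing2)
    next
      case mid
      then have x: "x \<in> cell M" using k by simp
      have "ennreal (norm (f x)) \<le> ennreal J * indicator (cell M) x"
        using f(1)[OF x[unfolded cell_def]] x by (simp add: ennreal_leI)
      then show ?thesis by (rule order_trans) (simp add: add_increasing2)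
    next
      case (pos i)
      then have e: "M + 2 * k = M + 2 + 2 * int i" by simp
      have x: "x \<in> cell (M + 2 + 2 * int i)" using k unfolding e .
      have "ennreal (norm (f x)) \<le> ennreal (dR i) * indicator (cell (M + 2 + 2 * int i)) x"
        using f(3)[OF x[unfolded cell_def]] x by (simp add: ennreal_leI)
      also note ser[of "\<lambda>i. ennreal (dR i) * indicator (cell (M + 2 + 2 * int i)) x" i]
      finally show ?thesis by (rule order_trans) (simp add: add_increasing)
    qed
  qed
  have series: "(\<integral>\<^sup>+x. (\<Sum>i. ennreal (d i) * indicator (cell (m i)) x) \<partial>lborel) = ennreal ((\<Sum>i. d i) * (2 * h))"
    if "\<And>i. 0 \<le> d i" "summable d" for d :: "nat \<Rightarrow> real" and m
  proof -
    have "(\<integral>\<^sup>+x. (\<Sum>i. ennreal (d i) * indicator (cell (m i)) x) \<partial>lborel)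
        = (\<Sum>i. \<integral>\<^sup>+x. ennreal (d i) * indicator (cell (m i)) x \<partial>lborel)"
      by (rule nn_integral_suminf) (use cell in measurable)
    also have "\<dots> = (\<Sum>i. ennreal (d i * (2 * h)))"
      using cell that h by (simp add: nn_integral_cmult_indicator ennreal_mult)
    also have "\<dots> = ennreal (\<Sum>i. d i * (2 * h))"
      using that h by (intro suminf_ennreal2) (auto intro: summable_mult2)
    also have "(\<Sum>i. d i * (2 * h)) = (\<Sum>i. d i) * (2 * h)" by (rule suminf_mult2[symmetric, OF that(2)])
    finally show ?thesis .
  qed
  have meas: "(\<lambda>x. ennreal J * indicator (cell M) x) \<in> borel_measurable lborel"
    "\<And>d m. (\<lambda>x. (\<Sum>i::nat. ennreal (d i) * indicator (cell (m i)) x)) \<in> borel_measurable lborel"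
    using cell(1) by measurable
  have "L1_norm UNIV f \<le> (\<integral>\<^sup>+x. ?B x \<partial>lborel)"
    unfolding L1_norm_def using pw by (intro nn_integral_mono) simp
  also have "\<dots> = (\<integral>\<^sup>+x. ennreal J * indicator (cell M) x \<partial>lborel)
     + ((\<integral>\<^sup>+x. (\<Sum>i. ennreal (dL i) * indicator (cell (M - 2 - 2 * int i)) x) \<partial>lborel)
     + (\<integral>\<^sup>+x. (\<Sum>i. ennreal (dR i) * indicator (cell (M + 2 + 2 * int i)) x) \<partial>lborel))"
    using meas by (subst nn_integral_add; simp add: nn_integral_add)
  also have "(\<integral>\<^sup>+x. ennreal J * indicator (cell M) x \<partial>lborel) = ennreal (J * (2 * h))"
    using cell J h by (simp add: nn_integral_cmult_indicator ennreal_mult)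
  also note series[OF d(1,3), of "\<lambda>i. M - 2 - 2 * int i"]
  also note series[OF d(2,4), of "\<lambda>i. M + 2 + 2 * int i"]
  finally show ?thesis
    using J h d suminf_nonneg[OF d(3,1)] suminf_nonneg[OF d(4,2)]
    by (simp add: algebra_simps flip: ennreal_plus)
qed

context base_states
begin

lemma phase_fan_dist:
  assumes "u \<in> fan_states (phase_fan c p q p' q')" "u' \<in> fan_states (phase_fan c p q p' q')"
    and "\<And>p q p' q'. norm (wave_state c p q - wave_state c p' q') \<le> W * (\<bar>p - p'\<bar> + \<bar>q - q'\<bar>)" "0 \<le> W"
  shows "norm (u - u') \<le> W * (\<bar>p' - p\<bar> + \<bar>q' - q\<bar>)"
proof -
  obtain a b a' b' where u: "u = wave_state c a b" "u' = wave_state c a' b'"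
    and ab: "a \<in> {p, p'}" "b \<in> {q, q'}" "a' \<in> {p, p'}" "b' \<in> {q, q'}"
    using assms(1,2) by (auto simp: fan_states_def phase_fan_def)
  have "norm (u - u') \<le> W * (\<bar>a - a'\<bar> + \<bar>b - b'\<bar>)" unfolding u by (rule assms)
  also have "\<dots> \<le> W * (\<bar>p' - p\<bar> + \<bar>q' - q\<bar>)"
    using ab assms(4) by (intro mult_left_mono add_mono) auto
  finally show ?thesis .
qed

lemma deviation_diff:
  "u \<in> H1 \<and> u' \<in> H1 \<or> u \<in> H3 \<and> u' \<in> H3 \<Longrightarrow> deviation u - deviation u' = u - u'"
proof (elim disjE conjE)
  assume "u \<in> H3" "u' \<in> H3"
  then have "u \<notin> H1" "u' \<notin> H1" using H_disjoint by blast+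
  then show ?thesis by (simp add: deviation_def base_state_def)
qed (simp add: deviation_def base_state_def)

lemma norm_diff_le_deviation:
  "norm (u - u') \<le> norm (deviation u - deviation u') + norm (uR - uL)"
proof -
  have "u - u' = (deviation u - deviation u') + (base_state u - base_state u')"
    by (simp add: deviation_def)
  then have "norm (u - u') \<le> norm (deviation u - deviation u') + norm (base_state u - base_state u')"
    by (metis norm_triangle_ineq)
  moreover have "norm (base_state u - base_state u') \<le> norm (uR - uL)"
    by (auto simp: base_state_def norm_minus_commute)
  ultimately show ?thesis by linarith
qed

context
  fixes K r :: real
  assumes br: "boundary_response p_out (q_out wR) eta K r ps xs ys zs"
begin

interpretation br: boundary_response p_out "q_out wR" eta K r ps xs ys zs by (rule br)

lemma middle_deviation:
  assumes b: "br.small b" and inv: "br.invariant b PL QL PR QR"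
    and lay: "layout U M PL QL PR QR" and bf: "boundary_fan wR (F M) s (PL 0) (QL 0) (PR 0) (QR 0)"
    and u: "u \<in> fan_states (F M)"
  shows "norm (deviation u) \<le> 2 * Ws * (br.Cw * b)"
proof -
  define p' q' where "p' = p_out (QL 0) (PR 0) (QR 0)" and "q' = q_out wR (QL 0) (PR 0)"
  note ib = br.invariant_bounds[OF b inv, folded p'_def q'_def]
  have W0: "0 \<le> Ws" using Ws by linarith
  have ul: "wave_state c1 (PL 0) (QL 0) \<in> H1" and ur: "wave_state c3 (PR 0) (QR 0) \<in> H3"
    using lay by (auto simp: layout_def)
  have left: "norm (deviation (wave_state c1 p (QL 0))) \<le> 2 * Ws * (br.Cw * b)"
    if "wave_state c1 p (QL 0) \<in> H1" "\<bar>p - ps\<bar> \<le> br.Cw * b" for p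
  proof -
    have "deviation (wave_state c1 p (QL 0)) = wave_state c1 p (QL 0) - wave_state c1 ps xs"
      using that(1) uL_eq by (simp add: deviation_def base_state_def)
    then have "norm (deviation (wave_state c1 p (QL 0))) \<le> Ws * (\<bar>p - ps\<bar> + \<bar>QL 0 - xs\<bar>)"
      using state_dist1 by simp
    also have "\<dots> \<le> Ws * (br.Cw * b + br.Cw * b)" using ib(6) that W0 by (intro mult_left_mono add_mono) auto
    finally show ?thesis by (simp add: algebra_simps)
  qed
  have right: "norm (deviation (wave_state c3 (PR 0) q)) \<le> 2 * Ws * (br.Cw * b)"
    if "wave_state c3 (PR 0) q \<in> H3" "\<bar>q - zs\<bar> \<le> br.Cw * b" for q
  proof -
    have "wave_state c3 (PR 0) q \<notin> H1" using that(1) H_disjoint by blast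
    then have "deviation (wave_state c3 (PR 0) q) = wave_state c3 (PR 0) q - wave_state c3 ys zs"
      using uR_eq by (simp add: deviation_def base_state_def)
    then have "norm (deviation (wave_state c3 (PR 0) q)) \<le> Ws * (\<bar>PR 0 - ys\<bar> + \<bar>q - zs\<bar>)"
      using state_dist3 by simp
    also have "\<dots> \<le> Ws * (br.Cw * b + br.Cw * b)" using ib(7) that W0 by (intro mult_left_mono add_mono) auto
    finally show ?thesis by (simp add: algebra_simps)
  qed
  have "u \<in> {wave_state c1 (PL 0) (QL 0), wave_state c1 p' (QL 0), wave_state c3 (PR 0) (QR 0)} \<or>
      u = wave_state c3 (PR 0) q' \<and> wave_state c3 (PR 0) q' \<in> H3"
    using bf u unfolding boundary_fan_def p'_def q'_def fan_states_def by auto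
  moreover have "wave_state c1 p' (QL 0) \<in> H1" using bf by (simp add: boundary_fan_def p'_def)
  ultimately show ?thesis
    using left[OF ul] left[of p'] right[OF ur] right[of q'] ib(5)[of 0] ib(5)[of 1] ib(8)[of 0] ib(8)[of 1] by auto
qed

text \<open>Within one step, sampling included, every value in a cell is a state of one fan, so it
  changes at most by the oscillation of that fan. The side cells contribute the variation of the
  four sequences. In the boundary cell the deviation changes by at most \<open>4 * Ws * B\<close>;
  \<open>u\<close> itself may in addition pass from one phase to the other, which costs
  \<open>norm (uR - uL)\<close>.\<close>

lemma step_L1:
  assumes b: "br.small b" and inv: "br.invariant b PL QL PR QR"
    and lay: "layout U M PL QL PR QR" and sol: "solves U M F"
    and bf: "boundary_fan wR (F M) s (PL 0) (QL 0) (PR 0) (QR 0)" and h: "0 < h"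
    and y: "\<And>m x. even (m - M) \<Longrightarrow> x \<in> {(of_int m - 1) * h..<(of_int m + 1) * h} \<Longrightarrow> y x \<in> fan_states (F m) \<and> y' x \<in> fan_states (F m)"
  shows "L1_norm UNIV (\<lambda>x. deviation (y x) - deviation (y' x)) \<le> ennreal (16 * Ws * (br.Cw * b) * h)"
    and "L1_norm UNIV (\<lambda>x. y x - y' x) \<le> ennreal ((16 * Ws * (br.Cw * b) + 2 * norm (uR - uL)) * h)"
proof -
  define B where "B = br.Cw * b"
  have W0: "0 \<le> Ws" using Ws by linarith
  have bv: "bv_seq PL" "bv_seq QL" "bv_seq PR" "bv_seq QR" using inv unfolding br.invariant_def by blast+
  note ib = br.invariant_bounds[OF b inv, folded B_def]
  have B0: "0 \<le> B" using ib(6)[of 0] abs_ge_zero order_trans by blast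
  have sv: "svar PL \<le> B" "svar QL \<le> B" "svar PR \<le> B" "svar QR \<le> B"
    using ib(1-4) by (simp_all add: svar_push bv)
  define dL where "dL i = Ws * (\<bar>PL i - PL (Suc i)\<bar> + \<bar>QL i - QL (Suc i)\<bar>)" for i
  define dR where "dR i = Ws * (\<bar>PR (Suc i) - PR i\<bar> + \<bar>QR (Suc i) - QR i\<bar>)" for i
  have ss: "(\<lambda>i. \<bar>s (Suc i) - s i\<bar>) sums svar s" if "bv_seq s" for s
    using that unfolding bv_seq_def svar_def by (rule summable_sums)
  have "(\<lambda>i. Ws * (\<bar>PL (Suc i) - PL i\<bar> + \<bar>QL (Suc i) - QL i\<bar>)) sums (Ws * (svar PL + svar QL))"
    by (intro sums_mult sums_add ss bv)
  then have dLs: "dL sums (Ws * (svar PL + svar QL))"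
    unfolding dL_def abs_minus_commute[of "PL (Suc _)"] abs_minus_commute[of "QL (Suc _)"] .
  have dRs: "dR sums (Ws * (svar PR + svar QR))"
    unfolding dR_def by (intro sums_mult sums_add ss bv)
  note sm = sums_summable[OF dLs] sums_summable[OF dRs] and sL = sums_unique[OF dLs, symmetric] sums_unique[OF dRs, symmetric]
  have nn: "0 \<le> dL i" "0 \<le> dR i" for i using W0 by (auto simp: dL_def dR_def)
  have dist: "u - u' = deviation u - deviation u' \<and> norm (u - u') \<le> dL i"
    if "u \<in> fan_states (F (M - 2 - 2 * int i))" "u' \<in> fan_states (F (M - 2 - 2 * int i))" for u u' i
  proof -
    have H: "u \<in> H1" "u' \<in> H1" using that fan_left(2)[OF lay sol, of i] by blast+
    have "norm (u - u') \<le> dL i"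
      unfolding dL_def using that unfolding fan_left(1)[OF lay sol]
      by (rule phase_fan_dist[OF _ _ state_dist1 W0])
    then show ?thesis using deviation_diff[of u u'] H by simp
  qed
  have dist': "u - u' = deviation u - deviation u' \<and> norm (u - u') \<le> dR i"
    if "u \<in> fan_states (F (M + 2 + 2 * int i))" "u' \<in> fan_states (F (M + 2 + 2 * int i))" for u u' i
  proof -
    have H: "u \<in> H3" "u' \<in> H3" using that fan_right(2)[OF lay sol, of i] by blast+
    have "norm (u - u') \<le> dR i"
      unfolding dR_def using that unfolding fan_right(1)[OF lay sol]
      by (rule phase_fan_dist[OF _ _ state_dist3 W0])
    then show ?thesis using deviation_diff[of u u'] H by simp
  qed
  note md = middle_deviation[where PL = PL and QL = QL and PR = PR and QR = QR and F = F and M = M, OF b inv lay bf]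
  have mid: "norm (deviation u - deviation u') \<le> 4 * Ws * B" if "u \<in> fan_states (F M)" "u' \<in> fan_states (F M)" for u u'
    using md[OF that(1)] md[OF that(2)]
      norm_triangle_ineq4[of "deviation u" "deviation u'"] unfolding B_def by linarith
  have total: "Ws * (svar PL + svar QL) + Ws * (svar PR + svar QR) \<le> 4 * Ws * B"
    using mult_left_mono[of "svar PL + svar QL + (svar PR + svar QR)" "4 * B" Ws] sv W0 by (simp add: distrib_left)
  have ev: "even ((M - 2 - 2 * int i) - M)" "even ((M + 2 + 2 * int i) - M)" "even (M - M)" for i by simp_all
  have "L1_norm UNIV (\<lambda>x. deviation (y x) - deviation (y' x)) \<le> ennreal (2 * h * (4 * Ws * B + (\<Sum>i. dL i) + (\<Sum>i. dR i)))"
  proof (rule L1_cells[OF h _ nn sm])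
    show "0 \<le> 4 * Ws * B" using W0 B0 by simp
    show "norm (deviation (y x) - deviation (y' x)) \<le> 4 * Ws * B"
      if "x \<in> {(of_int M - 1) * h..<(of_int M + 1) * h}" for x
      using mid y[OF ev(3) that] by blast
    show "norm (deviation (y x) - deviation (y' x)) \<le> dL i"
      if "x \<in> {(of_int (M - 2 - 2 * int i) - 1) * h..<(of_int (M - 2 - 2 * int i) + 1) * h}" for x i
    proof -
      have "y x - y' x = deviation (y x) - deviation (y' x)" "norm (y x - y' x) \<le> dL i"
        using dist[of "y x" i "y' x"] y[OF ev(1) that] by blast+
      then show ?thesis by (simp only:)
    qed
    show "norm (deviation (y x) - deviation (y' x)) \<le> dR i"
      if "x \<in> {(of_int (M + 2 + 2 * int i) - 1) * h..<(of_int (M + 2 + 2 * int i) + 1) * h}" for x i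
    proof -
      have "y x - y' x = deviation (y x) - deviation (y' x)" "norm (y x - y' x) \<le> dR i"
        using dist'[of "y x" i "y' x"] y[OF ev(2) that] by blast+
      then show ?thesis by (simp only:)
    qed
  qed
  also have "\<dots> \<le> ennreal (16 * Ws * B * h)"
    using mult_left_mono[OF total, of "2 * h"] h unfolding sL by (intro ennreal_leI) (simp add: algebra_simps)
  finally show "L1_norm UNIV (\<lambda>x. deviation (y x) - deviation (y' x)) \<le> ennreal (16 * Ws * (br.Cw * b) * h)"
    by (simp only: B_def)
  have "L1_norm UNIV (\<lambda>x. y x - y' x) \<le> ennreal (2 * h * ((4 * Ws * B + norm (uR - uL)) + (\<Sum>i. dL i) + (\<Sum>i. dR i)))"
  proof (rule L1_cells[OF h _ nn sm])
    show "0 \<le> 4 * Ws * B + norm (uR - uL)" using W0 B0 by simp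
    show "norm (y x - y' x) \<le> 4 * Ws * B + norm (uR - uL)"
      if "x \<in> {(of_int M - 1) * h..<(of_int M + 1) * h}" for x
      using mid[of "y x" "y' x"] y[OF ev(3) that] norm_diff_le_deviation[of "y x" "y' x"] by linarith
    show "norm (y x - y' x) \<le> dL i"
      if "x \<in> {(of_int (M - 2 - 2 * int i) - 1) * h..<(of_int (M - 2 - 2 * int i) + 1) * h}" for x i
      using dist[of "y x" i "y' x"] y[OF ev(1) that] by blast
    show "norm (y x - y' x) \<le> dR i"
      if "x \<in> {(of_int (M + 2 + 2 * int i) - 1) * h..<(of_int (M + 2 + 2 * int i) + 1) * h}" for x i
      using dist'[of "y x" i "y' x"] y[OF ev(2) that] by blast
  qed
  also have "\<dots> \<le> ennreal ((16 * Ws * B + 2 * norm (uR - uL)) * h)"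
    using mult_left_mono[OF total, of "2 * h"] h unfolding sL by (intro ennreal_leI) (simp add: algebra_simps)
  finally show "L1_norm UNIV (\<lambda>x. y x - y' x) \<le> ennreal ((16 * Ws * (br.Cw * b) + 2 * norm (uR - uL)) * h)"
    by (simp only: B_def)
qed

end

end

lemma Linf_norm_le:
  fixes f :: "real \<Rightarrow> 'a::{real_normed_vector, second_countable_topology}"
  assumes [measurable]: "f \<in> borel_measurable borel" and b: "\<And>x. norm (f x) \<le> c"
  shows "Linf_norm UNIV f \<le> ennreal c"
proof -
  have "esssup (restrict_space lborel UNIV) (\<lambda>x. ereal (norm (f x))) \<le> ereal c"
  proof (rule esssup_I)
    show "(\<lambda>x. ereal (norm (f x))) \<in> borel_measurable (restrict_space lborel UNIV)"
      by (intro measurable_restrict_space1) measurable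
  qed (simp add: b)
  then have "e2ennreal (esssup (restrict_space lborel UNIV) (\<lambda>x. ereal (norm (f x)))) \<le> e2ennreal (ereal c)"
    by (rule e2ennreal_mono)
  then show ?thesis by (simp add: Linf_norm_def)
qed

section \<open>Propagation of the invariant along the scheme\<close>

context base_states
begin

context
  fixes K r :: real
  assumes br: "boundary_response p_out (q_out wR) eta K r ps xs ys zs"
begin

interpretation br: boundary_response p_out "q_out wR" eta K r ps xs ys zs by (rule br)

text \<open>The parity condition places the boundary at one of the nodes where Riemann problems are
  centred at step \<open>n\<close>.\<close>

definition good :: "real \<Rightarrow> nat \<Rightarrow> (int \<Rightarrow> state) \<Rightarrow> bool" where
  "good b n U \<longleftrightarrow> (\<exists>M PL QL PR QR. even (M + int n) \<and> layout U M PL QL PR QR \<and> br.invariant b PL QL PR QR)"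

lemma solvesI:
  assumes "even (M + int n)" "\<And>m. even (m + int n) \<Longrightarrow> riemann (U (m - 2)) (U m) (F m)"
  shows "solves U M F"
  unfolding solves_def
proof (intro allI impI)
  fix m assume "even (m - M)"
  then have "even (m + int n)" using assms(1) by presburger
  then show "riemann (U (m - 2)) (U m) (F m)" by (rule assms(2))
qed

lemma good_step:
  assumes b: "br.small b" and g: "good b n U"
    and r: "\<And>m. even (m + int n) \<Longrightarrow> riemann (U (m - 2)) (U m) (F m)"
    and U': "\<And>m. even (m + int n) \<Longrightarrow> U' (m - 1) = fan_sample (F m) \<alpha>"
  shows "good b (Suc n) U'"
proof -
  obtain M PL QL PR QR where M: "even (M + int n)" and lay: "layout U M PL QL PR QR" and inv: "br.invariant b PL QL PR QR"
    using g unfolding good_def by blast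
  have sol: "solves U M F" using solvesI[of M n U F] M r by blast
  have "U' (m - 1) = fan_sample (F m) \<alpha>" if "even (m - M)" for m
  proof (rule U')
    show "even (m + int n)" using that M by presburger
  qed
  from scheme_step[OF br b inv lay sol this]
  obtain M' PL' QL' PR' QR' where "layout U' M' PL' QL' PR' QR'" "br.invariant b PL' QL' PR' QR'" "M' = M + 1 \<or> M' = M - 1"
    by blast
  moreover have "even (M' + int (Suc n))" using calculation(3) M by auto
  ultimately show ?thesis unfolding good_def by blast
qed

lemma scheme_estimates:
  assumes b: "br.small b" and \<tau>: "0 < \<tau>" and h: "0 < h" and cfl: "\<tau> * c1 < h"
    and g0: "good b 0 (\<lambda>m. u 0 (of_int m * h))"
    and rie: "\<And>n m. even (m + int n) \<Longrightarrow>
       riemann (u (real n * \<tau>) ((of_int m - 2) * h)) (u (real n * \<tau>) (of_int m * h)) (F n m)"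
    and val: "\<And>n m t x. even (m + int n) \<Longrightarrow> t \<in> {real n * \<tau>..<(real n + 1) * \<tau>} \<Longrightarrow>
       x \<in> {(of_int m - 1) * h..<(of_int m + 1) * h} \<Longrightarrow>
       u t x = fan_value (F n m) (t - real n * \<tau>) (x - of_int m * h)"
    and smp: "\<And>n m x. even (m + int n) \<Longrightarrow> x \<in> {(of_int m - 1) * h..<(of_int m + 1) * h} \<Longrightarrow>
       u (real (Suc n) * \<tau>) x = fan_sample (F n m) (\<alpha> n)"
  shows "\<exists>chi. phase_boundary u chi \<and> (\<forall>t\<ge>0. \<forall>x. deviation (u t x) = u t x - (if x < chi t then uL else uR)) \<and>
     (\<forall>t\<ge>0. TV UNIV (\<lambda>x. deviation (u t x)) \<le> ennreal (8 * Ws * (br.Cw * b)) \<and>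
        Linf_norm UNIV (\<lambda>x. deviation (u t x)) \<le> ennreal (2 * Ws * (br.Cw * b)) \<and>
        (\<forall>t'\<ge>0. L1_norm UNIV (\<lambda>x. deviation (u t x) - deviation (u t' x))
              \<le> ennreal (16 * Ws * (br.Cw * b) * h * (\<bar>t - t'\<bar> / \<tau> + 3)) \<and>
           L1_norm UNIV (\<lambda>x. u t x - u t' x)
              \<le> ennreal ((16 * Ws * (br.Cw * b) + 2 * norm (uR - uL)) * h * (\<bar>t - t'\<bar> / \<tau> + 3))))"
proof -
  define U where "U n m = u (real n * \<tau>) (of_int m * h)" for n m
  define B where "B = br.Cw * b"
  have rieU: "riemann (U n (m - 2)) (U n m) (F n m)" if "even (m + int n)" for n m
    using rie[OF that] by (simp add: U_def)
  have good: "good b n (U n)" for n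
  proof (induction n)
    case 0
    then show ?case using g0 by (simp add: U_def[abs_def])
  next
    case (Suc n)
    have "U (Suc n) (m - 1) = fan_sample (F n m) (\<alpha> n)" if "even (m + int n)" for m
      unfolding U_def using h by (intro smp[OF that]) (auto simp: algebra_simps)
    then show ?case by (intro good_step[OF b Suc.IH rieU]) auto
  qed
  have "\<forall>n. \<exists>M PL QL PR QR s. layout (U n) M PL QL PR QR \<and> br.invariant b PL QL PR QR \<and> solves (U n) M (F n) \<and>
      boundary_fan wR (F n M) s (PL 0) (QL 0) (PR 0) (QR 0) \<and> even (M + int n)"
  proof
    fix n
    obtain M PL QL PR QR where M: "even (M + int n)" and lay: "layout (U n) M PL QL PR QR" and inv: "br.invariant b PL QL PR QR"
      using good[of n] unfolding good_def by blast
    have sol: "solves (U n) M (F n)" using solvesI[of M n "U n" "F n"] M rieU by blast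
    obtain s where "boundary_fan wR (F n M) s (PL 0) (QL 0) (PR 0) (QR 0)" by (rule fan_middle[OF lay sol])
    then show "\<exists>M PL QL PR QR s. layout (U n) M PL QL PR QR \<and> br.invariant b PL QL PR QR \<and> solves (U n) M (F n) \<and>
      boundary_fan wR (F n M) s (PL 0) (QL 0) (PR 0) (QR 0) \<and> even (M + int n)"
      using M lay inv sol by blast
  qed
  then obtain M PL QL PR QR s where A: "\<forall>n. layout (U n) (M n) (PL n) (QL n) (PR n) (QR n) \<and> br.invariant b (PL n) (QL n) (PR n) (QR n) \<and>
      solves (U n) (M n) (F n) \<and> boundary_fan wR (F n (M n)) (s n) (PL n 0) (QL n 0) (PR n 0) (QR n 0) \<and> even (M n + int n)"
    unfolding choice_iff by (elim exE)
  have lay: "layout (U n) (M n) (PL n) (QL n) (PR n) (QR n)" and inv: "br.invariant b (PL n) (QL n) (PR n) (QR n)"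
    and sol: "solves (U n) (M n) (F n)" and bf: "boundary_fan wR (F n (M n)) (s n) (PL n 0) (QL n 0) (PR n 0) (QR n 0)"
    and M: "even (M n + int n)" for n
    using A by blast+
  have par: "even (m + int n)" if "even (m - M n)" for m n
    using that M[of n] by presburger
  define N where "N t = nat \<lfloor>t / \<tau>\<rfloor>" for t
  \<comment> \<open>Affine on each time step, issued from the boundary node with the boundary speed
    of the current fan.\<close>
  define chi where "chi t = of_int (M (N t)) * h + s (N t) * (t - real (N t) * \<tau>)" for t
  have N: "real (N t) * \<tau> \<le> t" "t < (real (N t) + 1) * \<tau>" if "0 \<le> t" for t
  proof -
    have "0 \<le> t / \<tau>" using that \<tau> by simp
    then have "real (N t) \<le> t / \<tau>" "t / \<tau> < real (N t) + 1" unfolding N_def by linarith+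
    then show "real (N t) * \<tau> \<le> t" "t < (real (N t) + 1) * \<tau>"
      using \<tau> by (simp_all add: pos_le_divide_eq pos_divide_less_eq)
  qed
  have prof: "\<exists>S1 S2 S3 S4. profile_of (u t) (chi t) B S1 S2 S3 S4" if t: "0 \<le> t" for t
  proof -
    define n where "n = N t"
    have n: "real n * \<tau> \<le> t" "t < (real n + 1) * \<tau>" using N[OF t] by (auto simp: n_def)
    have t1: "0 \<le> t - real n * \<tau>" "t - real n * \<tau> < \<tau>" using n by (auto simp: distrib_right)
    have "c1 * (t - real n * \<tau>) \<le> c1 * \<tau>" using t1 c_simps(1) by (intro mult_left_mono) auto
    then have t2: "c1 * (t - real n * \<tau>) < h" using cfl by (simp add: mult.commute)
    have "profile_of (u t) (of_int (M n) * h + s n * (t - real n * \<tau>)) (br.Cw * b)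
      (push (p_out (QL n 0) (PR n 0) (QR n 0)) (PL n)) (QL n) (PR n) (push (q_out wR (QL n 0) (PR n 0)) (QR n))"
    proof (rule step_profile[OF br b inv lay sol h t1(1) t2 _ bf])
      fix m x assume "even (m - M n)" "x \<in> {(of_int m - 1) * h..<(of_int m + 1) * h}"
      then show "u t x = fan_value (F n m) (t - real n * \<tau>) (x - of_int m * h)"
        using n by (intro val par) auto
    qed
    then show ?thesis unfolding chi_def n_def[symmetric] B_def by blast
  qed
  have phase: "(x < chi t \<longrightarrow> u t x \<in> H1) \<and> (chi t \<le> x \<longrightarrow> u t x \<in> H3)"
    and dev: "deviation (u t x) = u t x - (if x < chi t then uL else uR)"
    and nb: "norm (deviation (u t x)) \<le> 2 * Ws * B"
    and tv: "TV UNIV (\<lambda>x. deviation (u t x)) \<le> ennreal (8 * Ws * B)" if t: "0 \<le> t" for t x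
  proof -
    obtain S1 S2 S3 S4 where P: "profile_of (u t) (chi t) B S1 S2 S3 S4" using prof[OF t] by blast
    show "(x < chi t \<longrightarrow> u t x \<in> H1) \<and> (chi t \<le> x \<longrightarrow> u t x \<in> H3)"
      "deviation (u t x) = u t x - (if x < chi t then uL else uR)"
      "norm (deviation (u t x)) \<le> 2 * Ws * B" "TV UNIV (\<lambda>x. deviation (u t x)) \<le> ennreal (8 * Ws * B)"
      using profile_phase[OF P] profile_bounds[OF P] by blast+
  qed
  have meas: "(\<lambda>x. deviation (u t x)) \<in> borel_measurable borel" if t: "0 \<le> t" for t
  proof -
    have "TV UNIV (\<lambda>x. deviation (u t x)) < \<infinity>" using tv[OF t] by (rule le_less_trans) simp
    from TV_finite_measurable[OF this] show ?thesis by (simp add: borel_measurable_restrict_space_iff)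
  qed
  have meas_u: "u t \<in> borel_measurable borel" if t: "0 \<le> t" for t
  proof -
    have "(\<lambda>x. deviation (u t x) + (if x < chi t then uL else uR)) \<in> borel_measurable borel"
      using meas[OF t] by measurable
    moreover have "(\<lambda>x. deviation (u t x) + (if x < chi t then uL else uR)) = u t"
      using dev[OF t] by (intro ext) simp
    ultimately show ?thesis by simp
  qed
  have W0: "0 \<le> Ws" using Ws by linarith
  have B0: "0 \<le> B" using br.invariant_bounds(6)[OF b inv[of 0], of 0] abs_ge_zero order_trans unfolding B_def by blast
  have states: "u t x \<in> fan_states (F n m) \<and> u (real n * \<tau>) x \<in> fan_states (F n m)"
    if t: "real n * \<tau> \<le> t" "t \<le> (real n + 1) * \<tau>" and e: "even (m - M n)" and x: "x \<in> {(of_int m - 1) * h..<(of_int m + 1) * h}"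
    for n t m x
  proof
    show "u t x \<in> fan_states (F n m)"
    proof (cases "t < (real n + 1) * \<tau>")
      case True
      then show ?thesis using val[OF par[OF e] _ x, of t] t fan_value_in_states by simp
    next
      \<comment> \<open>At the closed end of the step \<open>u\<close> is a sample of the same fans,
        so the change caused by sampling is included in the estimate of the step.\<close>
      case False
      then have "t = real (Suc n) * \<tau>" using t by (simp add: algebra_simps)
      then show ?thesis using smp[OF par[OF e] x] fan_sample_in_states by simp
    qed
    show "u (real n * \<tau>) x \<in> fan_states (F n m)"
      using val[OF par[OF e] _ x, of "real n * \<tau>"] \<tau> fan_value_in_states by simp
  qed
  have l1: "L1_norm UNIV (\<lambda>x. deviation (u t x) - deviation (u (real n * \<tau>) x)) \<le> ennreal (16 * Ws * B * h)"
    "L1_norm UNIV (\<lambda>x. u t x - u (real n * \<tau>) x) \<le> ennreal ((16 * Ws * B + 2 * norm (uR - uL)) * h)"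
    if t: "real n * \<tau> \<le> t" "t \<le> (real n + 1) * \<tau>" for n t
    using step_L1[where PL = "PL n" and QL = "QL n" and PR = "PR n" and QR = "QR n" and F = "F n" and M = "M n"
        and y = "u t" and y' = "u (real n * \<tau>)", OF br b inv lay sol bf h states[OF t]]
    unfolding B_def by blast+
  have c0: "0 \<le> 16 * Ws * B * h" "0 \<le> (16 * Ws * B + 2 * norm (uR - uL)) * h" using W0 B0 h by simp_all
  have "phase_boundary u chi"
    unfolding phase_boundary_def using phase by (meson less_imp_le)
  moreover have "Linf_norm UNIV (\<lambda>x. deviation (u t x)) \<le> ennreal (2 * Ws * B)" if "0 \<le> t" for t
    by (rule Linf_norm_le[OF meas[OF that] nb[OF that]])
  moreover have "L1_norm UNIV (\<lambda>x. deviation (u t x) - deviation (u t' x)) \<le> ennreal (16 * Ws * B * h * (\<bar>t - t'\<bar> / \<tau> + 3))"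
    if "0 \<le> t" "0 \<le> t'" for t t'
    by (rule L1_time_steps[where A = "\<lambda>t x. deviation (u t x)", OF \<tau> c0(1) meas l1(1) that])
  moreover have "L1_norm UNIV (\<lambda>x. u t x - u t' x) \<le> ennreal ((16 * Ws * B + 2 * norm (uR - uL)) * h * (\<bar>t - t'\<bar> / \<tau> + 3))"
    if "0 \<le> t" "0 \<le> t'" for t t'
    by (rule L1_time_steps[where A = u, OF \<tau> c0(2) meas_u l1(2) that])
  ultimately show ?thesis
    using dev tv unfolding B_def[symmetric] by (intro exI[of _ chi]) blast
qed

end

section \<open>Existence\<close>

context
  fixes K r :: real
  assumes br: "boundary_response p_out (q_out wR) eta K r ps xs ys zs"
begin

interpretation br: boundary_response p_out "q_out wR" eta K r ps xs ys zs by (rule br)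

text \<open>The factor \<open>1 + c1\<close> is the Lipschitz constant of the left invariants as
  functions of the state; the constant \<open>1 + c3\<close> on the right is smaller.\<close>

lemma initial_good:
  assumes T: "0 \<le> T" "T < 1 + snd uL" and b: "br.small ((1 + c1) * T)" and h: "0 < h"
    and L: "bv_near {..<0} fL uL T (2 * h)" "\<And>x. x < 0 \<Longrightarrow> fL x \<in> H1"
    and R: "bv_near {0<..} fR uR T (2 * h)" "\<And>x. 0 < x \<Longrightarrow> fR x \<in> H3"
    and UL: "\<And>m. even m \<Longrightarrow> m < 0 \<Longrightarrow> U m = mean (2 * h) fL (of_int m * h)"
    and UR: "\<And>m. even m \<Longrightarrow> 0 \<le> m \<Longrightarrow> U m = mean (2 * h) fR (of_int m * h)"
  shows "good K ((1 + c1) * T) 0 U"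
proof -
  interpret L: bv_near "{..<0}" fL uL T "2 * h" by (rule L)
  interpret R: bv_near "{0<..}" fR uR T "2 * h" by (rule R)
  define b where "b = (1 + c1) * T"
  note cs = c_simps(1-3)
  have b3: "(1 + c3) * T \<le> b" unfolding b_def using T cs by (intro mult_right_mono) auto
  define aL aR where "aL i = (- 2 - 2 * real i) * h" and "aR i = 2 * real i * h" for i :: nat
  have cL: "{aL i<..<aL i + 2 * h} \<subseteq> {..<0}" for i
  proof -
    have "aL i + 2 * h = - (2 * real i * h)" by (simp add: aL_def algebra_simps)
    moreover have "0 \<le> 2 * real i * h" using h by simp
    ultimately have "aL i + 2 * h \<le> 0" by linarith
    then show ?thesis by auto
  qed
  have cR: "{aR i<..<aR i + 2 * h} \<subseteq> {0<..}" for i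
  proof -
    have "0 \<le> aR i" using h by (simp add: aR_def)
    then show ?thesis by auto
  qed
  have mon: "mono aL \<or> antimono aL" "mono aR \<or> antimono aR"
  proof -
    have "antimono aL" unfolding aL_def using h by (intro antimonoI mult_right_mono) auto
    then show "mono aL \<or> antimono aL" ..
    have "mono aR" unfolding aR_def using h by (intro monoI mult_right_mono) auto
    then show "mono aR \<or> antimono aR" ..
  qed
  define sL sR where "sL i = mean (2 * h) fL (aL i)" and "sR i = mean (2 * h) fR (aR i)" for i
  have U: "U (0 - 2 - 2 * int i) = sL i" "U (0 + 2 * int i) = sR i" for i
    using UL[of "0 - 2 - 2 * int i"] UR[of "0 + 2 * int i"] by (simp_all add: sL_def sR_def aL_def aR_def)
  have nearL: "norm (sL i - uL) \<le> T" and nearR: "norm (sR i - uR) \<le> T" for i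
    unfolding sL_def sR_def by (rule L.mean_near[OF cL], rule R.mean_near[OF cR])
  have varL: "(\<Sum>i<n. norm (sL (Suc i) - sL i)) \<le> T" and varR: "(\<Sum>i<n. norm (sR (Suc i) - sR i)) \<le> T" for n
    unfolding sL_def sR_def by (rule L.mean_variation[OF cL mon(1)], rule R.mean_variation[OF cR mon(2)])
  \<comment> \<open>The strict inequality \<open>-1 < w\<close> is taken from the distance to
    \<open>uL\<close>; this is where \<open>T < 1 + snd uL\<close> enters.\<close>
  have HL: "sL i \<in> H1" for i
  proof -
    have "snd (sL i) \<le> wM" unfolding sL_def using L(2) by (intro L.snd_mean(1)[OF cL]) (auto simp: H1_iff)
    moreover have "\<bar>snd (sL i - uL)\<bar> \<le> norm (sL i - uL)" using norm_snd_le[of "snd (sL i - uL)" "fst (sL i - uL)"] unfolding prod.collapse by simp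
    ultimately show ?thesis using nearL[of i] T unfolding H1_iff by auto
  qed
  have HR: "sR i \<in> H3" for i
    unfolding H3_iff sR_def using R(2) by (intro R.snd_mean(2)[OF cR]) (auto simp: H3_iff)
  define PL QL PR QR where "PL i = fst (sL i) + c1 * snd (sL i)" and "QL i = fst (sL i) - c1 * snd (sL i)"
    and "PR i = fst (sR i) + c3 * snd (sR i)" and "QR i = fst (sR i) - c3 * snd (sR i)" for i
  have lay: "layout U 0 PL QL PR QR"
  proof (rule layoutI)
    fix i
    show "U (0 - 2 - 2 * int i) = wave_state c1 (PL i) (QL i)" "U (0 + 2 * int i) = wave_state c3 (PR i) (QR i)"
      unfolding U PL_def QL_def PR_def QR_def by (rule wave_state_of[OF c_neq(1), symmetric] wave_state_of[OF c_neq(2), symmetric])+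
    show "U (0 - 2 - 2 * int i) \<in> H1" "U (0 + 2 * int i) \<in> H3" unfolding U by (rule HL HR)+
  qed
  have var: "bv_seq s \<and> svar s \<le> b"
    if "\<And>i. \<bar>s (Suc i) - s i\<bar> \<le> (1 + c) * norm (v (Suc i) - v i)" "\<And>n. (\<Sum>i<n. norm (v (Suc i) - v i)) \<le> T" "0 \<le> c" "(1 + c) * T \<le> b"
    for s :: "nat \<Rightarrow> real" and v :: "nat \<Rightarrow> state" and c
  proof -
    have "cvar s n \<le> b" for n
    proof -
      have "cvar s n \<le> (\<Sum>i<n. (1 + c) * norm (v (Suc i) - v i))" unfolding cvar_def by (intro sum_mono that)
      also have "\<dots> = (1 + c) * (\<Sum>i<n. norm (v (Suc i) - v i))" by (rule sum_distrib_left[symmetric])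
      also have "\<dots> \<le> (1 + c) * T" using that by (intro mult_left_mono) auto
      finally show ?thesis using that by linarith
    qed
    then show ?thesis using bv_seqI by blast
  qed
  have b1: "(1 + c1) * T \<le> b" by (simp add: b_def)
  have c0: "0 \<le> c1" "0 \<le> c3" using cs by auto
  have v: "bv_seq PL \<and> svar PL \<le> b" "bv_seq QL \<and> svar QL \<le> b" "bv_seq PR \<and> svar PR \<le> b" "bv_seq QR \<and> svar QR \<le> b"
    unfolding PL_def QL_def PR_def QR_def
    by (rule var[OF riemann_invariant_dist(1)[OF c0(1)] varL c0(1) b1], rule var[OF riemann_invariant_dist(2)[OF c0(1)] varL c0(1) b1],
        rule var[OF riemann_invariant_dist(1)[OF c0(2)] varR c0(2) b3], rule var[OF riemann_invariant_dist(2)[OF c0(2)] varR c0(2) b3])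
  have n: "\<bar>PL i - ps\<bar> \<le> b" "\<bar>QL i - xs\<bar> \<le> b" "\<bar>PR i - ys\<bar> \<le> b" "\<bar>QR i - zs\<bar> \<le> b" for i
  proof -
    have m: "(1 + c1) * norm (sL i - uL) \<le> b" "(1 + c3) * norm (sR i - uR) \<le> b"
      using c0 by (auto intro!: order_trans[OF mult_left_mono[OF nearL] b1] order_trans[OF mult_left_mono[OF nearR] b3])
    show "\<bar>PL i - ps\<bar> \<le> b" "\<bar>QL i - xs\<bar> \<le> b" "\<bar>PR i - ys\<bar> \<le> b" "\<bar>QR i - zs\<bar> \<le> b"
      unfolding PL_def QL_def PR_def QR_def ps_def xs_def ys_def zs_def
      using order_trans[OF riemann_invariant_dist(1)[OF c0(1)] m(1)] order_trans[OF riemann_invariant_dist(2)[OF c0(1)] m(1)]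
        order_trans[OF riemann_invariant_dist(1)[OF c0(2)] m(2)] order_trans[OF riemann_invariant_dist(2)[OF c0(2)] m(2)] by blast+
  qed
  have "br.invariant b PL QL PR QR"
    using v n b by (intro br.invariant_initial) (auto simp: b_def)
  with lay show ?thesis unfolding good_def[OF br] b_def[symmetric] by (intro exI[of _ 0] exI) auto
qed

lemma wave_states_interior:
  assumes B: "2 * Ws * B < 1 + snd uL" "2 * Ws * B < wM - snd uL" "2 * Ws * B < snd uR - wm"
  shows "\<bar>p - ps\<bar> \<le> B \<Longrightarrow> \<bar>q - xs\<bar> \<le> B \<Longrightarrow> wave_state c1 p q \<in> H1"
    and "\<bar>p - ys\<bar> \<le> B \<Longrightarrow> \<bar>q - zs\<bar> \<le> B \<Longrightarrow> wave_state c3 p q \<in> H3"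
proof -
  have W0: "0 \<le> Ws" using Ws by linarith
  have s: "\<bar>snd u - snd u'\<bar> \<le> norm (u - u')" for u u' :: state
    using norm_snd_le[of "snd (u - u')" "fst (u - u')"] unfolding prod.collapse by simp
  { assume a: "\<bar>p - ps\<bar> \<le> B" "\<bar>q - xs\<bar> \<le> B"
    have "\<bar>snd (wave_state c1 p q) - snd uL\<bar> \<le> Ws * (\<bar>p - ps\<bar> + \<bar>q - xs\<bar>)"
      using order_trans[OF s state_dist1, of p q ps xs] uL_eq by metis
    also have "\<dots> \<le> Ws * (B + B)" using a W0 by (intro mult_left_mono add_mono) auto
    also have "\<dots> = 2 * Ws * B" by (simp add: algebra_simps)
    finally have *: "\<bar>snd (wave_state c1 p q) - snd uL\<bar> \<le> 2 * Ws * B" .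
    show "wave_state c1 p q \<in> H1" unfolding H1_iff using * B by linarith }
  { assume a: "\<bar>p - ys\<bar> \<le> B" "\<bar>q - zs\<bar> \<le> B"
    have "\<bar>snd (wave_state c3 p q) - snd uR\<bar> \<le> Ws * (\<bar>p - ys\<bar> + \<bar>q - zs\<bar>)"
      using order_trans[OF s state_dist3, of p q ys zs] uR_eq by metis
    also have "\<dots> \<le> Ws * (B + B)" using a W0 by (intro mult_left_mono add_mono) auto
    also have "\<dots> = 2 * Ws * B" by (simp add: algebra_simps)
    finally have *: "\<bar>snd (wave_state c3 p q) - snd uR\<bar> \<le> 2 * Ws * B" .
    show "wave_state c3 p q \<in> H3" unfolding H3_iff using * B by linarith }
qed

text \<open>The solver is partial: intermediate and emitted states must lie in their phases. They
  combine entries of the sequences and emitted values within \<open>Cw * b\<close> of the base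
  values, so the phases contain them once the base states have enough room around them.\<close>

lemma riemann_solvable:
  assumes b: "br.small b" and g: "good K b n U" and m: "even (m + int n)"
    and B: "2 * Ws * (br.Cw * b) < 1 + snd uL" "2 * Ws * (br.Cw * b) < wM - snd uL" "2 * Ws * (br.Cw * b) < snd uR - wm"
  shows "\<exists>F. riemann (U (m - 2)) (U m) F"
proof -
  obtain M PL QL PR QR where M: "even (M + int n)" and lay: "layout U M PL QL PR QR" and inv: "br.invariant b PL QL PR QR"
    using g unfolding good_def[OF br] by blast
  note ib = br.invariant_bounds[OF b inv]
  note int = wave_states_interior[OF B]
  have pl: "\<bar>PL i - ps\<bar> \<le> br.Cw * b" "\<bar>QR i - zs\<bar> \<le> br.Cw * b" for i using ib(5)[of "Suc i"] ib(8)[of "Suc i"] by simp_all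
  have UL: "U (M - 2 - 2 * int i) = wave_state c1 (PL i) (QL i)" and UR: "U (M + 2 * int i) = wave_state c3 (PR i) (QR i)"
    and HL: "wave_state c1 (PL i) (QL i) \<in> H1" and HR: "wave_state c3 (PR i) (QR i) \<in> H3" for i
    using lay unfolding layout_def by blast+
  have "even (m - M)" using m M by presburger
  then obtain k where k: "m = M + 2 * k" by (metis dvd_def add.commute diff_add_cancel)
  show ?thesis
  proof (cases k rule: int_sign_cases)
    case (neg i)
    then have e: "m = M - 2 - 2 * int i" "m - 2 = M - 2 - 2 * int (Suc i)" using k by simp_all
    show ?thesis unfolding e(2) unfolding e(1) UL
      by (rule exI, rule riemann_phase1I[OF HL HL]) (intro int pl ib)
  next
    case (pos i)
    then have e: "m = M + 2 * int (Suc i)" "m - 2 = M + 2 * int i" using k by simp_all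
    show ?thesis unfolding e(2) unfolding e(1) UR
      by (rule exI, rule riemann_phase3I[OF HR HR]) (intro int pl ib)
  next
    case mid
    then have e: "m = M + 2 * int 0" "m - 2 = M - 2 - 2 * int 0" using k by simp_all
    have o1: "wave_state c1 (p_out (QL 0) (PR 0) (QR 0)) (QL 0) \<in> H1"
      using ib(5)[of 0] ib(6)[of 0] by (intro int(1)) simp_all
    have o2: "wave_state c3 (PR 0) (q_out wR (QL 0) (PR 0)) \<in> H3"
      using ib(7)[of 0] ib(8)[of 0] by (intro int(2)) simp_all
    show ?thesis unfolding e(2) unfolding e(1) UL UR
      using kinetic_boundary_exists[OF HL HR _ o1 o2] supersonic_exists[OF HL HR _ o1]
      by (cases "0 < h_in (QL 0) (PR 0)") auto
  qed
qed

lemma scheme_exists: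
  assumes b: "br.small b" and \<tau>: "0 < \<tau>" and h: "0 < h" and a: "\<And>n. 1 \<le> n \<Longrightarrow> a n \<in> {-1<..<1}"
    and g0: "good K b 0 U0"
    and U0: "\<And>m. even m \<Longrightarrow> (1 / (2 * h)) *\<^sub>R (LINT y:{of_int m * h..<(of_int m + 2) * h}|lborel. u0 y) = U0 m"
    and B: "2 * Ws * (br.Cw * b) < 1 + snd uL" "2 * Ws * (br.Cw * b) < wM - snd uL" "2 * Ws * (br.Cw * b) < snd uR - wm"
  shows "\<exists>u. glimm_approximation \<tau> h a u0 u"
proof -
  \<comment> \<open>The mesh is staggered: the cell with left end \<open>m\<close> at step
    \<open>n + 1\<close> is sampled from the fan at node \<open>m + 1\<close>, whose data are the
    entries \<open>m - 1\<close> and \<open>m + 1\<close> of step \<open>n\<close>. Entries of the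
    wrong parity are arbitrary.\<close>
  define U where "U = rec_nat U0 (\<lambda>n W m. fan_sample (SOME F. riemann (W (m - 1)) (W (m + 1)) F) (a (Suc n) * h / \<tau>))"
  define F where "F n m = (SOME F. riemann (U n (m - 2)) (U n m) F)" for n m
  have U_0: "U 0 = U0" and U_Suc: "U (Suc n) (m - 1) = fan_sample (F n m) (a (Suc n) * h / \<tau>)" for n m
    by (simp_all add: U_def F_def)
  have rF: "riemann (U n (m - 2)) (U n m) (F n m)" if "good K b n (U n)" "even (m + int n)" for n m
    unfolding F_def by (rule someI_ex[OF riemann_solvable[OF b that B]])
  have good: "good K b n (U n)" for n
  proof (induction n)
    case 0 then show ?case using g0 by (simp add: U_0)
  next
    case (Suc n)
    show ?case by (rule good_step[OF br b Suc.IH rF[OF Suc.IH] U_Suc])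
  qed
  have rie: "riemann (U n (m - 2)) (U n m) (F n m)" if "even (m + int n)" for n m using rF[OF good that] .
  define N where "N t = nat \<lfloor>t / \<tau>\<rfloor>" for t
  define cell where "cell n x = (SOME m::int. even (m + int n) \<and> x \<in> {(of_int m - 1) * h..<(of_int m + 1) * h})" for n :: nat and x
  define u where "u t x = (let n = N t; m = cell n x in fan_value (F n m) (t - real n * \<tau>) (x - of_int m * h))" for t x
  have cell_eq: "cell n x = m" if m: "even (m + int n)" "x \<in> {(of_int m - 1) * h..<(of_int m + 1) * h}" for n x m
    unfolding cell_def
  proof (rule some_equality)
    fix m' :: int assume m': "even (m' + int n) \<and> x \<in> {(of_int m' - 1) * h..<(of_int m' + 1) * h}"
    have "(of_int m - 1) * h < (of_int m' + 1) * h" "(of_int m' - 1) * h < (of_int m + 1) * h" using m m' by auto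
    then have "of_int m - 1 < (of_int m' + 1 :: real)" "of_int m' - 1 < (of_int m + 1 :: real)"
      using h by (simp_all only: mult_less_cancel_right_pos)
    then have "m < m' + 2" "m' < m + 2" by linarith+
    moreover have "even (m - m')" using m(1) conjunct1[OF m'] by presburger
    ultimately show "m' = m" by presburger
  qed (use m in simp)
  have N_eq: "N t = n" if "t \<in> {real n * \<tau>..<(real n + 1) * \<tau>}" for t n
  proof -
    have "real n \<le> t / \<tau>" "t / \<tau> < real n + 1" using that \<tau> by (simp_all add: pos_le_divide_eq pos_divide_less_eq)
    then have "\<lfloor>t / \<tau>\<rfloor> = int n" by (intro floor_unique) auto
    then show ?thesis by (simp add: N_def)
  qed
  have val: "u t x = fan_value (F n m) (t - real n * \<tau>) (x - of_int m * h)"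
    if "even (m + int n)" "t \<in> {real n * \<tau>..<(real n + 1) * \<tau>}" "x \<in> {(of_int m - 1) * h..<(of_int m + 1) * h}" for n m t x
    unfolding u_def using N_eq[OF that(2)] cell_eq[OF that(1,3)] by simp
  have grid: "u (real n * \<tau>) x = U n m" if e: "even (m + int n)" and x: "x \<in> {of_int m * h..<(of_int m + 2) * h}" for n m x
  proof -
    have t: "real n * \<tau> \<in> {real n * \<tau>..<(real n + 1) * \<tau>}" using \<tau> by simp
    show ?thesis
    proof (cases "x < (of_int m + 1) * h")
      case True
      have "x \<in> {(of_int m - 1) * h..<(of_int m + 1) * h}" using x True h by (auto simp: left_diff_distrib)
      from val[OF e t this] have "u (real n * \<tau>) x = fan_value (F n m) 0 (x - of_int m * h)" by simp
      also have "\<dots> = U n m" using x riemann_ends(2)[OF rie[OF e]] by (subst fan_value_0) simp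
      finally show ?thesis .
    next
      \<comment> \<open>The right half of the cell belongs to the fan at the next node, whose left
        state it is.\<close>
      case False
      have e2: "even ((m + 2) + int n)" using e by simp
      have "x \<in> {(of_int (m + 2) - 1) * h..<(of_int (m + 2) + 1) * h}" using x False h by (auto simp: algebra_simps)
      from val[OF e2 t this] have "u (real n * \<tau>) x = fan_value (F n (m + 2)) 0 (x - of_int (m + 2) * h)" by simp
      also have "\<dots> = U n m" using x riemann_ends(1)[OF rie[OF e2]] by (subst fan_value_0) (simp add: algebra_simps)
      finally show ?thesis .
    qed
  qed
  have "glimm_approximation \<tau> h a u0 u"
    unfolding glimm_approximation_def
  proof (intro conjI allI impI ballI)
    fix m :: int and x assume "even m" "x \<in> {of_int m * h..<(of_int m + 2) * h}"
    then show "u 0 x = (1 / (2 * h)) *\<^sub>R (LINT y:{of_int m * h..<(of_int m + 2) * h}|lborel. u0 y)"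
      using grid[of m 0 x] U0[of m] by (simp add: U_0)
  next
    fix n :: nat and m :: int and x
    assume n: "1 \<le> n" and e: "even (m + int n)" and x: "x \<in> {of_int m * h..<(of_int m + 2) * h}"
    obtain k where k: "n = Suc k" using n by (cases n) auto
    have e': "even ((m + 1) + int k)" using e k by simp
    have "Lim (at_left (of_int (m + 1) * h + a n * h)) (\<lambda>y. Lim (at_left (real k * \<tau> + \<tau>)) (\<lambda>t. u t y)) = fan_sample (F k (m + 1)) (a n * h / \<tau>)"
    proof (rule fan_sample_limit[OF \<tau>])
      show "a n * h \<in> {- h<..<h}"
        using a[OF n] h mult_strict_right_mono[of "-1" "a n" h] mult_strict_right_mono[of "a n" 1 h] by auto
      fix t y assume "0 \<le> t" "t < \<tau>" "y \<in> {- h<..<h}"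
      then show "u (real k * \<tau> + t) (of_int (m + 1) * h + y) = fan_value (F k (m + 1)) t y"
        using val[OF e', of "real k * \<tau> + t" "of_int (m + 1) * h + y"] by (auto simp: algebra_simps)
    qed
    also have "\<dots> = U n m" using U_Suc[of k "m + 1"] by (simp add: k)
    finally have "Lim (at_left (of_int (m + 1) * h + a n * h)) (\<lambda>y. Lim (at_left (real k * \<tau> + \<tau>)) (\<lambda>t. u t y)) = U n m" .
    moreover have "of_int (m + 1) * h + a n * h = (of_int m + 1 + a n) * h" "real k * \<tau> + \<tau> = real n * \<tau>"
      by (simp_all add: k algebra_simps)
    ultimately show "u (real n * \<tau>) x = Lim (at_left ((of_int m + 1 + a n) * h)) (\<lambda>y. Lim (at_left (real n * \<tau>)) (\<lambda>t. u t y))"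
      using grid[OF e x] by simp
  next
    fix n :: nat and m :: int assume e: "even (m + int n)"
    have e2: "even ((m - 2) + int n)" using e by simp
    have "u (real n * \<tau>) ((of_int m - 1) * h) = U n (m - 2)"
      using h by (intro grid[OF e2]) (auto simp: algebra_simps)
    moreover have "u (real n * \<tau>) (of_int m * h) = U n m"
      using h by (intro grid[OF e]) (auto simp: algebra_simps)
    ultimately show "\<exists>F. riemann (u (real n * \<tau>) ((of_int m - 1) * h)) (u (real n * \<tau>) (of_int m * h)) F \<and>
        (\<forall>t\<in>{real n * \<tau>..<(real n + 1) * \<tau>}. \<forall>x\<in>{(of_int m - 1) * h..<(of_int m + 1) * h}.
           u t x = fan_value F (t - real n * \<tau>) (x - of_int m * h))"
      using rie[OF e] val[OF e] by (intro exI[of _ "F n m"]) auto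
  qed
  then show ?thesis by blast
qed

end

end

section \<open>From the initial data to the final constants\<close>

lemma initial_averages:
  assumes h: "0 < h"
    and L: "bv_near {..<0} fL uL T (2 * h)" and R: "bv_near {0<..} fR uR T (2 * h)"
    and m: "even m"
  shows "(1 / (2 * h)) *\<^sub>R (LINT y:{of_int m * h..<(of_int m + 2) * h}|lborel. if y < 0 then fL y else fR y)
      = (if m < 0 then mean (2 * h) fL (of_int m * h) else mean (2 * h) fR (of_int m * h))"
proof -
  let ?u = "\<lambda>y. if y < 0 then fL y else fR y" and ?c = "of_int m * h"
  have e: "(of_int m + 2) * h = ?c + 2 * h" by (simp add: distrib_right)
  have "\<exists>f. set_integrable lborel {?c<..<?c + 2 * h} f \<and> (\<forall>y\<in>{?c<..<?c + 2 * h}. ?u y = f y)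
      \<and> f = (if m < 0 then fL else fR)"
  proof (cases "m < 0")
    case True
    \<comment> \<open>As \<open>m\<close> is even, no cell contains \<open>0\<close> in its
      interior.\<close>
    then have "m \<le> - 2" using m by presburger
    then have "of_int m \<le> (- 2 :: real)" by linarith
    then have "?c \<le> - 2 * h" using h by (intro mult_right_mono) auto
    then have s: "{?c<..<?c + 2 * h} \<subseteq> {..<0}" by auto
    show ?thesis using bv_near.integrable_cell[OF L s] s True by (intro exI[of _ fL]) auto
  next
    case False
    then have "0 \<le> ?c" using h by simp
    then have s: "{?c<..<?c + 2 * h} \<subseteq> {0<..}" by auto
    show ?thesis using bv_near.integrable_cell[OF R s] s False by (intro exI[of _ fR]) auto
  qed
  then obtain f where f: "set_integrable lborel {?c<..<?c + 2 * h} f" "\<forall>y\<in>{?c<..<?c + 2 * h}. ?u y = f y"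
    "f = (if m < 0 then fL else fR)" by blast
  have i: "set_integrable lborel {?c<..<?c + 2 * h} ?u"
    using f(1) by (rule set_integrable_cong[THEN iffD1, OF refl refl, rotated]) (use f(2) in auto)
  have "mean (2 * h) ?u ?c = (1 / (2 * h)) *\<^sub>R (LINT y:{?c..<?c + 2 * h}|lborel. ?u y)"
    using h by (intro mean_half_open[OF i]) auto
  moreover have "mean (2 * h) ?u ?c = mean (2 * h) f ?c" using f(2) by (intro mean_cong) blast
  ultimately show ?thesis unfolding e using f(3) by (cases "m < 0") simp_all
qed

lemma ennreal_bound_mono:
  assumes "x \<le> ennreal c" "c \<le> C * T" "ennreal T \<le> N" "0 \<le> C" "0 \<le> T"
  shows "x \<le> ennreal C * N"
proof -
  have "x \<le> ennreal (C * T)" using assms(1,2) by (meson ennreal_leI order_trans)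
  also have "\<dots> = ennreal C * ennreal T" using assms by (simp add: ennreal_mult)
  also have "\<dots> \<le> ennreal C * N" using assms by (intro mult_left_mono) auto
  finally show ?thesis .
qed

text \<open>A moving boundary alone changes \<open>u\<close> in L1 by \<open>norm (uR - uL)\<close>
  times the distance travelled. The time estimate with \<open>N1\<close> is therefore that of
  \<open>u - u'\<close>, and the one for \<open>u\<close> itself carries the extra term. Existence
  is asserted for base strains away from \<open>wM\<close> and \<open>wm\<close>, since the solver
  admits only states inside the phases.\<close>

theorem theorem3p1:
  fixes k1 k3 wM wm :: real and \<phi> :: "real \<Rightarrow> real"
    and uL uR :: state and V \<Lambda> :: real
  assumes "0 < k3" "k3 < k1" "0 < wM" "wM < wm"
    and "phase_model.entropy_dissipation k1 k3 wM wm \<phi>"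
    and "uL \<in> phase_model.H1 wM" "uR \<in> phase_model.H3 wm"
    and "phase_model.single_phase_boundary k1 k3 wM wm \<phi> uL uR V"
    and "V = sqrt k3 \<Longrightarrow> snd uL = 0"
    and "V = sqrt k3 \<Longrightarrow>
      \<exists>D. (\<phi> has_real_derivative D) (at_left (sqrt k3)) \<and> snd uR = sqrt (D / sqrt k3)"
  shows "\<exists>\<delta>>0. \<exists>C\<ge>0.
    \<forall>uL0 \<in> BV_loc {..<0} (phase_model.H1 wM). \<forall>uR0 \<in> BV_loc {0<..} (phase_model.H3 wm).
    BV_norm {..<0} (\<lambda>x. uL0 x - uL) + BV_norm {0<..} (\<lambda>x. uR0 x - uR) \<le> ennreal \<delta> \<longrightarrow>
    (\<forall>\<tau> h a. 0 < \<tau> \<and> 0 < h \<and> h / \<tau> = \<Lambda> \<and> \<tau> * sqrt k1 < h \<and> equidistributed a \<longrightarrow>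
      (let u0 = (\<lambda>x. if x < 0 then uL0 x else uR0 x);
           N2 = Linf_norm {..<0} (\<lambda>x. uL0 x - uL) + Linf_norm {0<..} (\<lambda>x. uR0 x - uR);
           N1 = TV {..<0} uL0 + TV {0<..} uR0 + (if V = sqrt k3 then N2 else 0)
       in (snd uL < wM \<and> wm < snd uR \<longrightarrow>
            (\<exists>u. phase_model.glimm_approximation k1 k3 wM wm \<phi> \<tau> h a u0 u)) \<and>
          (\<forall>u. phase_model.glimm_approximation k1 k3 wM wm \<phi> \<tau> h a u0 u \<longrightarrow>
            (\<exists>chi. phase_model.phase_boundary wM wm u chi \<and>
              (let u' = (\<lambda>t x. if x < chi t then uL else uR) in
                \<forall>t\<ge>0. \<forall>t'\<ge>0.
                  TV UNIV (\<lambda>x. u t x - u' t x) \<le> ennreal C * N1 \<and>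
                  Linf_norm UNIV (\<lambda>x. u t x - u' t x) \<le> ennreal C * (N1 + N2) \<and>
                  L1_norm UNIV (\<lambda>x. (u t x - u' t x) - (u t' x - u' t' x))
                    \<le> ennreal C * N1 * ennreal (\<bar>t - t'\<bar> + h) \<and>
                  L1_norm UNIV (\<lambda>x. u t x - u t' x)
                    \<le> ennreal C * (N1 + ennreal (norm (uR - uL))) * ennreal (\<bar>t - t'\<bar> + h))))))"
proof -
  interpret base_states k1 k3 wM wm \<phi> uL uR V
    by unfold_locales (use assms in auto)
  show ?thesis
  proof (rule boundary_response_exists)
    fix K r assume br: "boundary_response p_out (q_out wR) eta K r ps xs ys zs"
    interpret br: boundary_response p_out "q_out wR" eta K r ps xs ys zs by (rule br)
    note cs = c_simps(1-3)
    have K: "1 \<le> K" "0 < r" by (rule br.K br.r)+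
    have W0: "1 \<le> Ws" by (rule Ws)
    have Cw: "0 \<le> br.Cw" using K by (simp add: br.Cw_def)
    define b0 where "b0 = min (r / (2 * K)) (1 / (2 + 4 * K))"
    \<comment> \<open>The room around the base states. The distance to \<open>w = -1\<close> is
      always positive; the other two enter if the base strains differ from \<open>wM\<close> and
      \<open>wm\<close>, and \<open>1\<close> is a neutral default.\<close>
    define \<mu> where "\<mu> = min (1 + snd uL) (if snd uL < wM \<and> wm < snd uR then min (wM - snd uL) (snd uR - wm) else 1)"
    define D where "D = 2 * Ws * (br.Cw * (1 + c1))"
    \<comment> \<open>The first bound makes \<open>b = (1 + c1) * T\<close> satisfy
      \<open>small\<close>; the second keeps both \<open>T\<close> and the deviation bound
      \<open>D * T\<close> below \<open>\<mu>\<close>.\<close>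
    define \<delta> where "\<delta> = min (b0 / (1 + c1)) (\<mu> / (2 * (1 + D)))"
    \<comment> \<open>\<open>3 + \<bar>\<Lambda>\<bar>\<close> converts the number of time steps
      into time, since \<open>h * (\<bar>t - t'\<bar> / \<tau> + 3) = \<Lambda> * \<bar>t - t'\<bar>
      + 3 * h\<close>; the summand \<open>2\<close> serves the jump
      \<open>norm (uR - uL)\<close>.\<close>
    define C where "C = (16 * Ws * (br.Cw * (1 + c1)) + 2) * (3 + \<bar>\<Lambda>\<bar>)"
    have b0: "0 < b0" using K by (simp add: b0_def)
    have \<mu>: "0 < \<mu>" using uL_H1 by (simp add: \<mu>_def H1_iff)
    have D0: "0 \<le> D" using W0 Cw cs by (simp add: D_def)
    have \<delta>: "0 < \<delta>" using b0 \<mu> D0 cs by (simp add: \<delta>_def)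
    have G0: "0 \<le> 16 * Ws * (br.Cw * (1 + c1))" using W0 Cw cs by simp
    have C0: "0 \<le> C" using G0 by (simp add: C_def)
    show ?thesis
    proof (rule exI[of _ \<delta>], rule conjI[OF \<delta>], rule exI[of _ C], rule conjI[OF C0], intro ballI impI allI)
      fix uL0 uR0 \<tau> h a
      assume uL0: "uL0 \<in> BV_loc {..<0} H1" and uR0: "uR0 \<in> BV_loc {0<..} H3"
        and small: "BV_norm {..<0} (\<lambda>x. uL0 x - uL) + BV_norm {0<..} (\<lambda>x. uR0 x - uR) \<le> ennreal \<delta>"
        and mesh: "0 < \<tau> \<and> 0 < h \<and> h / \<tau> = \<Lambda> \<and> \<tau> * sqrt k1 < h \<and> equidistributed a"
      have \<tau>: "0 < \<tau>" and h: "0 < h" and \<Lambda>: "h / \<tau> = \<Lambda>" and cfl: "\<tau> * c1 < h" using mesh by auto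
      have a: "a n \<in> {-1<..<1}" if "1 \<le> n" for n using mesh that unfolding equidistributed_def by blast
      define N2 where "N2 = Linf_norm {..<0} (\<lambda>x. uL0 x - uL) + Linf_norm {0<..} (\<lambda>x. uR0 x - uR)"
      define N1 where "N1 = TV {..<0} uL0 + TV {0<..} uR0 + (if V = sqrt k3 then N2 else 0)"
      define u0 where "u0 = (\<lambda>x. if x < 0 then uL0 x else uR0 x)"
      define Te where "Te = TV {..<0} uL0 + TV {0<..} uR0"
      have "Te \<le> BV_norm {..<0} (\<lambda>x. uL0 x - uL) + BV_norm {0<..} (\<lambda>x. uR0 x - uR)"
        unfolding Te_def BV_norm_def TV_diff_const by (intro add_mono) (simp_all add: add_increasing)
      then have Te: "Te \<le> ennreal \<delta>" using small by (rule order_trans)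
      \<comment> \<open>The total variation of the data. As the L1 norms are finite it also bounds
        the distance to the base states, and it is at most \<open>N1\<close> in either case of the
        definition of \<open>N1\<close>.\<close>
      define T where "T = enn2real Te"
      have TeT: "Te = ennreal T" unfolding T_def using Te by (intro ennreal_enn2real[symmetric]) (auto intro: le_less_trans)
      have T: "0 \<le> T" "T \<le> \<delta>" using Te \<delta> unfolding TeT by (auto simp: T_def ennreal_le_iff)
      have TL: "TV {..<0} uL0 \<le> ennreal T" and TR: "TV {0<..} uR0 \<le> ennreal T"
        unfolding TeT[symmetric] Te_def by (simp_all add: add_increasing add_increasing2)
      have "L1_norm {..<0} (\<lambda>x. uL0 x - uL) \<le> ennreal \<delta>" "L1_norm {0<..} (\<lambda>x. uR0 x - uR) \<le> ennreal \<delta>"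
        by (rule order_trans[OF _ small], simp add: BV_norm_def add_increasing2 add_increasing add.assoc)+
      then have fin: "L1_norm {..<0} (\<lambda>x. uL0 x - uL) < \<infinity>" "L1_norm {0<..} (\<lambda>x. uR0 x - uR) < \<infinity>"
        by (auto intro: le_less_trans)
      have L: "bv_near {..<0} uL0 uL T (2 * h)"
        using TV_sup_bound[OF fin(1) TL T(1) _ emeasure_lborel_half_line(2)] TL T h by unfold_locales auto
      have R: "bv_near {0<..} uR0 uR T (2 * h)"
        using TV_sup_bound[OF fin(2) TR T(1) _ emeasure_lborel_half_line(1)] TR T h by unfold_locales auto
      define b where "b = (1 + c1) * T"
      have "T \<le> b0 / (1 + c1)" "T \<le> \<mu> / (2 * (1 + D))" using T by (auto simp: \<delta>_def)
      then have bb: "b \<le> b0" and TD: "T * (2 * (1 + D)) \<le> \<mu>"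
        unfolding b_def using cs D0 by (simp_all add: pos_le_divide_eq mult.commute)
      have sm: "br.small b"
      proof -
        have "b \<le> r / (2 * K)" "b \<le> 1 / (2 + 4 * K)" using bb by (auto simp: b0_def)
        then have "b * (2 * K) \<le> r" "b * (2 + 4 * K) \<le> 1" using K by (simp_all add: pos_le_divide_eq)
        moreover have "0 \<le> b" using T cs by (simp add: b_def)
        ultimately show ?thesis unfolding br.small_def by (simp add: mult.commute)
      qed
      have TDe: "2 * T + 2 * (D * T) \<le> \<mu>" using TD by (simp add: algebra_simps)
      have DT: "0 \<le> D * T" using D0 T by simp
      have T1: "T < 1 + snd uL" and margin: "2 * Ws * (br.Cw * b) < \<mu>"
      proof -
        have "T < \<mu>" "D * T < \<mu>" using TDe DT T \<mu> by linarith+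
        moreover have "\<mu> \<le> 1 + snd uL" by (simp add: \<mu>_def)
        moreover have "2 * Ws * (br.Cw * b) = D * T" by (simp add: D_def b_def)
        ultimately show "T < 1 + snd uL" "2 * Ws * (br.Cw * b) < \<mu>" by linarith+
      qed
      define U0 where "U0 m = (if m < 0 then mean (2 * h) uL0 (of_int m * h) else mean (2 * h) uR0 (of_int m * h))" for m :: int
      have avg: "(1 / (2 * h)) *\<^sub>R (LINT y:{of_int m * h..<(of_int m + 2) * h}|lborel. u0 y) = U0 m" if "even m" for m
        unfolding u0_def U0_def by (rule initial_averages[OF h L R that])
      have inL: "uL0 x \<in> H1" if "x < 0" for x using uL0 that by (auto simp: BV_loc_def)
      have inR: "uR0 x \<in> H3" if "0 < x" for x using uR0 that by (auto simp: BV_loc_def)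
      have good0: "good K b 0 U" if "\<And>m. even m \<Longrightarrow> U m = U0 m" for U
        unfolding b_def using that
        by (intro initial_good[OF br T(1) T1 sm[unfolded b_def] h L inL R inR]) (simp_all add: U0_def)
      have N1: "ennreal T \<le> N1" unfolding TeT[symmetric] Te_def N1_def by (simp add: add_increasing2)
      have ex: "\<exists>u. glimm_approximation \<tau> h a u0 u" if i: "snd uL < wM \<and> wm < snd uR"
      proof (rule scheme_exists[OF br sm \<tau> h a good0 avg])
        have "\<mu> \<le> 1 + snd uL" "\<mu> \<le> wM - snd uL" "\<mu> \<le> snd uR - wm" using i by (auto simp: \<mu>_def)
        then show "2 * Ws * (br.Cw * b) < 1 + snd uL" "2 * Ws * (br.Cw * b) < wM - snd uL" "2 * Ws * (br.Cw * b) < snd uR - wm"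
          using margin by linarith+
      qed auto
      define G where "G = 16 * Ws * (br.Cw * b)"
      have G: "G = 16 * Ws * (br.Cw * (1 + c1)) * T" by (simp add: G_def b_def)
      have Gn: "0 \<le> G" using G0 T by (simp add: G)
      have CT: "G * (3 + \<bar>\<Lambda>\<bar>) \<le> C * T"
        using T by (simp add: C_def G distrib_right)
      have GC: "G \<le> C * T"
        using CT mult_left_mono[of 1 "3 + \<bar>\<Lambda>\<bar>" G] Gn by linarith
      have C8: "8 * Ws * (br.Cw * b) \<le> C * T" and C2: "2 * Ws * (br.Cw * b) \<le> C * T"
      proof -
        define E where "E = Ws * (br.Cw * b)"
        have "G = 16 * E" "8 * Ws * (br.Cw * b) = 8 * E" "2 * Ws * (br.Cw * b) = 2 * E"
          by (simp_all add: G_def E_def)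
        then show "8 * Ws * (br.Cw * b) \<le> C * T" "2 * Ws * (br.Cw * b) \<le> C * T"
          using GC Gn by linarith+
      qed
      have est: "\<exists>chi. phase_boundary u chi \<and>
              (\<forall>t\<ge>0. \<forall>t'\<ge>0.
                  TV UNIV (\<lambda>x. u t x - (if x < chi t then uL else uR)) \<le> ennreal C * N1 \<and>
                  Linf_norm UNIV (\<lambda>x. u t x - (if x < chi t then uL else uR)) \<le> ennreal C * (N1 + N2) \<and>
                  L1_norm UNIV (\<lambda>x. (u t x - (if x < chi t then uL else uR)) - (u t' x - (if x < chi t' then uL else uR)))
                    \<le> ennreal C * N1 * ennreal (\<bar>t - t'\<bar> + h) \<and>
                  L1_norm UNIV (\<lambda>x. u t x - u t' x)
                    \<le> ennreal C * (N1 + ennreal (norm (uR - uL))) * ennreal (\<bar>t - t'\<bar> + h))"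
        if ga: "glimm_approximation \<tau> h a u0 u" for u
      proof (rule glimm_cells[OF ga \<tau> h a])
        fix F
        assume rie: "\<And>n m. even (m + int n) \<Longrightarrow>
           riemann (u (real n * \<tau>) ((of_int m - 2) * h)) (u (real n * \<tau>) (of_int m * h)) (F n m)"
          and val: "\<And>n m t x. even (m + int n) \<Longrightarrow> t \<in> {real n * \<tau>..<(real n + 1) * \<tau>} \<Longrightarrow>
           x \<in> {(of_int m - 1) * h..<(of_int m + 1) * h} \<Longrightarrow>
           u t x = fan_value (F n m) (t - real n * \<tau>) (x - of_int m * h)"
          and smp: "\<And>n m x. even (m + int n) \<Longrightarrow> x \<in> {(of_int m - 1) * h..<(of_int m + 1) * h} \<Longrightarrow>
           u (real (Suc n) * \<tau>) x = fan_sample (F n m) (a (Suc n) * h / \<tau>)"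
        have g0: "good K b 0 (\<lambda>m. u 0 (of_int m * h))"
        proof (rule good0)
          fix m :: int assume m: "even m"
          have "\<forall>x\<in>{of_int m * h..<(of_int m + 2) * h}.
             u 0 x = (1 / (2 * h)) *\<^sub>R (LINT y:{of_int m * h..<(of_int m + 2) * h}|lborel. u0 y)"
            using ga m unfolding glimm_approximation_def by blast
          moreover have "of_int m * h \<in> {of_int m * h..<(of_int m + 2) * h}" using h by simp
          ultimately show "u 0 (of_int m * h) = U0 m" using avg[OF m] by metis
        qed
        obtain chi where chi: "phase_boundary u chi"
          and dev: "\<forall>t\<ge>0. \<forall>x. deviation (u t x) = u t x - (if x < chi t then uL else uR)"
          and bd: "\<forall>t\<ge>0. TV UNIV (\<lambda>x. deviation (u t x)) \<le> ennreal (8 * Ws * (br.Cw * b)) \<and>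
            Linf_norm UNIV (\<lambda>x. deviation (u t x)) \<le> ennreal (2 * Ws * (br.Cw * b)) \<and>
            (\<forall>t'\<ge>0. L1_norm UNIV (\<lambda>x. deviation (u t x) - deviation (u t' x))
              \<le> ennreal (16 * Ws * (br.Cw * b) * h * (\<bar>t - t'\<bar> / \<tau> + 3)) \<and>
             L1_norm UNIV (\<lambda>x. u t x - u t' x)
              \<le> ennreal ((16 * Ws * (br.Cw * b) + 2 * norm (uR - uL)) * h * (\<bar>t - t'\<bar> / \<tau> + 3)))"
          using scheme_estimates[OF br sm \<tau> h cfl g0 rie val smp] by blast
        show ?thesis
        proof (intro exI[of _ chi] conjI chi allI impI)
          fix t t' :: real assume t: "0 \<le> t" "0 \<le> t'"
          have d: "(\<lambda>x. u t x - (if x < chi t then uL else uR)) = (\<lambda>x. deviation (u t x))" if "0 \<le> t" for t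
            using dev that by simp
          have d2: "(\<lambda>x. (u t x - (if x < chi t then uL else uR)) - (u t' x - (if x < chi t' then uL else uR)))
             = (\<lambda>x. deviation (u t x) - deviation (u t' x))" using dev t by simp
          have time: "h * (\<bar>t - t'\<bar> / \<tau> + 3) \<le> (3 + \<bar>\<Lambda>\<bar>) * (\<bar>t - t'\<bar> + h)"
          proof -
            have "h * (\<bar>t - t'\<bar> / \<tau> + 3) = \<Lambda> * \<bar>t - t'\<bar> + 3 * h"
              unfolding \<Lambda>[symmetric] by (simp add: algebra_simps)
            also have "\<dots> \<le> (3 + \<bar>\<Lambda>\<bar>) * \<bar>t - t'\<bar> + (3 + \<bar>\<Lambda>\<bar>) * h"
              using h by (intro add_mono mult_right_mono) auto
            finally show ?thesis by (simp add: distrib_left)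
          qed
          have sc: "A * h * (\<bar>t - t'\<bar> / \<tau> + 3) \<le> A * (3 + \<bar>\<Lambda>\<bar>) * (\<bar>t - t'\<bar> + h)" if "0 \<le> A" for A
            using mult_left_mono[OF time that] by (simp add: mult.assoc)
          have th: "0 \<le> \<bar>t - t'\<bar> + h" using h by simp
          show "TV UNIV (\<lambda>x. u t x - (if x < chi t then uL else uR)) \<le> ennreal C * N1"
            unfolding d[OF t(1)] using bd t C8 N1 C0 T
            by (intro ennreal_bound_mono[of _ "8 * Ws * (br.Cw * b)" C T]) blast+
          have "ennreal T \<le> N1 + N2" using N1 by (simp add: add_increasing2)
          then show "Linf_norm UNIV (\<lambda>x. u t x - (if x < chi t then uL else uR)) \<le> ennreal C * (N1 + N2)"
            unfolding d[OF t(1)] using bd t C2 C0 T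
            by (intro ennreal_bound_mono[of _ "2 * Ws * (br.Cw * b)" C T]) blast+
          have "L1_norm UNIV (\<lambda>x. deviation (u t x) - deviation (u t' x)) \<le> ennreal (G * h * (\<bar>t - t'\<bar> / \<tau> + 3))"
            using bd t unfolding G_def by blast
          also have "\<dots> \<le> ennreal (C * T * (\<bar>t - t'\<bar> + h))"
            using sc[OF Gn] mult_right_mono[OF CT th] by (intro ennreal_leI) linarith
          also have "\<dots> = ennreal (C * T) * ennreal (\<bar>t - t'\<bar> + h)" using C0 T th by (simp add: ennreal_mult)
          also have "\<dots> \<le> ennreal C * N1 * ennreal (\<bar>t - t'\<bar> + h)"
            using N1 C0 T by (intro mult_right_mono ennreal_bound_mono[of _ "C * T" C T]) auto
          finally show "L1_norm UNIV (\<lambda>x. (u t x - (if x < chi t then uL else uR)) - (u t' x - (if x < chi t' then uL else uR)))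
              \<le> ennreal C * N1 * ennreal (\<bar>t - t'\<bar> + h)" unfolding d2 .
          define nu where "nu = norm (uR - uL)"
          have nu: "0 \<le> nu" by (simp add: nu_def)
          have "L1_norm UNIV (\<lambda>x. u t x - u t' x) \<le> ennreal ((G + 2 * nu) * h * (\<bar>t - t'\<bar> / \<tau> + 3))"
            using bd t unfolding G_def nu_def by blast
          also have "\<dots> \<le> ennreal (C * (T + nu) * (\<bar>t - t'\<bar> + h))"
          proof (intro ennreal_leI)
            have "2 * nu * (3 + \<bar>\<Lambda>\<bar>) \<le> C * nu"
              unfolding C_def using G0 nu mult_right_mono[of 2 "16 * Ws * (br.Cw * (1 + c1)) + 2" "(3 + \<bar>\<Lambda>\<bar>) * nu"]
              by (simp add: mult_ac)
            then have "(G + 2 * nu) * (3 + \<bar>\<Lambda>\<bar>) \<le> C * (T + nu)" using CT by (simp add: distrib_left distrib_right)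
            from mult_right_mono[OF this th] sc[of "G + 2 * nu"] Gn nu
            show "(G + 2 * nu) * h * (\<bar>t - t'\<bar> / \<tau> + 3) \<le> C * (T + nu) * (\<bar>t - t'\<bar> + h)" by linarith
          qed
          also have "\<dots> = ennreal (C * (T + nu)) * ennreal (\<bar>t - t'\<bar> + h)" using C0 T nu th by (simp add: ennreal_mult)
          also have "\<dots> \<le> ennreal C * (N1 + ennreal nu) * ennreal (\<bar>t - t'\<bar> + h)"
          proof (intro mult_right_mono ennreal_bound_mono[of _ "C * (T + nu)" C "T + nu"])
            show "ennreal (T + nu) \<le> N1 + ennreal nu" using N1 T nu by (simp add: ennreal_plus add_mono)
          qed (use C0 T nu in auto)
          finally show "L1_norm UNIV (\<lambda>x. u t x - u t' x)
              \<le> ennreal C * (N1 + ennreal (norm (uR - uL))) * ennreal (\<bar>t - t'\<bar> + h)" unfolding nu_def .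
        qed
      qed
      show "let u0 = (\<lambda>x. if x < 0 then uL0 x else uR0 x);
           N2 = Linf_norm {..<0} (\<lambda>x. uL0 x - uL) + Linf_norm {0<..} (\<lambda>x. uR0 x - uR);
           N1 = TV {..<0} uL0 + TV {0<..} uR0 + (if V = sqrt k3 then N2 else 0)
       in (snd uL < wM \<and> wm < snd uR \<longrightarrow> (\<exists>u. glimm_approximation \<tau> h a u0 u)) \<and>
          (\<forall>u. glimm_approximation \<tau> h a u0 u \<longrightarrow>
            (\<exists>chi. phase_boundary u chi \<and>
              (let u' = (\<lambda>t x. if x < chi t then uL else uR) in
                \<forall>t\<ge>0. \<forall>t'\<ge>0.
                  TV UNIV (\<lambda>x. u t x - u' t x) \<le> ennreal C * N1 \<and>
                  Linf_norm UNIV (\<lambda>x. u t x - u' t x) \<le> ennreal C * (N1 + N2) \<and>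
                  L1_norm UNIV (\<lambda>x. (u t x - u' t x) - (u t' x - u' t' x))
                    \<le> ennreal C * N1 * ennreal (\<bar>t - t'\<bar> + h) \<and>
                  L1_norm UNIV (\<lambda>x. u t x - u t' x)
                    \<le> ennreal C * (N1 + ennreal (norm (uR - uL))) * ennreal (\<bar>t - t'\<bar> + h))))"
        unfolding Let_def u0_def[symmetric] N2_def[symmetric] N1_def[symmetric]
        using ex est by blast
    qed
  qed
qed

end
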